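(* Let $\mathcal{G} = (G_1, \dots, G_T)$ be a temporal graph with $n$ vertices in which no snapshot has more than $k$ connected components. Then the minimum cost of a temporal sequence $2$-colouring of $\mathcal{G}$ can be computed in $O(T |E| 2^k + n T 2^{2k})$ time.
   Context: A temporal graph $(G_1, \dots, G_T)$ is a sequence of static graphs $G_t = (V, E_t)$ on a common vertex set $V$, $|V| = n$; $E = \bigcup_t E_t$ is the edge set of its underlying graph. A temporal sequence $2$-colouring is a sequence $\psi_1, \dots, \psi_T$ where $\psi_t : V \to \{0,1\}$ is a proper colouring of $G_t$; its cost is the number of pairs $(v, t)$, $1 \le t \le T-1$, with $\psi_t(v) \neq \psi_{t+1}(v)$. *)

theory Defs
  imports "HOL-Library.FuncSet"
begin

section \<open>Temporal graphs and temporal sequence 2-colourings\<close>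

text \<open>Snapshots are indexed by \<open>t \<in> {1..T}\<close>; the values of \<open>E\<close> and of a colouring sequence
  outside this range are irrelevant.\<close>

definition temporal_graph :: "'a set \<Rightarrow> nat \<Rightarrow> (nat \<Rightarrow> 'a set set) \<Rightarrow> bool" where
  "temporal_graph V T E \<longleftrightarrow>
     finite V \<and> V \<noteq> {} \<and> T \<ge> 1 \<and> (\<forall>t\<in>{1..T}. \<forall>e\<in>E t. e \<subseteq> V \<and> card e = 2)"

definition underlying_edges :: "nat \<Rightarrow> (nat \<Rightarrow> 'a set set) \<Rightarrow> 'a set set" where
  "underlying_edges T E = (\<Union>t\<in>{1..T}. E t)"

definition connected_components :: "'a set \<Rightarrow> 'a set set \<Rightarrow> 'a set set" where
  "connected_components V F = V // {(u, v). u \<in> V \<and> v \<in> V \<and> (u, v) \<in> {(a, b). {a, b} \<in> F}\<^sup>*}"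

definition proper_2_colouring :: "'a set \<Rightarrow> 'a set set \<Rightarrow> ('a \<Rightarrow> nat) \<Rightarrow> bool" where
  "proper_2_colouring V F f \<longleftrightarrow> f \<in> V \<rightarrow> {0, 1} \<and> (\<forall>u v. {u, v} \<in> F \<longrightarrow> f u \<noteq> f v)"

definition temporal_2_colouring ::
    "'a set \<Rightarrow> nat \<Rightarrow> (nat \<Rightarrow> 'a set set) \<Rightarrow> (nat \<Rightarrow> 'a \<Rightarrow> nat) \<Rightarrow> bool" where
  "temporal_2_colouring V T E \<psi> \<longleftrightarrow> (\<forall>t\<in>{1..T}. proper_2_colouring V (E t) (\<psi> t))"

definition colouring_cost :: "'a set \<Rightarrow> nat \<Rightarrow> (nat \<Rightarrow> 'a \<Rightarrow> nat) \<Rightarrow> nat" where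
  "colouring_cost V T \<psi> = card {(v, t). v \<in> V \<and> t \<in> {1..T - 1} \<and> \<psi> t v \<noteq> \<psi> (t + 1) v}"

text \<open>The value is \<open>None\<close> if some snapshot is not bipartite, so that no colouring exists.\<close>

definition min_colouring_cost :: "'a set \<Rightarrow> nat \<Rightarrow> (nat \<Rightarrow> 'a set set) \<Rightarrow> nat option" where
  "min_colouring_cost V T E =
     (if \<exists>\<psi>. temporal_2_colouring V T E \<psi>
      then Some (LEAST c. \<exists>\<psi>. temporal_2_colouring V T E \<psi> \<and> colouring_cost V T \<psi> = c)
      else None)"


section \<open>A unit-cost random access machine\<close>

text \<open>Programs work on finitely many registers (those they mention) and on a memory of cells addressed
  by natural numbers. As is usual for the unit-cost RAM, the only arithmetic is addition
  and (truncated) subtraction: unit-cost multiplication would make the model unrealistically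
  strong. Every constant, register access, memory access, arithmetic operation, test, and
  assignment costs one time unit.\<close>

datatype aexp =
    Const nat
  | Reg nat
  | Load aexp
  | Add aexp aexp
  | Sub aexp aexp

datatype bexp =
    Less aexp aexp
  | Equal aexp aexp

datatype com =
    Skip
  | Assign nat aexp
  | Store aexp aexp
  | Seq com com
  | Cond bexp com com
  | While bexp com

record state =
  regs :: "nat \<Rightarrow> nat"
  mem :: "nat \<Rightarrow> nat"

primrec aval :: "aexp \<Rightarrow> state \<Rightarrow> nat" where
  "aval (Const c) s = c"
| "aval (Reg r) s = regs s r"
| "aval (Load a) s = mem s (aval a s)"
| "aval (Add a b) s = aval a s + aval b s"
| "aval (Sub a b) s = aval a s - aval b s"

primrec acost :: "aexp \<Rightarrow> nat" where
  "acost (Const c) = 1"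
| "acost (Reg r) = 1"
| "acost (Load a) = acost a + 1"
| "acost (Add a b) = acost a + acost b + 1"
| "acost (Sub a b) = acost a + acost b + 1"

primrec bval :: "bexp \<Rightarrow> state \<Rightarrow> bool" where
  "bval (Less a b) s \<longleftrightarrow> aval a s < aval b s"
| "bval (Equal a b) s \<longleftrightarrow> aval a s = aval b s"

primrec bcost :: "bexp \<Rightarrow> nat" where
  "bcost (Less a b) = acost a + acost b + 1"
| "bcost (Equal a b) = acost a + acost b + 1"

text \<open>\<open>exec c s d s'\<close>: started in \<open>s\<close>, program \<open>c\<close> halts in \<open>s'\<close> after \<open>d\<close> time units.\<close>

inductive exec :: "com \<Rightarrow> state \<Rightarrow> nat \<Rightarrow> state \<Rightarrow> bool" where
  Skip: "exec Skip s 1 s"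
| Assign: "exec (Assign r a) s (acost a + 1) (s\<lparr>regs := (regs s)(r := aval a s)\<rparr>)"
| Store: "exec (Store a b) s (acost a + acost b + 1) (s\<lparr>mem := (mem s)(aval a s := aval b s)\<rparr>)"
| Seq: "exec c\<^sub>1 s d\<^sub>1 s' \<Longrightarrow> exec c\<^sub>2 s' d\<^sub>2 s'' \<Longrightarrow> exec (Seq c\<^sub>1 c\<^sub>2) s (d\<^sub>1 + d\<^sub>2) s''"
| CondTrue: "bval b s \<Longrightarrow> exec c\<^sub>1 s d s' \<Longrightarrow> exec (Cond b c\<^sub>1 c\<^sub>2) s (bcost b + d) s'"
| CondFalse: "\<not> bval b s \<Longrightarrow> exec c\<^sub>2 s d s' \<Longrightarrow> exec (Cond b c\<^sub>1 c\<^sub>2) s (bcost b + d) s'"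
| WhileFalse: "\<not> bval b s \<Longrightarrow> exec (While b c) s (bcost b) s"
| WhileTrue: "bval b s \<Longrightarrow> exec c s d\<^sub>1 s' \<Longrightarrow> exec (While b c) s' d\<^sub>2 s'' \<Longrightarrow>
    exec (While b c) s (bcost b + d\<^sub>1 + d\<^sub>2) s''"

inductive_cases SkipE: "exec Skip s d s'"
  and AssignE: "exec (Assign r a) s d s'"
  and StoreE: "exec (Store a b) s d s'"
  and SeqE: "exec (Seq c\<^sub>1 c\<^sub>2) s d s'"
  and CondE: "exec (Cond b c\<^sub>1 c\<^sub>2) s d s'"
  and WhileE: "exec (While b c) s d s'"

lemma exec_deterministic:
  "exec c s d s' \<Longrightarrow> exec c s e s'' \<Longrightarrow> s' = s'' \<and> d = e"
proof (induction arbitrary: e s'' rule: exec.induct)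
  case (Skip s)
  then show ?case by (auto elim: SkipE)
next
  case (Assign r a s)
  then show ?case by (auto elim: AssignE)
next
  case (Store a b s)
  then show ?case by (auto elim: StoreE)
next
  case (Seq c\<^sub>1 s d\<^sub>1 s1 c\<^sub>2 d\<^sub>2 s2)
  then show ?case by (metis SeqE)
next
  case (CondTrue b s c\<^sub>1 d s1 c\<^sub>2)
  then show ?case by (metis CondE)
next
  case (CondFalse b s c\<^sub>2 d s1 c\<^sub>1)
  then show ?case by (metis CondE)
next
  case (WhileFalse b s c)
  then show ?case by (auto elim: WhileE)
next
  case (WhileTrue b s c d\<^sub>1 s1 d\<^sub>2 s2)
  from WhileTrue.prems \<open>bval b s\<close> obtain e\<^sub>1 e\<^sub>2 u
    where "exec c s e\<^sub>1 u" "exec (While b c) u e\<^sub>2 s''" "e = bcost b + e\<^sub>1 + e\<^sub>2"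
    by (auto elim: WhileE)
  then show ?case using WhileTrue.IH by blast
qed

definition initial_state :: "nat list \<Rightarrow> state" where
  "initial_state xs = \<lparr>regs = (\<lambda>_. 0), mem = (\<lambda>i. if i < length xs then xs ! i else 0)\<rparr>"

text \<open>An optional number is returned as a flag in register 0 and the number itself in register 1.\<close>

definition result_of :: "state \<Rightarrow> nat option" where
  "result_of s = (if regs s 0 = 0 then None else Some (regs s 1))"

definition computes_within :: "com \<Rightarrow> nat list \<Rightarrow> nat option \<Rightarrow> nat \<Rightarrow> bool" where
  "computes_within P xs r B \<longleftrightarrow>
     (\<exists>d s. exec P (initial_state xs) d s \<and> result_of s = r \<and> d \<le> B)"


section \<open>Temporal graphs as machine input\<close>

text \<open>A temporal graph on \<open>{..<n}\<close> is given by \<open>n\<close>, \<open>T\<close> and, for each snapshot, the number of its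
  edges followed by a list of the edges without repetition, in any order and orientation.\<close>

definition edge_list :: "(nat \<times> nat) list \<Rightarrow> nat set set \<Rightarrow> bool" where
  "edge_list L F \<longleftrightarrow>
     distinct (map (\<lambda>(u, v). {u, v}) L) \<and> set (map (\<lambda>(u, v). {u, v}) L) = F"

definition edge_lists :: "(nat \<times> nat) list list \<Rightarrow> nat \<Rightarrow> (nat \<Rightarrow> nat set set) \<Rightarrow> bool" where
  "edge_lists Ls T E \<longleftrightarrow> length Ls = T \<and> (\<forall>t\<in>{1..T}. edge_list (Ls ! (t - 1)) (E t))"

definition encode :: "nat \<Rightarrow> (nat \<times> nat) list list \<Rightarrow> nat list" where
  "encode n Ls =
     n # length Ls # concat (map (\<lambda>L. length L # concat (map (\<lambda>(u, v). [u, v]) L)) Ls)"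

end

theory Submission
  imports Defs
begin

text \<open>
  Process the snapshots in order and keep a table of colourings of the current snapshot, each with the
  least cost of a sequence that ends in it. A breadth-first search yields a spanning forest, and a proper
  2-colouring is determined by the colours of the at most \<open>k\<close> roots, so running through all root colours
  produces at most \<open>2 ^ k\<close> candidates, each checked against the edges in linear time. Comparing every
  surviving candidate with every entry of the previous table costs \<open>n * 2 ^ (2 * k)\<close> per snapshot.

  Programs are written in a small language with named registers and unboundedly long arrays. Since the
  machine has no multiplication, the arrays are interleaved in memory with stride 16, behind the input.
\<close>

text \<open>Stored costs are one more than real ones, so that 0 can stand for "no value". An
  improper candidate, an empty table and a snapshot that is not bipartite then need no separate
  treatment: the best cost simply stays 0, and the final answer is \<open>None\<close> exactly when
  it is 0 at the end. The candidates of a snapshot are produced in place. The root colours form a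
  binary number; adding 1 to it and recolouring the remaining vertices in search order takes time
  linear in \<open>n\<close>, which is affordable because every proper candidate is compared with
  the whole previous table anyway. Completeness rests on the fact that two colourings compatible
  with the forest and of the same number agree. Forest edges are respected by construction, but
  another edge may close an odd cycle, hence the test of each candidate. Products such as
  \<open>i * n\<close> are never computed: registers holding them move along with the loops by steps
  of 1. Space is not restricted, so each table is appended behind its predecessor and nothing has to
  be copied back.\<close>

section \<open>A language with arrays\<close>

text \<open>The input cells \<open>rES..<rEE\<close> hold the edges of the current snapshot. The table is kept in \<open>CS\<close>
  and \<open>DD\<close>: its entries \<open>rLO..<rHI\<close> belong to the previous snapshot and \<open>rHI..<rZ\<close> to the current
  one, and \<open>rQLO, rQHI, rQZ\<close> are the offsets \<open>n * rLO, n * rHI, n * rZ\<close> into \<open>CS\<close>.\<close>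

datatype reg = rN | rT | rP | rES | rEE | rJ | rV | rU | rW | rA | rQH | rQT | rRT
  | rCY | rOK | rBEST | rI | rQ | rDV | rLO | rHI | rZ | rQLO | rQHI | rQZ | rG

datatype arr = IN | HEAD | NXT | TGT | ORD | PAR | COL | CS | DD

text \<open>Codes start at 2. Register 0 holds the address at which the arrays begin, register 1 is
  scratch space for the preparation of the memory, and both finally receive the result.\<close>

primrec rcode :: "reg \<Rightarrow> nat" where
  "rcode rN = 2" | "rcode rT = 3" | "rcode rP = 4" | "rcode rES = 5" | "rcode rEE = 6"
| "rcode rJ = 7" | "rcode rV = 8" | "rcode rU = 9" | "rcode rW = 10" | "rcode rA = 11"
| "rcode rQH = 12" | "rcode rQT = 13" | "rcode rRT = 14" | "rcode rCY = 15" | "rcode rOK = 16"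
| "rcode rBEST = 17" | "rcode rI = 18" | "rcode rQ = 19" | "rcode rDV = 20" | "rcode rLO = 21"
| "rcode rHI = 22" | "rcode rZ = 23" | "rcode rQLO = 24" | "rcode rQHI = 25" | "rcode rQZ = 26"
| "rcode rG = 27"

primrec acode :: "arr \<Rightarrow> nat" where
  "acode IN = 0" | "acode HEAD = 1" | "acode NXT = 2" | "acode TGT = 3" | "acode ORD = 4"
| "acode PAR = 5" | "acode COL = 6" | "acode CS = 7" | "acode DD = 8"

lemma rcode_inject [simp]: "rcode r = rcode r' \<longleftrightarrow> r = r'"
  by (cases r; cases r'; simp)

lemma rcode_nonzero [simp]: "rcode r \<noteq> 0"
  by (cases r) simp_all

lemma acode_inject [simp]: "acode a = acode a' \<longleftrightarrow> a = a'"
  by (cases a; cases a'; simp)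

lemma acode_less: "acode a < 16"
  by (cases a) simp_all

record hstate =
  hr :: "reg \<Rightarrow> nat"
  ha :: "arr \<Rightarrow> nat \<Rightarrow> nat"

definition view :: "state \<Rightarrow> hstate" where
  "view s = \<lparr>hr = \<lambda>r. regs s (rcode r), ha = \<lambda>a i. mem s (regs s 0 + (16 * i + acode a))\<rparr>"

datatype hexp = N nat | R reg | Ld arr hexp | Plus hexp hexp | Minus hexp hexp

datatype hbexp = LessH hexp hexp | EqualH hexp hexp

datatype hcom =
    SkipH
  | SetH reg hexp  (\<open>_ :=\<^sub>r _\<close> [80, 61] 61)
  | StoreH arr hexp hexp
  | SeqH hcom hcom  (infixr \<open>;;\<close> 60)
  | CondH hbexp hcom hcom
  | WhileH hbexp hcom

primrec hval :: "hexp \<Rightarrow> hstate \<Rightarrow> nat" where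
  "hval (N c) h = c"
| "hval (R r) h = hr h r"
| "hval (Ld a e) h = ha h a (hval e h)"
| "hval (Plus e f) h = hval e h + hval f h"
| "hval (Minus e f) h = hval e h - hval f h"

primrec hbval :: "hbexp \<Rightarrow> hstate \<Rightarrow> bool" where
  "hbval (LessH e f) h \<longleftrightarrow> hval e h < hval f h"
| "hbval (EqualH e f) h \<longleftrightarrow> hval e h = hval f h"

section \<open>Compilation of the array language to the machine\<close>

definition double :: "aexp \<Rightarrow> aexp" where
  "double e = Add e e"

definition address :: "arr \<Rightarrow> aexp \<Rightarrow> aexp" where
  "address a e = Add (Reg 0) (Add (double (double (double (double e)))) (Const (acode a)))"

primrec compile_exp :: "hexp \<Rightarrow> aexp" where
  "compile_exp (N c) = Const c"
| "compile_exp (R r) = Reg (rcode r)"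
| "compile_exp (Ld a e) = Load (address a (compile_exp e))"
| "compile_exp (Plus e f) = Add (compile_exp e) (compile_exp f)"
| "compile_exp (Minus e f) = Sub (compile_exp e) (compile_exp f)"

primrec compile_bexp :: "hbexp \<Rightarrow> bexp" where
  "compile_bexp (LessH e f) = Less (compile_exp e) (compile_exp f)"
| "compile_bexp (EqualH e f) = Equal (compile_exp e) (compile_exp f)"

primrec compile :: "hcom \<Rightarrow> com" where
  "compile SkipH = Skip"
| "compile (SetH r e) = Assign (rcode r) (compile_exp e)"
| "compile (StoreH a e f) = Store (address a (compile_exp e)) (compile_exp f)"
| "compile (SeqH c d) = Seq (compile c) (compile d)"
| "compile (CondH b c d) = Cond (compile_bexp b) (compile c) (compile d)"
| "compile (WhileH b c) = While (compile_bexp b) (compile c)"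

lemma aval_address: "aval (address a e) s = regs s 0 + (16 * aval e s + acode a)"
  by (simp add: address_def double_def)

text \<open>Four nested doublings evaluate the index expression 16 times. This is why the constants
  in the time bounds of the loops are so large.\<close>

lemma acost_address: "acost (address a e) = 16 * acost e + 19"
  by (simp add: address_def double_def)

lemma aval_compile: "aval (compile_exp e) s = hval e (view s)"
  by (induction e) (simp_all add: aval_address view_def)

lemma bval_compile: "bval (compile_bexp b) s = hbval b (view s)"
  by (cases b) (simp_all add: aval_compile)

lemma address_inject: "16 * i + acode a = 16 * j + acode b \<longleftrightarrow> i = j \<and> a = b"
proof
  assume eq: "16 * i + acode a = 16 * j + acode b"
  have "(16 * i + acode a) div 16 = (16 * j + acode b) div 16" by (simp only: eq)
  then have "i = j" using acode_less[of a] acode_less[of b] by simp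
  then show "i = j \<and> a = b" using eq by simp
qed simp

text \<open>No named register has code 0, so an assignment leaves the base address, and with it
  every array, in place.\<close>

lemma view_set:
  "view (s\<lparr>regs := (regs s)(rcode r := x)\<rparr>) = (view s)\<lparr>hr := (hr (view s))(r := x)\<rparr>"
  by (simp add: view_def fun_eq_iff)

lemma view_store:
  "view (s\<lparr>mem := (mem s)(regs s 0 + (16 * i + acode a) := x)\<rparr>)
     = (view s)\<lparr>ha := (ha (view s))(a := (ha (view s) a)(i := x))\<rparr>"
  by (auto simp: view_def fun_eq_iff address_inject)

section \<open>Total correctness with running time\<close>

definition runs :: "hcom \<Rightarrow> hstate \<Rightarrow> nat \<Rightarrow> (hstate \<Rightarrow> bool) \<Rightarrow> bool" where
  "runs c h B Q \<longleftrightarrow> (\<forall>s. view s = h \<longrightarrow> (\<exists>d s'. exec (compile c) s d s' \<and> d \<le> B \<and> Q (view s')))"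

lemma runs_mono: "runs c h B Q \<Longrightarrow> B \<le> B' \<Longrightarrow> (\<And>h'. Q h' \<Longrightarrow> Q' h') \<Longrightarrow> runs c h B' Q'"
  unfolding runs_def by (metis le_trans)

lemma runs_Seq:
  assumes "runs c h B Q" "\<And>h'. Q h' \<Longrightarrow> runs d h' B' Q'"
  shows "runs (c ;; d) h (B + B') Q'"
  unfolding runs_def
proof (intro allI impI)
  fix s assume "view s = h"
  then obtain e s' where 1: "exec (compile c) s e s'" "e \<le> B" "Q (view s')"
    using assms(1) unfolding runs_def by blast
  then obtain f s'' where 2: "exec (compile d) s' f s''" "f \<le> B'" "Q' (view s'')"
    using assms(2) unfolding runs_def by blast
  have "exec (compile (c ;; d)) s (e + f) s''" using 1 2 by (auto intro: exec.intros)
  then show "\<exists>d' s'. exec (compile (c ;; d)) s d' s' \<and> d' \<le> B + B' \<and> Q' (view s')"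
    using 1 2 by (meson add_mono)
qed

lemma runs_Cond:
  assumes "hbval b h \<Longrightarrow> runs c h B Q" "\<not> hbval b h \<Longrightarrow> runs d h B Q"
  shows "runs (CondH b c d) h (bcost (compile_bexp b) + B) Q"
  unfolding runs_def
proof (intro allI impI)
  fix s assume s: "view s = h"
  have "runs (if hbval b h then c else d) h B Q" using assms by simp
  then obtain e s' where 1: "exec (compile (if hbval b h then c else d)) s e s'" "e \<le> B" "Q (view s')"
    using s unfolding runs_def by blast
  then have "exec (compile (CondH b c d)) s (bcost (compile_bexp b) + e) s'"
    using s by (cases "hbval b h") (simp_all add: bval_compile exec.CondTrue exec.CondFalse)
  then show "\<exists>d' s'. exec (compile (CondH b c d)) s d' s' \<and> d' \<le> bcost (compile_bexp b) + B \<and> Q (view s')"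
    using 1 by (meson add_left_mono)
qed

section \<open>Symbolic execution of loop-free commands\<close>

primrec straight :: "hcom \<Rightarrow> bool" where
  "straight SkipH \<longleftrightarrow> True"
| "straight (SetH r e) \<longleftrightarrow> True"
| "straight (StoreH a e f) \<longleftrightarrow> True"
| "straight (SeqH c d) \<longleftrightarrow> straight c \<and> straight d"
| "straight (CondH b c d) \<longleftrightarrow> straight c \<and> straight d"
| "straight (WhileH b c) \<longleftrightarrow> False"

text \<open>The clauses for loops are junk: both functions are only used on loop-free commands.\<close>

primrec run :: "hcom \<Rightarrow> hstate \<Rightarrow> hstate" where
  "run SkipH h = h"
| "run (SetH r e) h = h\<lparr>hr := (hr h)(r := hval e h)\<rparr>"
| "run (StoreH a e f) h = h\<lparr>ha := (ha h)(a := (ha h a)(hval e h := hval f h))\<rparr>"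
| "run (SeqH c d) h = run d (run c h)"
| "run (CondH b c d) h = (if hbval b h then run c h else run d h)"
| "run (WhileH b c) h = h"

text \<open>An upper bound rather than the exact time: both branches of a conditional are charged,
  which makes the bound independent of the state.\<close>

primrec hcost :: "hcom \<Rightarrow> nat" where
  "hcost SkipH = 1"
| "hcost (SetH r e) = acost (compile_exp e) + 1"
| "hcost (StoreH a e f) = acost (address a (compile_exp e)) + acost (compile_exp f) + 1"
| "hcost (SeqH c d) = hcost c + hcost d"
| "hcost (CondH b c d) = bcost (compile_bexp b) + hcost c + hcost d"
| "hcost (WhileH b c) = 0"

lemma runs_straight_exact: "straight c \<Longrightarrow> runs c h (hcost c) (\<lambda>h'. h' = run c h)"
proof (induction c arbitrary: h)
  case SkipH
  show ?case unfolding runs_def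
  proof (intro allI impI exI conjI)
    fix s assume "view s = h"
    then show "view s = run SkipH h" by simp
    show "exec (compile SkipH) s 1 s" by (simp only: compile.simps exec.Skip)
  qed simp
next
  case (SetH r e)
  show ?case unfolding runs_def
  proof (intro allI impI exI conjI)
    fix s assume s: "view s = h"
    show "exec (compile (SetH r e)) s (acost (compile_exp e) + 1)
      (s\<lparr>regs := (regs s)(rcode r := aval (compile_exp e) s)\<rparr>)"
      by (simp only: compile.simps exec.Assign)
    show "view (s\<lparr>regs := (regs s)(rcode r := aval (compile_exp e) s)\<rparr>) = run (SetH r e) h"
      by (simp add: view_set aval_compile s)
  qed simp
next
  case (StoreH a e f)
  let ?a = "address a (compile_exp e)" and ?f = "compile_exp f"
  show ?case unfolding runs_def
  proof (intro allI impI exI conjI)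
    fix s assume s: "view s = h"
    show "exec (compile (StoreH a e f)) s (acost ?a + acost ?f + 1)
      (s\<lparr>mem := (mem s)(aval ?a s := aval ?f s)\<rparr>)"
      by (simp only: compile.simps exec.Store)
    show "view (s\<lparr>mem := (mem s)(aval ?a s := aval ?f s)\<rparr>) = run (StoreH a e f) h"
      by (simp add: view_store aval_address aval_compile s)
  qed simp
next
  case (SeqH c d)
  then show ?case by (auto intro: runs_Seq)
next
  case (CondH b c d)
  have "runs (CondH b c d) h (bcost (compile_bexp b) + (hcost c + hcost d)) (\<lambda>h'. h' = run (CondH b c d) h)"
  proof (rule runs_Cond)
    assume "hbval b h"
    moreover have "runs c h (hcost c) (\<lambda>h'. h' = run c h)" using CondH by simp
    ultimately show "runs c h (hcost c + hcost d) (\<lambda>h'. h' = run (CondH b c d) h)"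
      by (elim runs_mono) simp_all
  next
    assume "\<not> hbval b h"
    moreover have "runs d h (hcost d) (\<lambda>h'. h' = run d h)" using CondH by simp
    ultimately show "runs d h (hcost c + hcost d) (\<lambda>h'. h' = run (CondH b c d) h)"
      by (elim runs_mono) simp_all
  qed
  then show ?case by (simp add: add.assoc)
qed simp

lemma runs_straight: "straight c \<Longrightarrow> hcost c \<le> B \<Longrightarrow> Q (run c h) \<Longrightarrow> runs c h B Q"
  by (rule runs_mono[OF runs_straight_exact]) auto

section \<open>Framing: registers and arrays that a command does not write\<close>

primrec wregs :: "hcom \<Rightarrow> reg set" where
  "wregs SkipH = {}"
| "wregs (SetH r e) = {r}"
| "wregs (StoreH a e f) = {}"
| "wregs (SeqH c d) = wregs c \<union> wregs d"
| "wregs (CondH b c d) = wregs c \<union> wregs d"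
| "wregs (WhileH b c) = wregs c"

primrec warrs :: "hcom \<Rightarrow> arr set" where
  "warrs SkipH = {}"
| "warrs (SetH r e) = {}"
| "warrs (StoreH a e f) = {a}"
| "warrs (SeqH c d) = warrs c \<union> warrs d"
| "warrs (CondH b c d) = warrs c \<union> warrs d"
| "warrs (WhileH b c) = warrs c"

definition frame :: "hcom \<Rightarrow> hstate \<Rightarrow> hstate \<Rightarrow> bool" where
  "frame c h h' \<longleftrightarrow> (\<forall>r. r \<notin> wregs c \<longrightarrow> hr h' r = hr h r) \<and> (\<forall>a. a \<notin> warrs c \<longrightarrow> ha h' a = ha h a)"

lemma frame_reg: "frame c h h' \<Longrightarrow> r \<notin> wregs c \<Longrightarrow> hr h' r = hr h r"
  and frame_arr: "frame c h h' \<Longrightarrow> a \<notin> warrs c \<Longrightarrow> ha h' a = ha h a"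
  by (auto simp: frame_def)

lemmas frameD = frame_reg frame_arr

lemma frame_refl: "frame c h h"
  by (simp add: frame_def)

lemma frame_trans: "frame c h h' \<Longrightarrow> frame c h' h'' \<Longrightarrow> frame c h h''"
  by (simp add: frame_def)

lemma exec_frame: "exec (compile c) s d s' \<Longrightarrow> frame c (view s) (view s')"
proof (induction c arbitrary: s d s')
  case SkipH
  then show ?case by (auto elim: SkipE simp: frame_refl)
next
  case (SetH r e)
  then show ?case by (auto elim!: AssignE simp: frame_def view_set)
next
  case (StoreH a e f)
  then show ?case by (auto elim!: StoreE simp: frame_def view_store aval_address)
next
  case (SeqH c1 c2)
  from SeqH.prems obtain d1 s1 d2 where "exec (compile c1) s d1 s1" "exec (compile c2) s1 d2 s'"
    by (auto elim: SeqE)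
  then have "frame c1 (view s) (view s1)" "frame c2 (view s1) (view s')" using SeqH.IH by auto
  then show ?case by (simp add: frame_def)
next
  case (CondH b c1 c2)
  from CondH.prems obtain d1 where "exec (compile c1) s d1 s' \<or> exec (compile c2) s d1 s'"
    by (auto elim: CondE)
  then have "frame c1 (view s) (view s') \<or> frame c2 (view s) (view s')" using CondH.IH by auto
  then show ?case by (auto simp: frame_def)
next
  case (WhileH b c)
  \<comment> \<open>The structural induction hypothesis covers the body only, so the iterations need
    an induction over the derivation. The command is generalised to \<open>w\<close> for it.\<close>
  have "exec w s d s' \<Longrightarrow> w = compile (WhileH b c) \<Longrightarrow> frame c (view s) (view s')" for w
  proof (induction rule: exec.induct)
    case (WhileTrue b s c d1 s1 d2 s2)
    then show ?case using WhileH.IH by (auto intro: frame_trans)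
  qed (auto simp: frame_refl)
  with WhileH.prems show ?case by (auto simp: frame_def)
qed

lemma runs_frame: "runs c h B Q \<Longrightarrow> runs c h B (\<lambda>h'. Q h' \<and> frame c h h')"
  unfolding runs_def using exec_frame by blast

lemma runs_Seq_frame:
  assumes "runs c h B Q" "\<And>h'. Q h' \<Longrightarrow> frame c h h' \<Longrightarrow> runs d h' B' Q'" "B + B' \<le> B''"
  shows "runs (c ;; d) h B'' Q'"
  using runs_mono[OF runs_Seq[OF runs_frame[OF assms(1)] assms(2)] assms(3)] by auto

lemma runs_straight_Seq:
  assumes "straight c" "runs d (run c h) B' Q" "hcost c + B' \<le> B"
  shows "runs (c ;; d) h B Q"
  using runs_mono[OF runs_Seq[OF runs_straight_exact[OF assms(1)]] assms(3)] assms(2) by auto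

section \<open>Rules for loops\<close>

text \<open>The second argument of the invariant bounds the number of remaining iterations.\<close>

lemma runs_While_aux:
  assumes "\<And>h m. I h m \<Longrightarrow> hbval b h \<Longrightarrow> runs c h K (\<lambda>h'. \<exists>m'<m. I h' (m' :: nat))" and "I h m"
  shows "runs (WhileH b c) h (m * (K + bcost (compile_bexp b)) + bcost (compile_bexp b))
    (\<lambda>h'. (\<exists>m'. I h' m') \<and> \<not> hbval b h')"
  using \<open>I h m\<close>
proof (induction m arbitrary: h rule: less_induct)
  case (less m)
  let ?w = "bcost (compile_bexp b)" and ?W = "compile (WhileH b c)"
  let ?B = "\<lambda>m. m * (K + ?w) + ?w"
  show ?case unfolding runs_def
  proof (intro allI impI)
    fix s assume s: "view s = h"
    show "\<exists>d s'. exec ?W s d s' \<and> d \<le> ?B m \<and> (\<exists>m'. I (view s') m') \<and> \<not> hbval b (view s')"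
    proof (cases "hbval b h")
      case False
      then have "exec ?W s ?w s" using s by (auto intro: exec.intros simp: bval_compile)
      then show ?thesis using False s less.prems by (metis le_add2)
    next
      case True
      obtain d1 s1 m' where 1: "exec (compile c) s d1 s1" "d1 \<le> K" "I (view s1) m'" "m' < m"
        using assms(1)[OF less.prems True] s unfolding runs_def by blast
      then obtain d2 s2 where 2: "exec ?W s1 d2 s2" "d2 \<le> ?B m'"
        "\<exists>m'. I (view s2) m'" "\<not> hbval b (view s2)"
        using less.IH[of m' "view s1"] unfolding runs_def by blast
      have "exec ?W s (?w + d1 + d2) s2"
        using 1 2 True s by (auto intro: exec.WhileTrue simp: bval_compile)
      moreover have "?w + d1 + d2 \<le> ?B m"
      proof -
        have "Suc m' * (K + ?w) \<le> m * (K + ?w)" using 1 by (intro mult_le_mono1) simp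
        then show ?thesis using 1 2 by simp
      qed
      ultimately show ?thesis using 2 by blast
    qed
  qed
qed

text \<open>Adding the frame to the invariant means that concrete invariants need to mention only
  what the loop changes. The bound \<open>K' * (m + 1)\<close> charges the final failing test like a
  full iteration.\<close>

lemma runs_While:
  assumes "\<And>h m. I h m \<Longrightarrow> frame c h0 h \<Longrightarrow> hbval b h \<Longrightarrow> runs c h K (\<lambda>h'. \<exists>m'<m. I h' (m' :: nat))"
    and "I h0 m" and "K + bcost (compile_bexp b) \<le> K'" and "K' * (m + 1) \<le> B"
    and "\<And>h' m'. I h' m' \<Longrightarrow> frame c h0 h' \<Longrightarrow> \<not> hbval b h' \<Longrightarrow> Q h'"
  shows "runs (WhileH b c) h0 B Q"
proof (rule runs_mono)
  let ?w = "bcost (compile_bexp b)"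
  show "runs (WhileH b c) h0 (m * (K + ?w) + ?w) (\<lambda>h'. (\<exists>m'. I h' m' \<and> frame c h0 h') \<and> \<not> hbval b h')"
  proof (rule runs_While_aux)
    fix h m assume h: "I h m \<and> frame c h0 h" "hbval b h"
    then have "runs c h K (\<lambda>h'. \<exists>m'<m. I h' m')" using assms(1) by blast
    then show "runs c h K (\<lambda>h'. \<exists>m'<m. I h' m' \<and> frame c h0 h')"
      using h frame_trans by (elim runs_mono[OF runs_frame]) auto
  qed (use assms frame_refl in auto)
  have "m * (K + ?w) \<le> m * K'" using assms(3) by (rule mult_le_mono2)
  then show "m * (K + ?w) + ?w \<le> B" using assms(3,4) by (simp add: algebra_simps)
qed (use assms in auto)

lemma runs_While_straight:
  assumes "straight c" and "hcost c + bcost (compile_bexp b) \<le> K"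
    and "I h0 m" and "K * (m + 1) \<le> B"
    and "\<And>h m. I h m \<Longrightarrow> frame c h0 h \<Longrightarrow> hbval b h \<Longrightarrow> \<exists>m'<m. I (run c h) (m' :: nat)"
    and "\<And>h' m'. I h' m' \<Longrightarrow> frame c h0 h' \<Longrightarrow> \<not> hbval b h' \<Longrightarrow> Q h'"
  shows "runs (WhileH b c) h0 B Q"
  using assms by (intro runs_While[where I = I and K = "hcost c"] runs_straight) auto

section \<open>Colouring sequences and the dynamic program\<close>

definition proper :: "nat \<Rightarrow> nat set set \<Rightarrow> (nat \<Rightarrow> nat) \<Rightarrow> bool" where
  "proper n F x \<longleftrightarrow> (\<forall>v<n. x v \<in> {1, 2}) \<and> (\<forall>u v. {u, v} \<in> F \<longrightarrow> x u \<noteq> x v)"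

definition hamming :: "nat \<Rightarrow> (nat \<Rightarrow> nat) \<Rightarrow> (nat \<Rightarrow> nat) \<Rightarrow> nat" where
  "hamming n x y = card {v. v < n \<and> x v \<noteq> y v}"

text \<open>Colours are shifted to \<open>1, 2\<close>, and a sequence starts with a virtual snapshot 0 coloured
  constantly 0. The step from 0 to 1 then always costs \<open>n\<close>, and no snapshot needs special treatment.\<close>

definition admissible :: "nat \<Rightarrow> (nat \<Rightarrow> nat set set) \<Rightarrow> nat \<Rightarrow> (nat \<Rightarrow> nat \<Rightarrow> nat) \<Rightarrow> bool" where
  "admissible n E t \<psi> \<longleftrightarrow> (\<forall>v<n. \<psi> 0 v = 0) \<and> (\<forall>s\<in>{1..t}. proper n (E s) (\<psi> s))"

definition prefix_cost :: "nat \<Rightarrow> nat \<Rightarrow> (nat \<Rightarrow> nat \<Rightarrow> nat) \<Rightarrow> nat" where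
  "prefix_cost n t \<psi> = (\<Sum>s<t. hamming n (\<psi> s) (\<psi> (Suc s)))"

text \<open>The \<open>i\<close>-th entry of the table is the colouring \<open>\<lambda>v. cs (i * n + v)\<close> together with the number
  \<open>dd i\<close>, which is one more than the cost of a sequence ending in this colouring.\<close>

definition sound :: "nat \<Rightarrow> (nat \<Rightarrow> nat set set) \<Rightarrow> nat \<Rightarrow> (nat \<Rightarrow> nat) \<Rightarrow> (nat \<Rightarrow> nat) \<Rightarrow> nat \<Rightarrow> bool" where
  "sound n E t cs dd i \<longleftrightarrow>
     (\<exists>\<psi>. admissible n E t \<psi> \<and> (\<forall>v<n. \<psi> t v = cs (i * n + v)) \<and> dd i = Suc (prefix_cost n t \<psi>))"

text \<open>Where \<open>sound\<close> says that no entry is too small, this says that some entry is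
  small enough. Together they make the least entry optimal, whatever the order of the table and even
  if it contains duplicates.\<close>

definition covered ::
    "nat \<Rightarrow> nat \<Rightarrow> (nat \<Rightarrow> nat) \<Rightarrow> (nat \<Rightarrow> nat) \<Rightarrow> nat set \<Rightarrow> (nat \<Rightarrow> nat \<Rightarrow> nat) \<Rightarrow> bool" where
  "covered n t cs dd I \<psi> \<longleftrightarrow> (\<exists>i\<in>I. (\<forall>v<n. cs (i * n + v) = \<psi> t v) \<and> dd i \<le> Suc (prefix_cost n t \<psi>))"

text \<open>The value 0 plays the role of infinity, the minimum of the empty set. It cannot be
  confused with a stored cost, as these are positive by \<open>sound_pos\<close>.\<close>

definition minimum_or_0 :: "nat set \<Rightarrow> nat \<Rightarrow> bool" where
  "minimum_or_0 S b \<longleftrightarrow> (if S = {} then b = 0 else b \<in> S \<and> (\<forall>s\<in>S. b \<le> s))"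

lemma minimum_or_0_empty [simp]: "minimum_or_0 {} b \<longleftrightarrow> b = 0"
  by (simp add: minimum_or_0_def)

lemma minimum_or_0_insert:
  assumes "minimum_or_0 S b" "0 \<notin> S"
  shows "minimum_or_0 (insert a S) (if b = 0 then a else if a < b then a else b)"
  using assms by (auto simp: minimum_or_0_def split: if_splits)

lemma minimum_or_0_zero: "minimum_or_0 S 0 \<Longrightarrow> 0 \<notin> S \<Longrightarrow> S = {}"
  by (auto simp: minimum_or_0_def split: if_splits)

lemma sound_pos: "sound n E t cs dd i \<Longrightarrow> 0 < dd i"
  by (auto simp: sound_def)

lemma sound_cong:
  assumes "sound n E t cs dd i" "\<And>v. v < n \<Longrightarrow> cs' (i * n + v) = cs (i * n + v)" "dd' i = dd i"
  shows "sound n E t cs' dd' i"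
  using assms by (auto simp: sound_def)

lemma covered_cong:
  assumes "covered n t cs dd I \<psi>" "I \<subseteq> I'"
    and "\<And>i v. i \<in> I \<Longrightarrow> v < n \<Longrightarrow> cs' (i * n + v) = cs (i * n + v)" "\<And>i. i \<in> I \<Longrightarrow> dd' i = dd i"
  shows "covered n t cs' dd' I' \<psi>"
proof -
  obtain i where i: "i \<in> I" "\<forall>v<n. cs (i * n + v) = \<psi> t v" "dd i \<le> Suc (prefix_cost n t \<psi>)"
    using assms(1) unfolding covered_def by blast
  then show ?thesis using assms(2-4) unfolding covered_def by (intro bexI[of _ i]) auto
qed

section \<open>The recurrence of the dynamic program\<close>

lemma hamming_cong:
  "(\<And>v. v < n \<Longrightarrow> x v = x' v) \<Longrightarrow> (\<And>v. v < n \<Longrightarrow> y v = y' v) \<Longrightarrow> hamming n x y = hamming n x' y'"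
  unfolding hamming_def by (rule arg_cong[where f = card]) auto

lemma hamming_0 [simp]: "hamming 0 x y = 0"
  by (simp add: hamming_def)

lemma hamming_Suc: "hamming (Suc n) x y = hamming n x y + (if x n = y n then 0 else 1)"
proof -
  have "{v. v < Suc n \<and> x v \<noteq> y v} = (if x n = y n then {} else {n}) \<union> {v. v < n \<and> x v \<noteq> y v}"
    by (auto simp: less_Suc_eq)
  then show ?thesis by (simp add: hamming_def)
qed

text \<open>One half of the recurrence: a sequence that realises entry \<open>i\<close> is continued
  by \<open>x\<close>, and its earlier costs do not change because they involve positions up to
  \<open>t\<close> only. The other half, optimality, is \<open>covered_Suc\<close>.\<close>

lemma sound_Suc:
  assumes "sound n E t cs dd i" "proper n (E (Suc t)) x"
    and "\<And>v. v < n \<Longrightarrow> cs' (j * n + v) = x v"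
    and "dd' j = dd i + hamming n (\<lambda>v. cs (i * n + v)) x"
  shows "sound n E (Suc t) cs' dd' j"
proof -
  obtain \<psi> where \<psi>: "admissible n E t \<psi>" "\<And>v. v < n \<Longrightarrow> \<psi> t v = cs (i * n + v)"
    "dd i = Suc (prefix_cost n t \<psi>)"
    using assms(1) by (auto simp: sound_def)
  let ?\<phi> = "\<psi>(Suc t := x)"
  have "admissible n E (Suc t) ?\<phi>" using \<psi>(1) assms(2) by (auto simp: admissible_def)
  moreover have "\<forall>v<n. ?\<phi> (Suc t) v = cs' (j * n + v)" using assms(3) by simp
  moreover have "prefix_cost n (Suc t) ?\<phi> = prefix_cost n t \<psi> + hamming n (\<psi> t) x"
    by (simp add: prefix_cost_def)
  moreover have "hamming n (\<psi> t) x = hamming n (\<lambda>v. cs (i * n + v)) x"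
    by (rule hamming_cong) (simp_all add: \<psi>(2))
  ultimately show ?thesis using \<psi>(3) assms(4) unfolding sound_def by (intro exI[of _ ?\<phi>]) simp
qed

lemma covered_Suc:
  assumes "covered n t cs dd I \<psi>" "\<And>v. v < n \<Longrightarrow> \<psi> (Suc t) v = x v"
    and "\<And>v. v < n \<Longrightarrow> cs' (j * n + v) = x v" "j \<in> J"
    and "\<And>i. i \<in> I \<Longrightarrow> dd' j \<le> dd i + hamming n (\<lambda>v. cs (i * n + v)) x"
  shows "covered n (Suc t) cs' dd' J \<psi>"
proof -
  obtain i where i: "i \<in> I" "\<And>v. v < n \<Longrightarrow> cs (i * n + v) = \<psi> t v" "dd i \<le> Suc (prefix_cost n t \<psi>)"
    using assms(1) by (auto simp: covered_def)
  have "hamming n (\<lambda>v. cs (i * n + v)) x = hamming n (\<psi> t) (\<psi> (Suc t))"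
    by (rule hamming_cong) (simp_all add: i(2) assms(2))
  then have "dd' j \<le> Suc (prefix_cost n (Suc t) \<psi>)"
    using assms(5)[OF i(1)] i(3) by (simp add: prefix_cost_def)
  then show ?thesis using assms(2-4) unfolding covered_def by (intro bexI[of _ j]) auto
qed

lemma admissible_Suc: "admissible n E (Suc t) \<psi> \<longleftrightarrow> admissible n E t \<psi> \<and> proper n (E (Suc t)) (\<psi> (Suc t))"
  by (auto simp: admissible_def atLeastAtMostSuc_conv)

section \<open>From the table to the optimum\<close>

lemma colouring_cost_eq_sum:
  "colouring_cost {..<n} T \<psi> = (\<Sum>s\<in>{1..<T}. hamming n (\<psi> s) (\<psi> (Suc s)))"
proof -
  have "{(v, t). v \<in> {..<n} \<and> t \<in> {1..T - 1} \<and> \<psi> t v \<noteq> \<psi> (t + 1) v}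
      = prod.swap ` (SIGMA s:{1..<T}. {v. v < n \<and> \<psi> s v \<noteq> \<psi> (Suc s) v})"
    by force
  then have "colouring_cost {..<n} T \<psi> = card (SIGMA s:{1..<T}. {v. v < n \<and> \<psi> s v \<noteq> \<psi> (Suc s) v})"
    unfolding colouring_cost_def by (simp add: card_image)
  then show ?thesis by (simp add: hamming_def)
qed

lemma prefix_cost_eq_colouring_cost:
  assumes "admissible n E T \<psi>" "T \<ge> 1"
    and "\<And>s v. s \<in> {1..T} \<Longrightarrow> v < n \<Longrightarrow> \<psi> s v = Suc (\<phi> s v)"
  shows "prefix_cost n T \<psi> = n + colouring_cost {..<n} T \<phi>"
proof -
  have "{..<T} = insert 0 {1..<T}" using assms(2) by auto
  then have "prefix_cost n T \<psi> = hamming n (\<psi> 0) (\<psi> 1) + (\<Sum>s\<in>{1..<T}. hamming n (\<psi> s) (\<psi> (Suc s)))"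
    by (simp add: prefix_cost_def)
  moreover have "hamming n (\<psi> 0) (\<psi> 1) = card {..<n}"
    unfolding hamming_def using assms by (intro arg_cong[where f = card]) (auto simp: admissible_def)
  moreover have "(\<Sum>s\<in>{1..<T}. hamming n (\<psi> s) (\<psi> (Suc s))) = (\<Sum>s\<in>{1..<T}. hamming n (\<phi> s) (\<phi> (Suc s)))"
    by (rule sum.cong) (auto simp: hamming_def assms(3) intro!: arg_cong[where f = card])
  ultimately show ?thesis by (simp add: colouring_cost_eq_sum)
qed

text \<open>In \<open>g - 1 - n\<close>, the 1 is the offset of the stored costs and
  \<open>n\<close> is the cost of the step out of the virtual snapshot 0.\<close>

lemma min_colouring_cost_from_table:
  assumes G: "temporal_graph {..<n} T E"
    and snd: "\<And>i. i \<in> I \<Longrightarrow> sound n E T cs dd i"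
    and cov: "\<And>\<psi>. admissible n E T \<psi> \<Longrightarrow> covered n T cs dd I \<psi>"
    and g: "minimum_or_0 (dd ` I) g"
  shows "min_colouring_cost {..<n} T E = (if g = 0 then None else Some (g - 1 - n))"
proof -
  have T: "T \<ge> 1" using G by (simp add: temporal_graph_def)
  have edges: "u < n \<and> v < n" if "t \<in> {1..T}" "{u, v} \<in> E t" for t u v
  proof -
    have "{u, v} \<subseteq> {..<n}" using G that unfolding temporal_graph_def by blast
    then show ?thesis by simp
  qed
  have bound: "g \<noteq> 0 \<and> g \<le> Suc (n + colouring_cost {..<n} T \<phi>)" if \<phi>: "temporal_2_colouring {..<n} T E \<phi>" for \<phi>
  proof -
    let ?\<psi> = "\<lambda>s v. if s = 0 then 0 else Suc (\<phi> s v)"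
    have adm: "admissible n E T ?\<psi>"
      using \<phi> unfolding admissible_def temporal_2_colouring_def proper_2_colouring_def proper_def
      by (auto simp: Pi_iff)
    have "prefix_cost n T ?\<psi> = n + colouring_cost {..<n} T \<phi>"
      by (rule prefix_cost_eq_colouring_cost[OF adm T]) auto
    then obtain i where i: "i \<in> I" "dd i \<le> Suc (n + colouring_cost {..<n} T \<phi>)"
      using cov[OF adm] by (auto simp: covered_def)
    moreover have "g \<in> dd ` I \<and> g \<le> dd i" using g i(1) by (auto simp: minimum_or_0_def split: if_splits)
    moreover have "\<forall>d\<in>dd ` I. 0 < d" using snd sound_pos by blast
    ultimately show ?thesis by (metis le_trans less_irrefl)
  qed
  have attained: "\<exists>\<phi>. temporal_2_colouring {..<n} T E \<phi> \<and> g = Suc (n + colouring_cost {..<n} T \<phi>)" if "g \<noteq> 0"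
  proof -
    obtain i where "i \<in> I" "g = dd i" using g \<open>g \<noteq> 0\<close> by (auto simp: minimum_or_0_def split: if_splits)
    then obtain \<psi> where \<psi>: "admissible n E T \<psi>" "g = Suc (prefix_cost n T \<psi>)"
      using snd by (auto simp: sound_def)
    let ?\<phi> = "\<lambda>s v. \<psi> s v - 1"
    have val: "\<psi> s v \<in> {1, 2}" if "s \<in> {1..T}" "v < n" for s v
      using \<psi>(1) that by (auto simp: admissible_def proper_def)
    \<comment> \<open>Truncated subtraction of 1 separates colours only because both are 1 or 2,
      which is known for vertices below \<open>n\<close>. Hence the appeal to
      \<open>edges\<close>.\<close>
    have "?\<phi> s u \<noteq> ?\<phi> s v" if "s \<in> {1..T}" "{u, v} \<in> E s" for s u v
    proof -
      have "\<psi> s u \<noteq> \<psi> s v" using \<psi>(1) that by (auto simp: admissible_def proper_def)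
      then show ?thesis using val[of s u] val[of s v] edges[OF that] that by auto
    qed
    then have "temporal_2_colouring {..<n} T E ?\<phi>"
      using val by (fastforce simp: temporal_2_colouring_def proper_2_colouring_def)
    moreover have "prefix_cost n T \<psi> = n + colouring_cost {..<n} T ?\<phi>"
      by (rule prefix_cost_eq_colouring_cost[OF \<psi>(1) T]) (use val in fastforce)
    ultimately show ?thesis using \<psi>(2) by (intro exI[of _ ?\<phi>]) simp
  qed
  show ?thesis
  proof (cases "g = 0")
    case True
    then show ?thesis using bound by (auto simp: min_colouring_cost_def)
  next
    case False
    then obtain \<phi> where \<phi>: "temporal_2_colouring {..<n} T E \<phi>" "g = Suc (n + colouring_cost {..<n} T \<phi>)"
      using attained by blast
    have "(LEAST c. \<exists>\<psi>. temporal_2_colouring {..<n} T E \<psi> \<and> colouring_cost {..<n} T \<psi> = c)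
        = colouring_cost {..<n} T \<phi>"
      by (rule Least_equality) (use bound \<phi> in auto)
    then show ?thesis using \<phi> False by (auto simp: min_colouring_cost_def)
  qed
qed

section \<open>Enumerating the colourings along a spanning forest\<close>

text \<open>A root is its own parent. Parents come earlier in \<open>ord\<close>, so one pass along
  \<open>ord\<close> propagates colours from the roots, and induction along \<open>ord\<close> is
  available.\<close>

definition forest :: "nat \<Rightarrow> nat set set \<Rightarrow> (nat \<Rightarrow> nat) \<Rightarrow> (nat \<Rightarrow> nat) \<Rightarrow> bool" where
  "forest n F ord par \<longleftrightarrow> inj_on ord {..<n} \<and> ord ` {..<n} = {..<n} \<and>
     (\<forall>i<n. par (ord i) = ord i \<or> (\<exists>j<i. par (ord i) = ord j \<and> {ord j, ord i} \<in> F))"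

text \<open>\<open>3 - x\<close> exchanges the colours 1 and 2. Only forest edges are constrained,
  so a consistent colouring may violate another edge.\<close>

definition consistent :: "nat \<Rightarrow> (nat \<Rightarrow> nat) \<Rightarrow> (nat \<Rightarrow> nat) \<Rightarrow> bool" where
  "consistent n par x \<longleftrightarrow> (\<forall>v<n. x v \<in> {1, 2} \<and> (par v \<noteq> v \<longrightarrow> x v = 3 - x (par v)))"

text \<open>The place value, in the number \<open>rank\<close>, of a root at position
  \<open>i\<close>. For \<open>i = n\<close> it is the number of root colourings.\<close>

primrec weight :: "(nat \<Rightarrow> nat) \<Rightarrow> (nat \<Rightarrow> nat) \<Rightarrow> nat \<Rightarrow> nat" where
  "weight ord par 0 = 1"
| "weight ord par (Suc i) = (if par (ord i) = ord i then 2 else 1) * weight ord par i"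

text \<open>The colours of the first \<open>i\<close> vertices in the order \<open>ord\<close> that are roots, read as a binary number
  with the least significant digit first.\<close>

primrec rank :: "(nat \<Rightarrow> nat) \<Rightarrow> (nat \<Rightarrow> nat) \<Rightarrow> (nat \<Rightarrow> nat) \<Rightarrow> nat \<Rightarrow> nat" where
  "rank ord par x 0 = 0"
| "rank ord par x (Suc i) =
     rank ord par x i + (if par (ord i) = ord i then (x (ord i) - 1) * weight ord par i else 0)"

lemma weight_eq: "weight ord par i = 2 ^ card {j. j < i \<and> par (ord j) = ord j}"
proof (induction i)
  case (Suc i)
  have "{j. j < Suc i \<and> par (ord j) = ord j}
      = (if par (ord i) = ord i then {i} else {}) \<union> {j. j < i \<and> par (ord j) = ord j}"
    by (auto simp: less_Suc_eq)
  then show ?case using Suc by simp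
qed simp

lemma forest_less: "forest n F ord par \<Longrightarrow> i < n \<Longrightarrow> ord i < n"
  unfolding forest_def by (metis imageI lessThan_iff)

lemma forest_parent:
  assumes "forest n F ord par" "i < n" "par (ord i) \<noteq> ord i"
  obtains j where "j < i" "par (ord i) = ord j" "{ord j, ord i} \<in> F"
proof -
  have "\<forall>i<n. par (ord i) = ord i \<or> (\<exists>j<i. par (ord i) = ord j \<and> {ord j, ord i} \<in> F)"
    using assms(1) unfolding forest_def by (elim conjE)
  then show thesis using that assms(2,3) by blast
qed

lemma weight_eq_roots:
  assumes "forest n F ord par"
  shows "weight ord par n = 2 ^ card {v. v < n \<and> par v = v}"
proof -
  have "ord ` {..<n} = {..<n}" using assms by (simp add: forest_def)
  then have "{v. v < n \<and> par v = v} = {v \<in> ord ` {..<n}. par v = v}" by auto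
  then have img: "ord ` {j. j < n \<and> par (ord j) = ord j} = {v. v < n \<and> par v = v}" by auto
  have "inj_on ord {..<n}" using assms by (simp add: forest_def)
  then have "inj_on ord {j. j < n \<and> par (ord j) = ord j}" by (rule inj_on_subset) auto
  from card_image[OF this] have "card {v. v < n \<and> par v = v} = card {j. j < n \<and> par (ord j) = ord j}"
    by (simp only: img)
  then show ?thesis by (simp add: weight_eq)
qed

lemma rank_cong: "(\<And>j. j < i \<Longrightarrow> x (ord j) = y (ord j)) \<Longrightarrow> rank ord par x i = rank ord par y i"
  by (induction i) auto

lemma rank_eq_0: "(\<And>j. j < i \<Longrightarrow> par (ord j) = ord j \<Longrightarrow> x (ord j) \<le> 1) \<Longrightarrow> rank ord par x i = 0"
  by (induction i) auto

lemma rank_less: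
  assumes "\<And>j. j < i \<Longrightarrow> x (ord j) \<le> 2"
  shows "rank ord par x i < weight ord par i"
  using assms
proof (induction i)
  case (Suc i)
  have "x (ord i) = 0 \<or> x (ord i) = 1 \<or> x (ord i) = 2" using Suc.prems[of i] by auto
  then show ?case using Suc by auto
qed simp

text \<open>By \<open>rank_less\<close> the lower digits stay below the weight of position
  \<open>i\<close>, so equal ranks force equal lower parts and equal digits. At a vertex that is no
  root, the colour follows from the parent, which comes earlier and is covered by the
  induction.\<close>

lemma rank_inject:
  assumes F: "forest n F ord par" and x: "consistent n par x" and y: "consistent n par y"
    and "i \<le> n" "rank ord par x i = rank ord par y i" "j < i"
  shows "x (ord j) = y (ord j)"
  using assms(4-6)
proof (induction i arbitrary: j)
  case (Suc i)
  have ord: "ord j < n" if "j < n" for j using forest_less[OF F that] .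
  have lt: "rank ord par z i < weight ord par i" if "consistent n par z" for z
  proof (rule rank_less)
    fix j assume "j < i"
    then have "ord j < n" using ord Suc.prems(1) by simp
    then have "z (ord j) \<in> {1, 2}" using that unfolding consistent_def by blast
    then show "z (ord j) \<le> 2" by auto
  qed
  have bit: "z (ord i) = 1 \<or> z (ord i) = 2" if "consistent n par z" for z
    using that ord Suc.prems(1) by (auto simp: consistent_def)
  have eq: "rank ord par x i = rank ord par y i \<and> (par (ord i) = ord i \<longrightarrow> x (ord i) = y (ord i))"
    using Suc.prems(2) lt[OF x] lt[OF y] bit[OF x] bit[OF y] by (auto split: if_splits)
  have IH: "x (ord j) = y (ord j)" if "j < i" for j
    using Suc.IH[of j] eq Suc.prems(1) that by auto
  have "x (ord i) = y (ord i)"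
  proof (cases "par (ord i) = ord i")
    case False
    then obtain l where "l < i" "par (ord i) = ord l"
      using forest_parent[OF F, of i] Suc.prems(1) by (metis Suc_le_eq)
    then show ?thesis using x y ord[of i] Suc.prems(1) IH False by (auto simp: consistent_def)
  qed (use eq in simp)
  then show ?case using IH Suc.prems(3) by (auto simp: less_Suc_eq)
qed simp

text \<open>Forest edges are edges of the graph, and with only two colours, being different from the
  parent determines the colour.\<close>

lemma proper_consistent:
  assumes "forest n F ord par" "proper n F x"
  shows "consistent n par x"
  unfolding consistent_def
proof (intro allI impI)
  fix v assume "v < n"
  then obtain i where i: "i < n" "v = ord i" using assms(1) unfolding forest_def by (metis imageE lessThan_iff)
  have bits: "x w = 1 \<or> x w = 2" if "w < n" for w using assms(2) that by (auto simp: proper_def)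
  have "x v = 3 - x (par v)" if v: "par v \<noteq> v"
  proof -
    obtain j where j: "j < i" "par v = ord j" "{ord j, v} \<in> F"
      using forest_parent[OF assms(1) i(1)] i(2) v by metis
    then have "ord j < n" using forest_less[OF assms(1)] i by simp
    moreover have "x (ord j) \<noteq> x v" using j(3) assms(2) by (simp add: proper_def)
    ultimately show ?thesis using bits[of "ord j"] bits[of v] j(2) \<open>v < n\<close> by auto
  qed
  then show "x v \<in> {1, 2} \<and> (par v \<noteq> v \<longrightarrow> x v = 3 - x (par v))" using bits[OF \<open>v < n\<close>] by auto
qed

section \<open>Graph search\<close>

text \<open>The lists contain names of arcs rather than vertices, because the program identifies an
  arc with a memory index and finds its head through \<open>tgt\<close>.\<close>

definition adjacency ::
    "nat \<Rightarrow> nat set set \<Rightarrow> (nat \<Rightarrow> nat list) \<Rightarrow> (nat \<Rightarrow> nat) \<Rightarrow> bool" where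
  "adjacency n F adj tgt \<longleftrightarrow>
     (\<forall>u v. {u, v} \<in> F \<longrightarrow> u < n \<and> v < n \<and> u \<noteq> v) \<and>
     (\<forall>v<n. \<forall>b\<in>set (adj v). {v, tgt b} \<in> F) \<and>
     (\<forall>u v. {u, v} \<in> F \<longrightarrow> (\<exists>b\<in>set (adj u). tgt b = v))"

abbreviation edge_rel :: "nat set set \<Rightarrow> (nat \<times> nat) set" where
  "edge_rel F \<equiv> {(a, b). {a, b} \<in> F}"

text \<open>Invariant of a breadth-first search with queue \<open>ord qh, \<dots>, ord (qt - 1)\<close>. Colour 0 marks
  undiscovered vertices, \<open>l\<close> lists the arcs of the vertex \<open>u\<close> under expansion that are still to be
  scanned, and \<open>rt\<close> is the next candidate for a root.\<close>

definition search_inv ::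
    "nat \<Rightarrow> nat set set \<Rightarrow> (nat \<Rightarrow> nat list) \<Rightarrow> (nat \<Rightarrow> nat) \<Rightarrow> (nat \<Rightarrow> nat) \<Rightarrow> (nat \<Rightarrow> nat) \<Rightarrow>
      (nat \<Rightarrow> nat) \<Rightarrow> nat \<Rightarrow> nat \<Rightarrow> nat \<Rightarrow> nat \<Rightarrow> nat list \<Rightarrow> bool" where
  "search_inv n F adj tgt x ord par qh qt rt u l \<longleftrightarrow>
     qh \<le> qt \<and> rt \<le> n \<and> inj_on ord {..<qt} \<and>
     (\<forall>v. (\<exists>i<qt. ord i = v) \<longleftrightarrow> v < n \<and> x v \<noteq> 0) \<and>
     (\<forall>v<n. x v \<le> 2) \<and>
     (\<forall>i<qt. par (ord i) = ord i \<and> x (ord i) = 1 \<or>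
        (\<exists>j<i. par (ord i) = ord j \<and> {ord j, ord i} \<in> F \<and> x (ord i) = 3 - x (ord j))) \<and>
     (\<forall>v<rt. x v \<noteq> 0) \<and>
     (l \<noteq> [] \<longrightarrow> (\<exists>i<qh. u = ord i) \<and> set l \<subseteq> set (adj u)) \<and>
     (\<forall>i<qh. \<forall>b\<in>set (adj (ord i)). x (tgt b) \<noteq> 0 \<or> b \<in> set l) \<and>
     (\<forall>r r'. r < n \<and> r' < n \<and> x r \<noteq> 0 \<and> x r' \<noteq> 0 \<and> par r = r \<and> par r' = r' \<and> r \<noteq> r' \<longrightarrow>
        (r, r') \<notin> (edge_rel F)\<^sup>*)"

text \<open>A potential that pays 1 for each iteration of the search: unscanned arcs of the current
  vertex, one unit plus the degree for each vertex not yet expanded, and one unit for each remaining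
  candidate root. Expanding a vertex moves its degree into the first term and spends the extra
  unit.\<close>

definition search_measure :: "nat \<Rightarrow> (nat \<Rightarrow> nat list) \<Rightarrow> (nat \<Rightarrow> nat) \<Rightarrow> nat \<Rightarrow> nat \<Rightarrow> nat list \<Rightarrow> nat" where
  "search_measure n adj ord qh rt l =
     length l + (\<Sum>v\<in>{..<n} - ord ` {..<qh}. Suc (length (adj v))) + (n - rt)"

lemma search_init:
  assumes "\<And>v. v < n \<Longrightarrow> x v = 0"
  shows "search_inv n F adj tgt x ord par 0 0 0 u []"
  using assms by (auto simp: search_inv_def)

lemma search_measure_init:
  "search_measure n adj ord 0 0 [] = 2 * n + (\<Sum>v<n. length (adj v))"
  by (simp add: search_measure_def sum_Suc)

lemma search_inv_bounds:
  assumes "search_inv n F adj tgt x ord par qh qt rt u l"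
  shows "qt \<le> n" and "i < qt \<Longrightarrow> ord i < n" and "i < qt \<Longrightarrow> x (ord i) \<noteq> 0"
proof -
  have mem: "\<forall>v. (\<exists>i<qt. ord i = v) \<longleftrightarrow> v < n \<and> x v \<noteq> 0" and inj: "inj_on ord {..<qt}"
    using assms by (simp_all add: search_inv_def)
  then have "ord ` {..<qt} \<subseteq> {..<n}" by auto
  then show "qt \<le> n" using inj card_inj_on_le[of ord "{..<qt}" "{..<n}"] by simp
  show "i < qt \<Longrightarrow> ord i < n" "i < qt \<Longrightarrow> x (ord i) \<noteq> 0" using mem by auto
qed

lemma search_skip:
  assumes "search_inv n F adj tgt x ord par qh qt rt u (b # l)" "x (tgt b) \<noteq> 0"
  shows "search_inv n F adj tgt x ord par qh qt rt u l"
    and "search_measure n adj ord qh rt l < search_measure n adj ord qh rt (b # l)"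
  using assms by (auto simp: search_inv_def search_measure_def)

lemma search_expand:
  assumes "search_inv n F adj tgt x ord par qh qt rt u []" "qh < qt"
  shows "search_inv n F adj tgt x ord par (Suc qh) qt rt (ord qh) (adj (ord qh))"
    and "search_measure n adj ord (Suc qh) rt (adj (ord qh)) < search_measure n adj ord qh rt []"
proof -
  show "search_inv n F adj tgt x ord par (Suc qh) qt rt (ord qh) (adj (ord qh))"
    using assms by (auto simp: search_inv_def less_Suc_eq)
  let ?S = "{..<n} - ord ` {..<qh}"
  have "ord qh < n" using search_inv_bounds(2)[OF assms(1,2)] .
  moreover have "ord qh \<notin> ord ` {..<qh}"
  proof
    assume "ord qh \<in> ord ` {..<qh}"
    then obtain j where "j < qh" "ord j = ord qh" by auto
    moreover have "inj_on ord {..<qt}" using assms(1) by (simp add: search_inv_def)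
    ultimately show False using assms(2) by (auto dest!: inj_onD)
  qed
  ultimately have "ord qh \<in> ?S" by simp
  then have "(\<Sum>v\<in>?S. Suc (length (adj v)))
      = Suc (length (adj (ord qh))) + (\<Sum>v\<in>?S - {ord qh}. Suc (length (adj v)))"
    by (intro sum.remove) auto
  moreover have "?S - {ord qh} = {..<n} - ord ` {..<Suc qh}" by (auto simp: lessThan_Suc)
  ultimately show "search_measure n adj ord (Suc qh) rt (adj (ord qh)) < search_measure n adj ord qh rt []"
    by (simp add: search_measure_def)
qed

lemma search_measure_cong:
  "qh \<le> qt \<Longrightarrow> search_measure n adj (ord(qt := w)) qh rt l = search_measure n adj ord qh rt l"
proof -
  assume "qh \<le> qt"
  then have "(ord(qt := w)) ` {..<qh} = ord ` {..<qh}" by (intro image_cong) auto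
  then show ?thesis by (simp only: search_measure_def)
qed

lemma image_update: "(\<exists>i<Suc q. (f(q := w)) i = v) \<longleftrightarrow> v = w \<or> (\<exists>i<q. f i = v)"
  by (metis fun_upd_apply less_Suc_eq less_irrefl)

lemma inj_on_update: "inj_on f {..<q} \<Longrightarrow> (\<And>i. i < q \<Longrightarrow> f i \<noteq> w) \<Longrightarrow> inj_on (f(q := w)) {..<Suc q}"
  unfolding inj_on_def by (metis fun_upd_apply lessThan_iff less_Suc_eq)

text \<open>The new vertex hangs below \<open>u \<noteq> w\<close>, so the set of roots is
  unchanged. Since \<open>x u\<close> is 1 or 2, \<open>3 - x u\<close> is again a colour and marks
  \<open>w\<close> as discovered.\<close>

lemma search_discover:
  assumes A: "adjacency n F adj tgt"
    and I: "search_inv n F adj tgt x ord par qh qt rt u (b # l)" and w: "x (tgt b) = 0"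
  defines "w \<equiv> tgt b"
  shows "search_inv n F adj tgt (x(w := 3 - x u)) (ord(qt := w)) (par(w := u)) qh (Suc qt) rt u l"
    and "search_measure n adj (ord(qt := w)) qh rt l < search_measure n adj ord qh rt (b # l)"
proof -
  have qh: "qh \<le> qt" "rt \<le> n" and inj: "inj_on ord {..<qt}"
    and mem: "\<And>v. (\<exists>i<qt. ord i = v) \<longleftrightarrow> v < n \<and> x v \<noteq> 0"
    and le2: "\<forall>v<n. x v \<le> 2"
    and par: "\<forall>i<qt. par (ord i) = ord i \<and> x (ord i) = 1 \<or>
        (\<exists>j<i. par (ord i) = ord j \<and> {ord j, ord i} \<in> F \<and> x (ord i) = 3 - x (ord j))"
    and rt: "\<forall>v<rt. x v \<noteq> 0" and u: "\<exists>i<qh. u = ord i" and sub: "set (b # l) \<subseteq> set (adj u)"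
    and closed: "\<forall>i<qh. \<forall>b'\<in>set (adj (ord i)). x (tgt b') \<noteq> 0 \<or> b' \<in> set (b # l)"
    and roots: "\<forall>r r'. r < n \<and> r' < n \<and> x r \<noteq> 0 \<and> x r' \<noteq> 0 \<and> par r = r \<and> par r' = r' \<and> r \<noteq> r' \<longrightarrow>
        (r, r') \<notin> (edge_rel F)\<^sup>*"
    using I unfolding search_inv_def by auto
  from u obtain k where kq: "k < qh" "u = ord k" by blast
  then have k: "k < qt" "u = ord k" using qh(1) by simp_all
  then have un: "u < n" "x u \<noteq> 0" "x u \<le> 2" using mem[of u] le2 by auto
  have "{u, w} \<in> F" using A un sub unfolding w_def adjacency_def by auto
  then have wn: "w < n" "u \<noteq> w" using A unfolding adjacency_def by auto
  have new: "ord i \<noteq> w" if "i < qt" for i using mem[of w] w that unfolding w_def by auto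
  have ordn: "(\<exists>i<Suc qt. (ord(qt := w)) i = v) \<longleftrightarrow> v < n \<and> (x(w := 3 - x u)) v \<noteq> 0" for v
    unfolding image_update using mem[of v] wn un by auto
  have inj': "inj_on (ord(qt := w)) {..<Suc qt}"
    using inj_on_update[OF inj new] .
  have par': "(par(w := u)) ((ord(qt := w)) i) = (ord(qt := w)) i \<and> (x(w := 3 - x u)) ((ord(qt := w)) i) = 1 \<or>
        (\<exists>j<i. (par(w := u)) ((ord(qt := w)) i) = (ord(qt := w)) j \<and>
          {(ord(qt := w)) j, (ord(qt := w)) i} \<in> F \<and>
          (x(w := 3 - x u)) ((ord(qt := w)) i) = 3 - (x(w := 3 - x u)) ((ord(qt := w)) j))"
    if i: "i < Suc qt" for i
  proof (cases "i = qt")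
    case True
    then show ?thesis using k wn \<open>{u, w} \<in> F\<close> by (intro disjI2 exI[of _ k]) auto
  next
    case False
    then have "i < qt" using i by simp
    then have "par (ord i) = ord i \<and> x (ord i) = 1 \<or>
        (\<exists>j<i. par (ord i) = ord j \<and> {ord j, ord i} \<in> F \<and> x (ord i) = 3 - x (ord j))" using par by blast
    then show ?thesis
    proof
      assume "\<exists>j<i. par (ord i) = ord j \<and> {ord j, ord i} \<in> F \<and> x (ord i) = 3 - x (ord j)"
      then obtain j where "j < i" "par (ord i) = ord j" "{ord j, ord i} \<in> F" "x (ord i) = 3 - x (ord j)"
        by blast
      then show ?thesis using \<open>i < qt\<close> new[of i] new[of j] by (intro disjI2 exI[of _ j]) auto
    qed (use \<open>i < qt\<close> new[of i] in simp)
  qed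
  have roots': "(r, r') \<notin> (edge_rel F)\<^sup>*"
    if "r < n \<and> r' < n \<and> (x(w := 3 - x u)) r \<noteq> 0 \<and> (x(w := 3 - x u)) r' \<noteq> 0 \<and>
      (par(w := u)) r = r \<and> (par(w := u)) r' = r' \<and> r \<noteq> r'" for r r'
  proof -
    have "r \<noteq> w" "r' \<noteq> w" using that wn by auto
    then show ?thesis using roots that by auto
  qed
  have u': "l \<noteq> [] \<longrightarrow> (\<exists>i<qh. u = (ord(qt := w)) i) \<and> set l \<subseteq> set (adj u)"
    using kq qh(1) sub by (intro impI conjI exI[of _ k]) auto
  have closed': "\<forall>i<qh. \<forall>b\<in>set (adj ((ord(qt := w)) i)). (x(w := 3 - x u)) (tgt b) \<noteq> 0 \<or> b \<in> set l"
    using closed qh un unfolding w_def by auto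
  show "search_inv n F adj tgt (x(w := 3 - x u)) (ord(qt := w)) (par(w := u)) qh (Suc qt) rt u l"
    unfolding search_inv_def
    apply (intro conjI)
    subgoal using qh by simp
    subgoal using qh by simp
    subgoal by (rule inj')
    subgoal using ordn by blast
    subgoal using le2 un by auto
    subgoal using par' by blast
    subgoal using rt un by simp
    subgoal by (rule u')
    subgoal by (rule closed')
    subgoal using roots' by blast
    done
  show "search_measure n adj (ord(qt := w)) qh rt l < search_measure n adj ord qh rt (b # l)"
    unfolding search_measure_cong[OF qh(1)] by (simp add: search_measure_def)
qed

text \<open>Otherwise all \<open>n\<close> vertices would be discovered and hence occur among the
  \<open>qt < n\<close> queue entries.\<close>

lemma search_root_less:
  assumes "search_inv n F adj tgt x ord par qh qt rt u l" "qt < n"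
  shows "rt < n"
proof (rule ccontr)
  assume rt: "\<not> rt < n"
  have mem: "\<And>v. (\<exists>i<qt. ord i = v) \<longleftrightarrow> v < n \<and> x v \<noteq> 0" and seen: "\<forall>v<rt. x v \<noteq> 0"
    using assms(1) unfolding search_inv_def by simp_all
  have "{..<n} \<subseteq> ord ` {..<qt}"
  proof
    fix v assume "v \<in> {..<n}"
    then have "\<exists>i<qt. ord i = v" using mem[of v] seen rt by simp
    then show "v \<in> ord ` {..<qt}" by blast
  qed
  then have "card {..<n} \<le> card {..<qt}" by (metis card_image_le card_mono finite_imageI finite_lessThan le_trans)
  then show False using assms(2) by simp
qed

lemma search_next_root:
  assumes "search_inv n F adj tgt x ord par qh qt rt u []" "qt < n" "x rt \<noteq> 0"
  shows "search_inv n F adj tgt x ord par qh qt (Suc rt) u []"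
    and "search_measure n adj ord qh (Suc rt) [] < search_measure n adj ord qh rt []"
  using assms search_root_less[OF assms(1,2)] by (auto simp: search_inv_def search_measure_def less_Suc_eq)

text \<open>When the queue is empty, the discovered vertices form a union of components.\<close>

lemma search_root:
  assumes A: "adjacency n F adj tgt"
    and I: "search_inv n F adj tgt x ord par qt qt rt u []" and "qt < n" and r: "x rt = 0"
  shows "search_inv n F adj tgt (x(rt := 1)) (ord(qt := rt)) (par(rt := rt)) qt (Suc qt) (Suc rt) u []"
    and "search_measure n adj (ord(qt := rt)) qt (Suc rt) [] < search_measure n adj ord qt rt []"
proof -
  have rn: "rt < n" using search_root_less[OF I \<open>qt < n\<close>] .
  have inj: "inj_on ord {..<qt}"
    and mem: "\<And>v. (\<exists>i<qt. ord i = v) \<longleftrightarrow> v < n \<and> x v \<noteq> 0"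
    and le2: "\<forall>v<n. x v \<le> 2"
    and par: "\<forall>i<qt. par (ord i) = ord i \<and> x (ord i) = 1 \<or>
        (\<exists>j<i. par (ord i) = ord j \<and> {ord j, ord i} \<in> F \<and> x (ord i) = 3 - x (ord j))"
    and rt: "\<forall>v<rt. x v \<noteq> 0"
    and closed: "\<forall>i<qt. \<forall>b'\<in>set (adj (ord i)). x (tgt b') \<noteq> 0"
    and roots: "\<forall>r r'. r < n \<and> r' < n \<and> x r \<noteq> 0 \<and> x r' \<noteq> 0 \<and> par r = r \<and> par r' = r' \<and> r \<noteq> r' \<longrightarrow>
        (r, r') \<notin> (edge_rel F)\<^sup>*"
    using I unfolding search_inv_def by auto
  have step: "x v \<noteq> 0" if a: "x a \<noteq> 0" "{a, v} \<in> F" for a v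
  proof -
    have "a < n" using A a unfolding adjacency_def by blast
    then obtain i where "i < qt" "ord i = a" using mem[of a] a(1) by blast
    moreover obtain b where "b \<in> set (adj a)" "tgt b = v" using A a(2) unfolding adjacency_def by blast
    ultimately show ?thesis using closed by blast
  qed
  have reach: "x v \<noteq> 0" if "(a, v) \<in> (edge_rel F)\<^sup>*" "x a \<noteq> 0" for a v
    using that by (induction rule: rtrancl_induct) (use step in auto)
  \<comment> \<open>By \<open>reach\<close>, no discovered vertex reaches the undiscovered
    \<open>rt\<close>. Symmetry turns this around for the pairs with \<open>rt\<close> as the
    source.\<close>
  have "sym (edge_rel F)" by (auto simp: sym_def insert_commute)
  then have sym: "sym ((edge_rel F)\<^sup>*)" by (rule sym_rtrancl)
  have new: "ord i \<noteq> rt" if "i < qt" for i using mem[of rt] r that by auto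
  have ordn: "(\<exists>i<Suc qt. (ord(qt := rt)) i = v) \<longleftrightarrow> v < n \<and> (x(rt := 1)) v \<noteq> 0" for v
    unfolding image_update using mem[of v] rn by auto
  have inj': "inj_on (ord(qt := rt)) {..<Suc qt}"
    using inj_on_update[OF inj new] .
  have par': "(par(rt := rt)) ((ord(qt := rt)) i) = (ord(qt := rt)) i \<and> (x(rt := 1)) ((ord(qt := rt)) i) = 1 \<or>
        (\<exists>j<i. (par(rt := rt)) ((ord(qt := rt)) i) = (ord(qt := rt)) j \<and>
          {(ord(qt := rt)) j, (ord(qt := rt)) i} \<in> F \<and>
          (x(rt := 1)) ((ord(qt := rt)) i) = 3 - (x(rt := 1)) ((ord(qt := rt)) j))"
    if i: "i < Suc qt" for i
  proof (cases "i = qt")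
    case False
    then have "i < qt" using i by simp
    then have "par (ord i) = ord i \<and> x (ord i) = 1 \<or>
        (\<exists>j<i. par (ord i) = ord j \<and> {ord j, ord i} \<in> F \<and> x (ord i) = 3 - x (ord j))" using par by blast
    then show ?thesis
    proof
      assume "\<exists>j<i. par (ord i) = ord j \<and> {ord j, ord i} \<in> F \<and> x (ord i) = 3 - x (ord j)"
      then obtain j where "j < i" "par (ord i) = ord j" "{ord j, ord i} \<in> F" "x (ord i) = 3 - x (ord j)"
        by blast
      then show ?thesis using \<open>i < qt\<close> new[of i] new[of j] by (intro disjI2 exI[of _ j]) auto
    qed (use \<open>i < qt\<close> new[of i] in simp)
  qed simp
  have roots': "(a, a') \<notin> (edge_rel F)\<^sup>*"
    if aa: "a < n \<and> a' < n \<and> (x(rt := 1)) a \<noteq> 0 \<and> (x(rt := 1)) a' \<noteq> 0 \<and>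
      (par(rt := rt)) a = a \<and> (par(rt := rt)) a' = a' \<and> a \<noteq> a'" for a a'
  proof -
    consider "a = rt" "a' \<noteq> rt" | "a' = rt" "a \<noteq> rt" | "a \<noteq> rt" "a' \<noteq> rt" using aa by auto
    then show ?thesis
    proof cases
      case 1
      then show ?thesis using reach[of a' a] symD[OF sym, of a a'] r that by auto
    next
      case 2
      then show ?thesis using reach[of a a'] r that by auto
    next
      case 3
      then show ?thesis using roots that by auto
    qed
  qed
  have closed': "\<forall>i<qt. \<forall>b\<in>set (adj ((ord(qt := rt)) i)). (x(rt := 1)) (tgt b) \<noteq> 0 \<or> b \<in> set []"
    using closed by auto
  show "search_inv n F adj tgt (x(rt := 1)) (ord(qt := rt)) (par(rt := rt)) qt (Suc qt) (Suc rt) u []"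
    unfolding search_inv_def
    apply (intro conjI)
    subgoal by simp
    subgoal using rn by simp
    subgoal by (rule inj')
    subgoal using ordn by blast
    subgoal using le2 by simp
    subgoal using par' by blast
    subgoal using rt by (simp add: less_Suc_eq)
    subgoal by simp
    subgoal by (rule closed')
    subgoal using roots' by blast
    done
  show "search_measure n adj (ord(qt := rt)) qt (Suc rt) [] < search_measure n adj ord qt rt []"
    unfolding search_measure_cong[OF le_refl] using rn by (simp add: search_measure_def)
qed

text \<open>Pairwise unreachable vertices lie in different classes of the quotient. This converts
  the number of components into a bound on the number of roots.\<close>

lemma card_roots_le:
  assumes "\<forall>r r'. r \<in> S \<and> r' \<in> S \<and> r \<noteq> r' \<longrightarrow> (r, r') \<notin> (edge_rel F)\<^sup>*" "S \<subseteq> V" "finite V"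
  shows "card S \<le> card (connected_components V F)"
proof -
  let ?R = "{(u, v). u \<in> V \<and> v \<in> V \<and> (u, v) \<in> (edge_rel F)\<^sup>*}"
  have "inj_on (\<lambda>v. ?R `` {v}) S"
  proof (rule inj_onI)
    fix r r' assume r: "r \<in> S" "r' \<in> S" "?R `` {r} = ?R `` {r'}"
    have "r' \<in> ?R `` {r'}" using r(2) assms(2) by auto
    then have "r' \<in> ?R `` {r}" using r(3) by simp
    then show "r = r'" using assms(1) r(1,2) by blast
  qed
  moreover have "(\<lambda>v. ?R `` {v}) ` S \<subseteq> V // ?R" using assms(2) by (auto simp: quotient_def)
  moreover have "finite (V // ?R)" using assms(3) by (simp add: quotient_def)
  ultimately show ?thesis unfolding connected_components_def by (rule card_inj_on_le)
qed

text \<open>The search stops as soon as every vertex is discovered, possibly with arcs still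
  unscanned; nothing further could be added to the forest. That all roots have colour 1 makes the
  first candidate the one of rank 0.\<close>

lemma search_final:
  assumes A: "adjacency n F adj tgt"
    and I: "search_inv n F adj tgt x ord par qh qt rt u l" and "\<not> qt < n"
  shows "forest n F ord par" and "consistent n par x"
    and "\<forall>v<n. par v = v \<longrightarrow> x v = 1"
    and "card {v. v < n \<and> par v = v} \<le> card (connected_components {..<n} F)"
proof -
  have qt: "qt = n" using search_inv_bounds(1)[OF I] \<open>\<not> qt < n\<close> by simp
  have inj: "inj_on ord {..<n}"
    and mem: "\<And>v. (\<exists>i<n. ord i = v) \<longleftrightarrow> v < n \<and> x v \<noteq> 0"
    and le2: "\<forall>v<n. x v \<le> 2"
    and par: "\<forall>i<n. par (ord i) = ord i \<and> x (ord i) = 1 \<or>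
        (\<exists>j<i. par (ord i) = ord j \<and> {ord j, ord i} \<in> F \<and> x (ord i) = 3 - x (ord j))"
    and roots: "\<forall>r r'. r < n \<and> r' < n \<and> x r \<noteq> 0 \<and> x r' \<noteq> 0 \<and> par r = r \<and> par r' = r' \<and> r \<noteq> r' \<longrightarrow>
        (r, r') \<notin> (edge_rel F)\<^sup>*"
    using I unfolding search_inv_def qt by auto
  have "ord ` {..<n} \<subseteq> {..<n}" using mem by auto
  then have img: "ord ` {..<n} = {..<n}" by (rule endo_inj_surj[OF finite_lessThan _ inj])
  have idx: "\<exists>i<n. ord i = v" if "v < n" for v
  proof -
    have "v \<in> ord ` {..<n}" using img that by simp
    then show ?thesis by auto
  qed
  then have pos: "x v \<noteq> 0" if "v < n" for v using mem that by blast
  show "forest n F ord par" using inj img par unfolding forest_def by blast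
  show "consistent n par x" unfolding consistent_def
  proof (intro allI impI)
    fix v assume "v < n"
    then obtain i where i: "i < n" "ord i = v" using idx by blast
    have "x v \<in> {1, 2}" using pos[OF \<open>v < n\<close>] le2 \<open>v < n\<close> by (auto simp: le_Suc_eq numeral_2_eq_2)
    moreover have "par v \<noteq> v \<longrightarrow> x v = 3 - x (par v)" using par i by metis
    ultimately show "x v \<in> {1, 2} \<and> (par v \<noteq> v \<longrightarrow> x v = 3 - x (par v))" by blast
  qed
  \<comment> \<open>For \<open>par v = v\<close> the second alternative of the parent clause would
    give an edge from \<open>v\<close> to itself. Excluding it leaves colour 1.\<close>
  have loopfree: "{v, v} \<notin> F" for v using A unfolding adjacency_def by blast
  show "\<forall>v<n. par v = v \<longrightarrow> x v = 1"
  proof (intro allI impI)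
    fix v assume "v < n" "par v = v"
    then obtain i where "i < n" "ord i = v" using idx by blast
    then have "x v = 1 \<or> (\<exists>j<i. par v = ord j \<and> {ord j, v} \<in> F)" using par by blast
    then show "x v = 1" using \<open>par v = v\<close> loopfree by metis
  qed
  show "card {v. v < n \<and> par v = v} \<le> card (connected_components {..<n} F)"
    by (rule card_roots_le) (use roots pos in auto)
qed

section \<open>The loops of the program\<close>

abbreviation inc :: "reg \<Rightarrow> hcom" where
  "inc r \<equiv> r :=\<^sub>r Plus (R r) (N 1)"

text \<open>Arrays keep their contents from one snapshot to the next. \<open>HEAD\<close> and
  \<open>COL\<close> are the two that are read before being written again: as empty lists and as the
  mark of undiscovered vertices.\<close>

definition reset_body :: hcom where
  "reset_body = StoreH HEAD (R rV) (N 0) ;; StoreH COL (R rV) (N 0) ;; inc rV"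

definition reset_loop :: hcom where
  "reset_loop = WhileH (LessH (R rV) (R rN)) reset_body"

lemma reset_loop_runs:
  assumes "hr h0 rV = 0"
  shows "runs reset_loop h0 (1000 * (hr h0 rN + 1))
    (\<lambda>h. \<forall>v<hr h0 rN. ha h HEAD v = 0 \<and> ha h COL v = 0)"
  unfolding reset_loop_def
proof (rule runs_While_straight[where m = "hr h0 rN" and K = 1000 and
      I = "\<lambda>h m. hr h rV + m = hr h0 rN \<and> (\<forall>v<hr h rV. ha h HEAD v = 0 \<and> ha h COL v = 0)"])
  fix h m
  assume "hr h rV + m = hr h0 rN \<and> (\<forall>v<hr h rV. ha h HEAD v = 0 \<and> ha h COL v = 0)"
    and fr: "frame reset_body h0 h" and "hbval (LessH (R rV) (R rN)) h"
  then show "\<exists>m'<m. hr (run reset_body h) rV + m' = hr h0 rN \<and> (\<forall>v<hr (run reset_body h) rV.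
      ha (run reset_body h) HEAD v = 0 \<and> ha (run reset_body h) COL v = 0)"
    using frameD(1)[OF fr, of rN] by (intro exI[of _ "m - 1"]) (auto simp: reset_body_def less_Suc_eq)
next
  fix h m
  assume "hr h rV + m = hr h0 rN \<and> (\<forall>v<hr h rV. ha h HEAD v = 0 \<and> ha h COL v = 0)"
    and fr: "frame reset_body h0 h" and "\<not> hbval (LessH (R rV) (R rN)) h"
  then show "\<forall>v<hr h0 rN. ha h HEAD v = 0 \<and> ha h COL v = 0"
    using frameD(1)[OF fr, of rN] by (auto simp: reset_body_def)
qed (use assms in \<open>auto simp: reset_body_def acost_address\<close>)

section \<open>Adjacency lists as linked lists in arrays\<close>

primrec chain :: "(nat \<Rightarrow> nat) \<Rightarrow> nat \<Rightarrow> nat list \<Rightarrow> bool" where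
  "chain nxt a [] \<longleftrightarrow> a = 0"
| "chain nxt a (b # l) \<longleftrightarrow> a = b \<and> b \<noteq> 0 \<and> chain nxt (nxt b) l"

lemma chain_update: "p \<notin> set l \<Longrightarrow> chain (nxt(p := x)) a l \<longleftrightarrow> chain nxt a l"
  by (induction l arbitrary: a) auto

text \<open>All arc names in use are below \<open>p\<close>, so an arc stored at \<open>p\<close>
  disturbs no existing chain. The count \<open>c\<close> becomes the number of arc scans in the
  running time of the search.\<close>

definition linked ::
    "nat \<Rightarrow> (nat \<Rightarrow> nat) \<Rightarrow> (nat \<Rightarrow> nat) \<Rightarrow> (nat \<Rightarrow> nat) \<Rightarrow> (nat \<Rightarrow> nat list) \<Rightarrow> (nat \<times> nat) set \<Rightarrow> nat \<Rightarrow> nat \<Rightarrow> bool"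
  where
  "linked n nxt tgt head adj A p c \<longleftrightarrow>
     (\<forall>v<n. chain nxt (head v) (adj v) \<and> (\<forall>b\<in>set (adj v). b < p)) \<and>
     (\<forall>v<n. \<forall>w. (\<exists>b\<in>set (adj v). tgt b = w) \<longleftrightarrow> (v, w) \<in> A) \<and>
     (\<Sum>v<n. length (adj v)) = c"

lemma linked_insert:
  assumes L: "linked n nxt tgt head adj A p c" and "u < n" "0 < p"
  shows "linked n (nxt(p := head u)) (tgt(p := w)) (head(u := p)) (adj(u := p # adj u))
    (insert (u, w) A) (Suc p) (Suc c)"
proof -
  have ch: "chain nxt (head v) (adj v)" and lt: "\<forall>b\<in>set (adj v). b < p"
    and arcs: "(\<exists>b\<in>set (adj v). tgt b = w') \<longleftrightarrow> (v, w') \<in> A" if "v < n" for v w'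
    using L that unfolding linked_def by blast+
  have fresh: "p \<notin> set (adj v)" if "v < n" for v using lt[OF that] by auto
  have "chain (nxt(p := head u)) ((head(u := p)) v) ((adj(u := p # adj u)) v) \<and>
      (\<forall>b\<in>set ((adj(u := p # adj u)) v). b < Suc p)" if "v < n" for v
    using ch[OF that] lt[OF that] fresh[OF that] \<open>0 < p\<close> by (auto simp: chain_update less_Suc_eq)
  moreover have "(\<exists>b\<in>set ((adj(u := p # adj u)) v). (tgt(p := w)) b = w') \<longleftrightarrow> (v, w') \<in> insert (u, w) A"
    if "v < n" for v w'
  proof -
    have "(\<exists>b\<in>set (adj v). (tgt(p := w)) b = w') \<longleftrightarrow> (v, w') \<in> A"
      using arcs[OF that, of w'] fresh[OF that] by (metis fun_upd_other)
    then show ?thesis by auto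
  qed
  moreover have "(\<Sum>v<n. length ((adj(u := p # adj u)) v)) = Suc c"
  proof -
    have "(\<Sum>v<n. length ((adj(u := p # adj u)) v)) = (\<Sum>v<n. length (adj v) + (if v = u then 1 else 0))"
      by (rule sum.cong) auto
    then show ?thesis using L \<open>u < n\<close> by (simp add: sum.distrib linked_def)
  qed
  ultimately show ?thesis unfolding linked_def by blast
qed

text \<open>An arc is named by the input cell that holds its source. These cells are never 0, so 0 can end
  the lists.\<close>

definition build_body :: hcom where
  "build_body =
     rU :=\<^sub>r Ld IN (R rP) ;;
     rW :=\<^sub>r Ld IN (Plus (R rP) (N 1)) ;;
     StoreH TGT (R rP) (R rW) ;;
     StoreH NXT (R rP) (Ld HEAD (R rU)) ;;
     StoreH HEAD (R rU) (R rP) ;;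
     StoreH TGT (Plus (R rP) (N 1)) (R rU) ;;
     StoreH NXT (Plus (R rP) (N 1)) (Ld HEAD (R rW)) ;;
     StoreH HEAD (R rW) (Plus (R rP) (N 1)) ;;
     rP :=\<^sub>r Plus (R rP) (N 2)"

definition build_loop :: hcom where
  "build_loop = WhileH (LessH (R rP) (R rEE)) build_body"

definition stored_edges :: "(nat \<Rightarrow> nat) \<Rightarrow> nat \<Rightarrow> (nat \<times> nat) list \<Rightarrow> bool" where
  "stored_edges f p L \<longleftrightarrow> (\<forall>j<length L. f (p + 2 * j) = fst (L ! j) \<and> f (p + 2 * j + 1) = snd (L ! j))"

text \<open>An edge occupies two input cells, and each of them names one of its two orientations.
  Hence the symmetric set of arcs, and exactly two arcs per edge.\<close>

lemma build_loop_runs: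
  assumes L: "stored_edges (ha h0 IN) p L" and Ln: "set L \<subseteq> {..<n} \<times> {..<n}" and "0 < p"
    and p: "hr h0 rP = p" "hr h0 rEE = p + 2 * length L"
    and head: "\<forall>v<n. ha h0 HEAD v = 0"
  shows "runs build_loop h0 (1000 * (length L + 1))
    (\<lambda>h. hr h rP = p + 2 * length L \<and>
      (\<exists>adj. linked n (ha h NXT) (ha h TGT) (ha h HEAD) adj (set L \<union> (set L)\<inverse>) (p + 2 * length L) (2 * length L)))"
proof -
  let ?I = "\<lambda>h m. m \<le> length L \<and> (let j = length L - m in hr h rP = p + 2 * j \<and>
      (\<exists>adj. linked n (ha h NXT) (ha h TGT) (ha h HEAD) adj (set (take j L) \<union> (set (take j L))\<inverse>) (p + 2 * j) (2 * j)))"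
  show ?thesis unfolding build_loop_def
  proof (rule runs_While_straight[where m = "length L" and K = 1000 and I = ?I])
    fix h m
    assume I: "?I h m" and fr: "frame build_body h0 h" and b: "hbval (LessH (R rP) (R rEE)) h"
    define j where "j = length L - m"
    obtain adj where adj: "linked n (ha h NXT) (ha h TGT) (ha h HEAD) adj
        (set (take j L) \<union> (set (take j L))\<inverse>) (p + 2 * j) (2 * j)" and P: "hr h rP = p + 2 * j"
      using I unfolding Let_def j_def[symmetric] by blast
    have "hr h rEE = p + 2 * length L" using frameD(1)[OF fr, of rEE] p by (simp add: build_body_def)
    then have j: "j < length L" and m: "0 < m" "length L - (m - 1) = Suc j" "m - 1 \<le> length L"
      using b P I by (auto simp: j_def)
    obtain u w where uw: "L ! j = (u, w)" by force
    have "(u, w) \<in> set L" using j uw by (metis nth_mem)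
    then have n: "u < n" "w < n" using Ln by auto
    have IN: "ha h IN (p + 2 * j) = u" "ha h IN (p + 2 * j + 1) = w"
      using frameD(2)[OF fr, of IN] L j uw by (auto simp: build_body_def stored_edges_def)
    have tk: "insert (w, u) (insert (u, w) (set (take j L) \<union> (set (take j L))\<inverse>))
        = set (take (Suc j) L) \<union> (set (take (Suc j) L))\<inverse>"
      using j uw by (auto simp: take_Suc_conv_app_nth)
    have "linked n (ha (run build_body h) NXT) (ha (run build_body h) TGT) (ha (run build_body h) HEAD)
        ((adj(u := (p + 2 * j) # adj u))(w := Suc (p + 2 * j) # (adj(u := (p + 2 * j) # adj u)) w))
        (set (take (Suc j) L) \<union> (set (take (Suc j) L))\<inverse>) (p + 2 * Suc j) (2 * Suc j)"
      using linked_insert[OF linked_insert[OF adj n(1)] n(2), of w u] \<open>0 < p\<close> IN P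
      unfolding tk by (simp add: build_body_def)
    moreover have "hr (run build_body h) rP = p + 2 * Suc j" using P by (simp add: build_body_def)
    ultimately show "\<exists>m'<m. ?I (run build_body h) m'"
      using m unfolding Let_def by (intro exI[of _ "m - 1"]) auto
  next
    fix h m
    assume I: "?I h m" and fr: "frame build_body h0 h" and b: "\<not> hbval (LessH (R rP) (R rEE)) h"
    have "hr h rEE = p + 2 * length L" using frameD(1)[OF fr, of rEE] p by (simp add: build_body_def)
    then have "length L - m = length L" using I b by (auto simp: Let_def)
    then show "hr h rP = p + 2 * length L \<and>
      (\<exists>adj. linked n (ha h NXT) (ha h TGT) (ha h HEAD) adj (set L \<union> (set L)\<inverse>) (p + 2 * length L) (2 * length L))"
      using I by (simp add: Let_def)
  next
    show "?I h0 (length L)" using p head by (auto simp: linked_def intro!: exI[of _ "\<lambda>_. []"])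
  qed (auto simp: build_body_def acost_address)
qed

text \<open>One flat loop in place of nested ones: an iteration scans one arc, expands one vertex or
  inspects one candidate root. Each of these lowers \<open>search_measure\<close>, so the number of
  iterations needs no amortised argument over nested loops.\<close>

definition search_body :: hcom where
  "search_body =
     CondH (LessH (N 0) (R rA))
       (rW :=\<^sub>r Ld TGT (R rA) ;;
        rA :=\<^sub>r Ld NXT (R rA) ;;
        CondH (EqualH (Ld COL (R rW)) (N 0))
          (StoreH COL (R rW) (Minus (N 3) (Ld COL (R rU))) ;;
           StoreH PAR (R rW) (R rU) ;;
           StoreH ORD (R rQT) (R rW) ;;
           inc rQT)
          SkipH)
       (CondH (LessH (R rQH) (R rQT))
         (rU :=\<^sub>r Ld ORD (R rQH) ;;
          inc rQH ;;
          rA :=\<^sub>r Ld HEAD (R rU))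
         (CondH (EqualH (Ld COL (R rRT)) (N 0))
            (StoreH COL (R rRT) (N 1) ;;
             StoreH PAR (R rRT) (R rRT) ;;
             StoreH ORD (R rQT) (R rRT) ;;
             inc rQT)
            SkipH ;;
          inc rRT))"

definition search_loop :: hcom where
  "search_loop = WhileH (LessH (R rQT) (R rN)) search_body"

lemma search_loop_runs:
  assumes A: "adjacency n F adj (ha h0 TGT)"
    and chains: "\<And>v. v < n \<Longrightarrow> chain (ha h0 NXT) (ha h0 HEAD v) (adj v)"
    and init: "hr h0 rN = n" "hr h0 rA = 0" "hr h0 rQH = 0" "hr h0 rQT = 0" "hr h0 rRT = 0"
    and col: "\<forall>v<n. ha h0 COL v = 0"
  shows "runs search_loop h0 (1000 * (2 * n + (\<Sum>v<n. length (adj v)) + 1))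
    (\<lambda>h. forest n F (ha h ORD) (ha h PAR) \<and> consistent n (ha h PAR) (ha h COL) \<and>
      (\<forall>v<n. ha h PAR v = v \<longrightarrow> ha h COL v = 1) \<and>
      card {v. v < n \<and> ha h PAR v = v} \<le> card (connected_components {..<n} F))"
proof -
  let ?tgt = "ha h0 TGT" and ?nxt = "ha h0 NXT"
  let ?I = "\<lambda>h m. \<exists>l. chain ?nxt (hr h rA) l \<and> m = search_measure n adj (ha h ORD) (hr h rQH) (hr h rRT) l \<and>
    search_inv n F adj ?tgt (ha h COL) (ha h ORD) (ha h PAR) (hr h rQH) (hr h rQT) (hr h rRT) (hr h rU) l"
  show ?thesis unfolding search_loop_def
  proof (rule runs_While_straight[where m = "2 * n + (\<Sum>v<n. length (adj v))" and K = 1000 and I = ?I])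
    fix h m
    assume I: "?I h m" and fr: "frame search_body h0 h" and b: "hbval (LessH (R rQT) (R rN)) h"
    have const: "hr h rN = n" "ha h NXT = ?nxt" "ha h TGT = ?tgt" "ha h HEAD = ha h0 HEAD"
      using frameD(1)[OF fr, of rN] frameD(2)[OF fr] init by (simp_all add: search_body_def)
    then have qt: "hr h rQT < n" using b by simp
    let ?h = "run search_body h"
    from I obtain l where l: "chain ?nxt (hr h rA) l"
      and m: "m = search_measure n adj (ha h ORD) (hr h rQH) (hr h rRT) l"
      and inv: "search_inv n F adj ?tgt (ha h COL) (ha h ORD) (ha h PAR) (hr h rQH) (hr h rQT) (hr h rRT) (hr h rU) l"
      by blast
    show "\<exists>m'<m. ?I ?h m'"
    proof (cases l)
      case (Cons b l')
      then have A: "hr h rA = b" "0 < b" "chain ?nxt (?nxt b) l'" using l by auto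
      note inv = inv[unfolded Cons] and m = m[unfolded Cons]
      show ?thesis
      proof (cases "ha h COL (?tgt b) = 0")
        case True
        show ?thesis
          using search_discover[OF \<open>adjacency n F adj (ha h0 TGT)\<close> inv True] A True const
          unfolding m by (intro exI conjI) (auto simp: search_body_def)
      next
        case False
        show ?thesis
          using search_skip[OF inv False] A False const
          unfolding m by (intro exI conjI) (auto simp: search_body_def)
      qed
    next
      case Nil
      then have A: "hr h rA = 0" using l by simp
      note inv = inv[unfolded Nil] and m = m[unfolded Nil]
      show ?thesis
      proof (cases "hr h rQH < hr h rQT")
        case True
        have "ha h ORD (hr h rQH) < n" using search_inv_bounds(2)[OF inv True] .
        then show ?thesis
          using search_expand[OF inv True] A True const chains
          unfolding m by (intro exI conjI) (auto simp: search_body_def)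
      next
        case False
        then have q: "hr h rQH = hr h rQT" using inv by (simp add: search_inv_def)
        show ?thesis
        proof (cases "ha h COL (hr h rRT) = 0")
          case True
          show ?thesis
            using search_root[OF \<open>adjacency n F adj (ha h0 TGT)\<close> inv[unfolded q] qt True] A True const q
            unfolding m by (intro exI[of _ "search_measure n adj (ha ?h ORD) (hr ?h rQH) (hr ?h rRT) []"]
                conjI exI[of _ "[]"]) (auto simp: search_body_def)
        next
          case F: False
          show ?thesis
            using search_next_root[OF inv qt F] A F const q
            unfolding m by (intro exI[of _ "search_measure n adj (ha ?h ORD) (hr ?h rQH) (hr ?h rRT) []"]
                conjI exI[of _ "[]"]) (auto simp: search_body_def)
        qed
      qed
    qed
  next
    fix h m
    assume I: "?I h m" and fr: "frame search_body h0 h" and b: "\<not> hbval (LessH (R rQT) (R rN)) h"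
    have "hr h rN = n" using frameD(1)[OF fr, of rN] init by (simp add: search_body_def)
    then have qt: "\<not> hr h rQT < n" using b by simp
    obtain l where inv: "search_inv n F adj ?tgt (ha h COL) (ha h ORD) (ha h PAR) (hr h rQH) (hr h rQT)
        (hr h rRT) (hr h rU) l" using I by blast
    show "forest n F (ha h ORD) (ha h PAR) \<and> consistent n (ha h PAR) (ha h COL) \<and>
      (\<forall>v<n. ha h PAR v = v \<longrightarrow> ha h COL v = 1) \<and>
      card {v. v < n \<and> ha h PAR v = v} \<le> card (connected_components {..<n} F)"
      using search_final[OF A inv qt] by blast
  next
    show "?I h0 (2 * n + (\<Sum>v<n. length (adj v)))"
      using search_init[of n "ha h0 COL"] col init by (intro exI[of _ "[]"]) (simp add: search_measure_init)
  qed (auto simp: search_body_def acost_address)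
qed

section \<open>Testing a candidate for properness\<close>

definition check_body :: hcom where
  "check_body =
     CondH (EqualH (Ld COL (Ld IN (R rJ))) (Ld COL (Ld IN (Plus (R rJ) (N 1))))) (rOK :=\<^sub>r N 0) SkipH ;;
     rJ :=\<^sub>r Plus (R rJ) (N 2)"

definition check_loop :: hcom where
  "check_loop = WhileH (LessH (R rJ) (R rEE)) check_body"

lemma check_loop_runs:
  assumes L: "stored_edges (ha h0 IN) p L" and p: "hr h0 rJ = p" "hr h0 rEE = p + 2 * length L"
    and ok: "hr h0 rOK = 1"
  shows "runs check_loop h0 (2000 * (length L + 1))
    (\<lambda>h. hr h rOK = (if \<forall>(u, v)\<in>set L. ha h0 COL u \<noteq> ha h0 COL v then 1 else 0))"
proof -
  let ?ok = "\<lambda>L. if \<forall>(u, v)\<in>set L. ha h0 COL u \<noteq> ha h0 COL v then 1 else 0"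
  let ?I = "\<lambda>h m. m \<le> length L \<and> (let j = length L - m in hr h rJ = p + 2 * j \<and> hr h rOK = ?ok (take j L))"
  show ?thesis unfolding check_loop_def
  \<comment> \<open>The constant is larger than in the other loops because the nested access to
    \<open>COL\<close> at an entry of \<open>IN\<close> pays the factor 16 of address computation
    twice.\<close>
  proof (rule runs_While_straight[where m = "length L" and K = 2000 and I = ?I])
    fix h m
    assume I: "?I h m" and fr: "frame check_body h0 h" and b: "hbval (LessH (R rJ) (R rEE)) h"
    define j where "j = length L - m"
    have J: "hr h rJ = p + 2 * j" "hr h rOK = ?ok (take j L)"
      using I unfolding Let_def j_def[symmetric] by blast+
    have const: "hr h rEE = p + 2 * length L" "ha h COL = ha h0 COL" "ha h IN = ha h0 IN"
      using frameD(1)[OF fr, of rEE] frameD(2)[OF fr] p by (simp_all add: check_body_def)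
    then have j: "j < length L" and m: "0 < m" "length L - (m - 1) = Suc j" "m - 1 \<le> length L"
      using b J I by (auto simp: j_def)
    obtain u w where uw: "L ! j = (u, w)" by force
    have IN: "ha h0 IN (p + 2 * j) = u" "ha h0 IN (p + 2 * j + 1) = w"
      using L j uw by (auto simp: stored_edges_def)
    have "hr (run check_body h) rOK = ?ok (take (Suc j) L)"
      using J const IN j uw by (auto simp: check_body_def take_Suc_conv_app_nth)
    moreover have "hr (run check_body h) rJ = p + 2 * Suc j" using J by (simp add: check_body_def)
    ultimately show "\<exists>m'<m. ?I (run check_body h) m'"
      using m unfolding Let_def by (intro exI[of _ "m - 1"]) auto
  next
    fix h m
    assume I: "?I h m" and fr: "frame check_body h0 h" and b: "\<not> hbval (LessH (R rJ) (R rEE)) h"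
    have "hr h rEE = p + 2 * length L" using frameD(1)[OF fr, of rEE] p by (simp add: check_body_def)
    then have "length L - m = length L" using I b by (auto simp: Let_def)
    then show "hr h rOK = ?ok L" using I by (simp add: Let_def)
  next
    show "?I h0 (length L)" using p ok by simp
  qed (auto simp: check_body_def acost_address)
qed

section \<open>Comparing a candidate with the entries of the previous table\<close>

definition compare_body :: hcom where
  "compare_body =
     CondH (EqualH (Ld CS (R rQ)) (Ld COL (R rV))) SkipH (inc rDV) ;; inc rQ ;; inc rV"

definition compare_loop :: hcom where
  "compare_loop = WhileH (LessH (R rV) (R rN)) compare_body"

text \<open>The final value of \<open>rQ\<close> matters: it is the offset of the next table entry,
  so that the surrounding loop keeps \<open>rQ\<close> equal to \<open>i * n\<close> without
  multiplying.\<close>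

lemma compare_loop_runs:
  assumes V: "hr h0 rV = 0" and n: "hr h0 rN = n"
  shows "runs compare_loop h0 (1000 * (n + 1))
    (\<lambda>h. hr h rQ = hr h0 rQ + n \<and>
      hr h rDV = hr h0 rDV + hamming n (\<lambda>v. ha h0 CS (hr h0 rQ + v)) (ha h0 COL))"
proof -
  let ?I = "\<lambda>h m. hr h rV + m = n \<and> hr h rQ = hr h0 rQ + hr h rV \<and>
    hr h rDV = hr h0 rDV + hamming (hr h rV) (\<lambda>v. ha h0 CS (hr h0 rQ + v)) (ha h0 COL)"
  show ?thesis unfolding compare_loop_def
  proof (rule runs_While_straight[where m = n and K = 1000 and I = ?I])
    fix h m
    assume I: "?I h m" and fr: "frame compare_body h0 h" and b: "hbval (LessH (R rV) (R rN)) h"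
    have "hr h rN = n" "ha h COL = ha h0 COL" "ha h CS = ha h0 CS"
      using frameD(1)[OF fr, of rN] frameD(2)[OF fr] n by (simp_all add: compare_body_def)
    then show "\<exists>m'<m. ?I (run compare_body h) m'"
      using I b by (intro exI[of _ "m - 1"]) (auto simp: compare_body_def hamming_Suc)
  next
    fix h m
    assume I: "?I h m" and fr: "frame compare_body h0 h" and b: "\<not> hbval (LessH (R rV) (R rN)) h"
    have "hr h rN = n" using frameD(1)[OF fr, of rN] n by (simp add: compare_body_def)
    then have "hr h rV = n" using I b by simp
    then show "hr h rQ = hr h0 rQ + n \<and>
      hr h rDV = hr h0 rDV + hamming n (\<lambda>v. ha h0 CS (hr h0 rQ + v)) (ha h0 COL)"
      using I by simp
  qed (use V in \<open>auto simp: compare_body_def acost_address\<close>)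
qed

definition improve :: "reg \<Rightarrow> reg \<Rightarrow> hcom" where
  "improve b a = CondH (EqualH (R b) (N 0)) (b :=\<^sub>r R a) (CondH (LessH (R a) (R b)) (b :=\<^sub>r R a) SkipH)"

definition previous_body :: hcom where
  "previous_body = (rDV :=\<^sub>r Ld DD (R rI) ;; rV :=\<^sub>r N 0) ;; compare_loop ;; improve rBEST rDV ;; inc rI"

definition previous_loop :: hcom where
  "previous_loop = WhileH (LessH (R rI) (R rHI)) previous_body"

lemmas previous_simps = previous_body_def compare_loop_def compare_body_def improve_def

lemma previous_loop_runs:
  assumes n: "hr h0 rN = n" and I0: "hr h0 rI = lo" and hi: "hr h0 rHI = lo + c"
    and Q: "hr h0 rQ = lo * n" and best: "hr h0 rBEST = 0" and pos: "\<And>i. lo \<le> i \<Longrightarrow> i < lo + c \<Longrightarrow> 0 < ha h0 DD i"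
  shows "runs previous_loop h0 (2000 * (n + 1) * (c + 1))
    (\<lambda>h. minimum_or_0 ((\<lambda>i. ha h0 DD i + hamming n (\<lambda>v. ha h0 CS (i * n + v)) (ha h0 COL)) ` {lo..<lo + c})
      (hr h rBEST))"
proof -
  let ?d = "\<lambda>i. ha h0 DD i + hamming n (\<lambda>v. ha h0 CS (i * n + v)) (ha h0 COL)"
  let ?I = "\<lambda>h m. hr h rI + m = lo + c \<and> lo \<le> hr h rI \<and> hr h rQ = hr h rI * n \<and>
    minimum_or_0 (?d ` {lo..<hr h rI}) (hr h rBEST)"
  show ?thesis unfolding previous_loop_def
  proof (rule runs_While[where m = c and K = "1000 * (n + 1) + 900" and K' = "2000 * (n + 1)" and I = ?I])
    fix h m
    assume I: "?I h m" and fr: "frame previous_body h0 h" and b: "hbval (LessH (R rI) (R rHI)) h"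
    have const: "hr h rN = n" "hr h rHI = lo + c" "ha h COL = ha h0 COL" "ha h CS = ha h0 CS" "ha h DD = ha h0 DD"
      using frameD(1)[OF fr, of rN] frameD(1)[OF fr, of rHI] frameD(2)[OF fr] n hi by (simp_all add: previous_simps)
    have lt: "hr h rI < lo + c" using b const by simp
    define h1 where "h1 = run (rDV :=\<^sub>r Ld DD (R rI) ;; rV :=\<^sub>r N 0) h"
    have h1: "hr h1 rN = n" "hr h1 rV = 0" "hr h1 rDV = ha h0 DD (hr h rI)" "hr h1 rI = hr h rI"
      "hr h1 rQ = hr h rI * n" "ha h1 CS = ha h0 CS" "ha h1 COL = ha h0 COL" "hr h1 rBEST = hr h rBEST"
      using const I by (simp_all add: h1_def)
    show "runs previous_body h (1000 * (n + 1) + 900) (\<lambda>h'. \<exists>m'<m. ?I h' m')"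
      unfolding previous_body_def
    proof (rule runs_straight_Seq, simp, fold h1_def, rule runs_Seq_frame[OF compare_loop_runs[OF h1(2,1)]])
      fix h2 assume h2: "hr h2 rQ = hr h1 rQ + n \<and>
        hr h2 rDV = hr h1 rDV + hamming n (\<lambda>v. ha h1 CS (hr h1 rQ + v)) (ha h1 COL)"
        and fr2: "frame compare_loop h1 h2"
      have c2: "hr h2 rI = hr h rI" "hr h2 rBEST = hr h rBEST"
        using frameD(1)[OF fr2] h1 by (simp_all add: previous_simps)
      have dv: "hr h2 rDV = ?d (hr h rI)" using h2 h1 by simp
      have ins: "?d ` {lo..<Suc (hr h rI)} = insert (?d (hr h rI)) (?d ` {lo..<hr h rI})"
        using I by (simp add: atLeastLessThanSuc)
      \<comment> \<open>Stored costs are positive, so a 0 in \<open>rBEST\<close> really means that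
        no entry has been seen yet, as \<open>minimum_or_0_insert\<close> requires.\<close>
      have "0 \<notin> ?d ` {lo..<hr h rI}" using pos lt by fastforce
      moreover have "hr (run (improve rBEST rDV ;; inc rI) h2) rBEST = (if hr h rBEST = 0 then ?d (hr h rI)
          else if ?d (hr h rI) < hr h rBEST then ?d (hr h rI) else hr h rBEST)"
        unfolding dv[symmetric] c2(2)[symmetric] by (simp add: improve_def)
      ultimately have "minimum_or_0 (?d ` {lo..<Suc (hr h rI)}) (hr (run (improve rBEST rDV ;; inc rI) h2) rBEST)"
        unfolding ins using I minimum_or_0_insert by presburger
      then show "runs (improve rBEST rDV ;; inc rI) h2 200 (\<lambda>h'. \<exists>m'<m. ?I h' m')"
        using I lt h1 h2 c2 by (intro runs_straight exI[of _ "m - 1"]) (auto simp: improve_def)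
    qed (auto simp: acost_address)
  next
    fix h m
    assume I: "?I h m" and fr: "frame previous_body h0 h" and b: "\<not> hbval (LessH (R rI) (R rHI)) h"
    have "hr h rHI = lo + c" using frameD(1)[OF fr, of rHI] hi by (simp add: previous_simps)
    then have "hr h rI = lo + c" using I b by simp
    then show "minimum_or_0 (?d ` {lo..<lo + c}) (hr h rBEST)" using I by simp
  qed (use assms in auto)
qed

definition append_body :: hcom where
  "append_body = StoreH CS (R rQZ) (Ld COL (R rV)) ;; inc rQZ ;; inc rV"

definition append_loop :: hcom where
  "append_loop = WhileH (LessH (R rV) (R rN)) append_body"

lemma append_loop_runs:
  assumes V: "hr h0 rV = 0" and n: "hr h0 rN = n"
  shows "runs append_loop h0 (1000 * (n + 1))
    (\<lambda>h. hr h rQZ = hr h0 rQZ + n \<and> (\<forall>v<n. ha h CS (hr h0 rQZ + v) = ha h0 COL v) \<and>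
      (\<forall>a<hr h0 rQZ. ha h CS a = ha h0 CS a))"
proof -
  let ?I = "\<lambda>h m. hr h rV + m = n \<and> hr h rQZ = hr h0 rQZ + hr h rV \<and>
    (\<forall>v<hr h rV. ha h CS (hr h0 rQZ + v) = ha h0 COL v) \<and> (\<forall>a<hr h0 rQZ. ha h CS a = ha h0 CS a)"
  show ?thesis unfolding append_loop_def
  proof (rule runs_While_straight[where m = n and K = 1000 and I = ?I])
    fix h m
    assume I: "?I h m" and fr: "frame append_body h0 h" and b: "hbval (LessH (R rV) (R rN)) h"
    have "hr h rN = n" "ha h COL = ha h0 COL"
      using frameD(1)[OF fr, of rN] frameD(2)[OF fr] n by (simp_all add: append_body_def)
    then show "\<exists>m'<m. ?I (run append_body h) m'"
      using I b by (intro exI[of _ "m - 1"]) (auto simp: append_body_def less_Suc_eq)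
  next
    fix h m
    assume I: "?I h m" and fr: "frame append_body h0 h" and b: "\<not> hbval (LessH (R rV) (R rN)) h"
    have "hr h rN = n" using frameD(1)[OF fr, of rN] n by (simp add: append_body_def)
    then have "hr h rV = n" using I b by simp
    then show "hr h rQZ = hr h0 rQZ + n \<and> (\<forall>v<n. ha h CS (hr h0 rQZ + v) = ha h0 COL v) \<and>
      (\<forall>a<hr h0 rQZ. ha h CS a = ha h0 CS a)"
      using I by simp
  qed (use V in \<open>auto simp: append_body_def acost_address\<close>)
qed

text \<open>Increments the binary number of the root colours, \<open>rCY\<close> being the carry, and propagates the
  new colours down the forest.\<close>

definition advance_body :: hcom where
  "advance_body =
     rW :=\<^sub>r Ld ORD (R rV) ;;
     rU :=\<^sub>r Ld PAR (R rW) ;;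
     CondH (EqualH (R rU) (R rW))
       (CondH (EqualH (R rCY) (N 1))
         (CondH (EqualH (Ld COL (R rW)) (N 1))
           (StoreH COL (R rW) (N 2) ;; rCY :=\<^sub>r N 0)
           (StoreH COL (R rW) (N 1)))
         SkipH)
       (StoreH COL (R rW) (Minus (N 3) (Ld COL (R rU)))) ;;
     inc rV"

definition advance_loop :: hcom where
  "advance_loop = WhileH (LessH (R rV) (R rN)) advance_body"

text \<open>Addition of 1 with carry. If a carry remains at the end, the old rank was the largest
  possible one and the new rank is 0, that is, all root colourings have been visited.\<close>

lemma advance_loop_runs:
  assumes V: "hr h0 rV = 0" and n: "hr h0 rN = n" and CY: "hr h0 rCY = 1"
    and F: "forest n F (ha h0 ORD) (ha h0 PAR)" and C: "consistent n (ha h0 PAR) (ha h0 COL)"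
  shows "runs advance_loop h0 (1000 * (n + 1))
    (\<lambda>h. hr h rCY \<le> 1 \<and> consistent n (ha h0 PAR) (ha h COL) \<and>
      rank (ha h0 ORD) (ha h0 PAR) (ha h COL) n + hr h rCY * weight (ha h0 ORD) (ha h0 PAR) n
        = Suc (rank (ha h0 ORD) (ha h0 PAR) (ha h0 COL) n))"
proof -
  let ?ord = "ha h0 ORD" and ?par = "ha h0 PAR"
  let ?good = "\<lambda>x j. x (?ord j) \<in> {1, 2} \<and> (?par (?ord j) \<noteq> ?ord j \<longrightarrow> x (?ord j) = 3 - x (?par (?ord j)))"
  \<comment> \<open>The last clause is the correctness of the adder on a prefix: new low digits plus
    the outgoing carry are the old low digits plus 1. Consistency is claimed only for the processed
    prefix, which suffices because it contains the parents of its vertices.\<close>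
  let ?I = "\<lambda>h m. hr h rV + m = n \<and> hr h rCY \<le> 1 \<and> (\<forall>j<hr h rV. ?good (ha h COL) j) \<and>
    (\<forall>j. hr h rV \<le> j \<longrightarrow> j < n \<longrightarrow> ha h COL (?ord j) = ha h0 COL (?ord j)) \<and>
    rank ?ord ?par (ha h COL) (hr h rV) + hr h rCY * weight ?ord ?par (hr h rV)
      = Suc (rank ?ord ?par (ha h0 COL) (hr h rV))"
  have inj: "?ord i \<noteq> ?ord j" if "i < n" "j < n" "i \<noteq> j" for i j
    using F that by (auto simp: forest_def dest: inj_onD)
  have bits: "ha h0 COL (?ord i) = 1 \<or> ha h0 COL (?ord i) = 2" if "i < n" for i
    using C forest_less[OF F that] by (auto simp: consistent_def)
  show ?thesis unfolding advance_loop_def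
  proof (rule runs_While_straight[where m = n and K = 1000 and I = ?I])
    fix h m
    assume I: "?I h m" and fr: "frame advance_body h0 h" and b: "hbval (LessH (R rV) (R rN)) h"
    have const: "hr h rN = n" "ha h ORD = ?ord" "ha h PAR = ?par"
      using frameD(1)[OF fr, of rN] frameD(2)[OF fr] n by (simp_all add: advance_body_def)
    define i where "i = hr h rV"
    define w where "w = ?ord i"
    have i: "i < n" using b const by (simp add: i_def)
    have old: "ha h COL w = ha h0 COL w" using I i by (simp add: i_def w_def)
    let ?h = "run advance_body h"
    obtain y where y: "ha ?h COL = (ha h COL)(w := y)" and V': "hr ?h rV = Suc i"
      and root: "?par w = w \<Longrightarrow> hr h rCY = 0 \<Longrightarrow> y = ha h0 COL w \<and> hr ?h rCY = 0"
        "?par w = w \<Longrightarrow> hr h rCY = 1 \<Longrightarrow> ha h0 COL w = 1 \<Longrightarrow> y = 2 \<and> hr ?h rCY = 0"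
        "?par w = w \<Longrightarrow> hr h rCY = 1 \<Longrightarrow> ha h0 COL w = 2 \<Longrightarrow> y = 1 \<and> hr ?h rCY = 1"
      and child: "?par w \<noteq> w \<Longrightarrow> y = 3 - ha h COL (?par w) \<and> hr ?h rCY = hr h rCY"
    proof
      show "ha ?h COL = (ha h COL)(w := ha ?h COL w)"
        using const by (auto simp: advance_body_def w_def i_def)
    qed (use const old in \<open>auto simp: advance_body_def w_def i_def\<close>)
    have other: "((ha h COL)(w := y)) (?ord j) = ha h COL (?ord j)" if "j < n" "j \<noteq> i" for j
      using inj[OF that(1) i that(2)] by (simp add: w_def)
    have r: "rank ?ord ?par ((ha h COL)(w := y)) i = rank ?ord ?par (ha h COL) i"
      by (rule rank_cong) (use other i in auto)
    have bit: "hr h rCY = 0 \<or> hr h rCY = 1" using I by auto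
    have parent: "\<exists>k<j. ?par (?ord j) = ?ord k" if "j < n" "?par (?ord j) \<noteq> ?ord j" for j
      using forest_parent[OF F that] by metis
    have new: "?good ((ha h COL)(w := y)) i"
    proof (cases "?par w = w")
      case True
      then show ?thesis using root bits[OF i] bit by (auto simp: w_def)
    next
      case False
      then obtain k where k: "k < i" "?par w = ?ord k" using parent[OF i] by (auto simp: w_def)
      then have "ha h COL (?ord k) \<in> {1, 2}" using I by (auto simp: i_def)
      moreover have "?ord k \<noteq> w" using inj[of k i] k i by (simp add: w_def)
      ultimately show ?thesis using child[OF False] False k by (auto simp: w_def)
    qed
    have good: "?good ((ha h COL)(w := y)) j" if "j < Suc i" for j
    proof (cases "j = i")
      case False
      then have j: "j < i" "j < n" using that i by auto
      then have g: "?good (ha h COL) j" using I by (simp add: i_def)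
      have "((ha h COL)(w := y)) (?par (?ord j)) = ha h COL (?par (?ord j))" if pj: "?par (?ord j) \<noteq> ?ord j"
      proof -
        obtain k where "k < j" "?par (?ord j) = ?ord k" using parent[OF j(2) pj] by blast
        then show ?thesis using other[of k] j i by simp
      qed
      then show ?thesis using g other[OF j(2) False] by simp
    qed (use new in simp)
    have "rank ?ord ?par ((ha h COL)(w := y)) (Suc i) + hr ?h rCY * weight ?ord ?par (Suc i)
      = Suc (rank ?ord ?par (ha h0 COL) (Suc i))"
    proof (cases "?par w = w")
      case True
      then show ?thesis using I bit bits[OF i] root r unfolding w_def i_def[symmetric] by auto
    next
      case False
      then show ?thesis using I child r unfolding w_def i_def[symmetric] by auto
    qed
    moreover have "hr ?h rCY \<le> 1" using root child bit bits[OF i] by (cases "?par w = w") (auto simp: w_def)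
    moreover have "\<forall>j. Suc i \<le> j \<longrightarrow> j < n \<longrightarrow> ((ha h COL)(w := y)) (?ord j) = ha h0 COL (?ord j)"
      using I other by (auto simp: i_def)
    ultimately show "\<exists>m'<m. ?I ?h m'"
      using good I i unfolding y V' by (intro exI[of _ "m - 1"]) (auto simp: i_def)
  next
    fix h m
    assume I: "?I h m" and fr: "frame advance_body h0 h" and b: "\<not> hbval (LessH (R rV) (R rN)) h"
    have "hr h rN = n" using frameD(1)[OF fr, of rN] n by (simp add: advance_body_def)
    then have V: "hr h rV = n" using I b by simp
    have "consistent n ?par (ha h COL)" unfolding consistent_def
    proof (intro allI impI)
      fix v assume "v < n"
      then obtain j where "j < n" "v = ?ord j" using F unfolding forest_def by (metis imageE lessThan_iff)
      moreover have "?good (ha h COL) j" using I V \<open>j < n\<close> by simp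
      ultimately show "ha h COL v \<in> {1, 2} \<and> (?par v \<noteq> v \<longrightarrow> ha h COL v = 3 - ha h COL (?par v))" by simp
    qed
    then show "hr h rCY \<le> 1 \<and> consistent n ?par (ha h COL) \<and>
      rank ?ord ?par (ha h COL) n + hr h rCY * weight ?ord ?par n = Suc (rank ?ord ?par (ha h0 COL) n)"
      using I V by simp
  qed (use V CY in \<open>auto simp: advance_body_def acost_address\<close>)
qed

section \<open>Extending the table by one snapshot\<close>

definition table :: "nat \<Rightarrow> (nat \<Rightarrow> nat set set) \<Rightarrow> nat \<Rightarrow> (nat \<Rightarrow> nat) \<Rightarrow> (nat \<Rightarrow> nat) \<Rightarrow> nat set \<Rightarrow> bool" where
  "table n E t cs dd I \<longleftrightarrow>
     (\<forall>i\<in>I. sound n E t cs dd i) \<and> (\<forall>\<psi>. admissible n E t \<psi> \<longrightarrow> covered n t cs dd I \<psi>)"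

text \<open>Entries \<open>hi..<z\<close> form a partial table for the next snapshot, complete for the colourings in \<open>D\<close>.\<close>

definition extends ::
    "nat \<Rightarrow> (nat \<Rightarrow> nat set set) \<Rightarrow> nat \<Rightarrow> (nat \<Rightarrow> nat) \<Rightarrow> (nat \<Rightarrow> nat) \<Rightarrow> nat \<Rightarrow>
      (nat \<Rightarrow> nat) \<Rightarrow> (nat \<Rightarrow> nat) \<Rightarrow> nat \<Rightarrow> nat \<Rightarrow> ((nat \<Rightarrow> nat) \<Rightarrow> bool) \<Rightarrow> bool" where
  "extends n E t cs0 dd0 hi cs dd z g D \<longleftrightarrow>
     hi \<le> z \<and> (\<forall>a<hi * n. cs a = cs0 a) \<and> (\<forall>i<hi. dd i = dd0 i) \<and>
     (\<forall>i\<in>{hi..<z}. sound n E (Suc t) cs dd i) \<and>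
     (\<forall>\<psi>. admissible n E (Suc t) \<psi> \<and> D (\<psi> (Suc t)) \<longrightarrow> covered n (Suc t) cs dd {hi..<z} \<psi>) \<and>
     minimum_or_0 (dd ` {hi..<z}) g"

definition transition_costs ::
    "nat \<Rightarrow> (nat \<Rightarrow> nat) \<Rightarrow> (nat \<Rightarrow> nat) \<Rightarrow> nat set \<Rightarrow> (nat \<Rightarrow> nat) \<Rightarrow> nat set" where
  "transition_costs n cs dd I x = (\<lambda>i. dd i + hamming n (\<lambda>v. cs (i * n + v)) x) ` I"

lemma entry_less: "i < z \<Longrightarrow> v < n \<Longrightarrow> i * n + v < z * (n :: nat)"
proof -
  assume "i < z" "v < n"
  then have "i * n + v < Suc i * n" by simp
  also have "\<dots> \<le> z * n" using \<open>i < z\<close> by (intro mult_le_mono1) simp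
  finally show ?thesis .
qed

lemma transition_costs_cong:
  assumes "\<And>i v. i \<in> I \<Longrightarrow> v < n \<Longrightarrow> cs (i * n + v) = cs' (i * n + v)" "\<And>i. i \<in> I \<Longrightarrow> dd i = dd' i"
  shows "transition_costs n cs dd I x = transition_costs n cs' dd' I x"
  unfolding transition_costs_def
proof (rule image_cong[OF refl])
  fix i assume "i \<in> I"
  then have "hamming n (\<lambda>v. cs (i * n + v)) x = hamming n (\<lambda>v. cs' (i * n + v)) x"
    by (intro hamming_cong) (simp_all add: assms(1))
  then show "dd i + hamming n (\<lambda>v. cs (i * n + v)) x = dd' i + hamming n (\<lambda>v. cs' (i * n + v)) x"
    using assms(2)[OF \<open>i \<in> I\<close>] by simp
qed

text \<open>No admissible sequence ends in \<open>x\<close>, so completeness extends from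
  \<open>D\<close> to \<open>x\<close> vacuously and nothing has to be recorded.\<close>

lemma extends_skip:
  assumes "extends n E t cs0 dd0 hi cs dd z g D"
    and "\<And>\<psi>. admissible n E (Suc t) \<psi> \<Longrightarrow> (\<And>v. v < n \<Longrightarrow> \<psi> (Suc t) v = x v) \<Longrightarrow> False"
    and "\<And>y. D' y \<Longrightarrow> D y \<or> (\<forall>v<n. y v = x v)"
  shows "extends n E t cs0 dd0 hi cs dd z g D'"
  using assms unfolding extends_def by blast

text \<open>Entry \<open>z\<close> occupies cells from \<open>z * n\<close> on, behind all earlier
  entries, so these survive. Agreement below \<open>n\<close> replaces equality of colourings
  because their values elsewhere are arbitrary.\<close>

lemma extends_add:
  assumes ext: "extends n E t cs0 dd0 hi cs dd z g D" and tab: "table n E t cs0 dd0 {lo..<hi}"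
    and x: "proper n (E (Suc t)) x"
    and b: "minimum_or_0 (transition_costs n cs0 dd0 {lo..<hi} x) b" "b \<noteq> 0"
    and cs': "\<And>a. a < z * n \<Longrightarrow> cs' a = cs a" "\<And>v. v < n \<Longrightarrow> cs' (z * n + v) = x v"
    and dd': "dd' = dd(z := b)"
    and D: "\<And>y. D' y \<Longrightarrow> D y \<or> (\<forall>v<n. y v = x v)"
  shows "extends n E t cs0 dd0 hi cs' dd' (Suc z) (if g = 0 then b else if b < g then b else g) D'"
proof -
  have hi: "hi \<le> z" and cs0: "\<forall>a<hi * n. cs a = cs0 a" and dd0: "\<forall>i<hi. dd i = dd0 i"
    and snd: "\<forall>i\<in>{hi..<z}. sound n E (Suc t) cs dd i"
    and cov: "\<forall>\<psi>. admissible n E (Suc t) \<psi> \<and> D (\<psi> (Suc t)) \<longrightarrow> covered n (Suc t) cs dd {hi..<z} \<psi>"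
    and g: "minimum_or_0 (dd ` {hi..<z}) g"
    using ext unfolding extends_def by auto
  have same: "cs' (i * n + v) = cs (i * n + v)" if "i < z" "v < n" for i v
    using cs'(1) entry_less[OF that] by blast
  have le: "hi * n \<le> z * n" using hi by (rule mult_le_mono1)
  have 1: "\<forall>a<hi * n. cs' a = cs0 a" using cs0 cs'(1) less_le_trans[OF _ le] by simp
  have 2: "\<forall>i<hi. dd' i = dd0 i" using dd0 hi dd' by auto
  have bs: "b \<in> transition_costs n cs0 dd0 {lo..<hi} x" "\<And>s. s \<in> transition_costs n cs0 dd0 {lo..<hi} x \<Longrightarrow> b \<le> s"
    using b by (auto simp: minimum_or_0_def split: if_splits)
  have "sound n E (Suc t) cs' dd' i" if "i \<in> {hi..<Suc z}" for i
  proof (cases "i = z")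
    case True
    obtain j where j: "j \<in> {lo..<hi}" "b = dd0 j + hamming n (\<lambda>v. cs0 (j * n + v)) x"
      using bs(1) by (auto simp: transition_costs_def)
    then have "sound n E t cs0 dd0 j" using tab by (auto simp: table_def)
    then show ?thesis using sound_Suc[of n E t cs0 dd0 j x cs' z dd'] x cs'(2) j(2) dd' True by simp
  next
    case False
    then have i: "i \<in> {hi..<z}" "i < z" using that by auto
    show ?thesis by (rule sound_cong[OF bspec[OF snd i(1)]]) (simp_all add: same i dd' False)
  qed
  moreover have "covered n (Suc t) cs' dd' {hi..<Suc z} \<psi>"
    if \<psi>: "admissible n E (Suc t) \<psi>" "D' (\<psi> (Suc t))" for \<psi>
  proof (cases "D (\<psi> (Suc t))")
    case True
    then have "covered n (Suc t) cs dd {hi..<z} \<psi>" using cov \<psi> by blast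
    then show ?thesis by (rule covered_cong) (use same dd' in auto)
  next
    case False
    then have eq: "\<And>v. v < n \<Longrightarrow> \<psi> (Suc t) v = x v" using D \<psi> by blast
    have "covered n t cs0 dd0 {lo..<hi} \<psi>" using tab \<psi> by (simp add: table_def admissible_Suc)
    then show ?thesis
      by (rule covered_Suc[where x = x and j = z])
        (use eq cs'(2) dd' hi bs(2) in \<open>auto simp: transition_costs_def\<close>)
  qed
  moreover have "minimum_or_0 (dd' ` {hi..<Suc z}) (if g = 0 then b else if b < g then b else g)"
  proof -
    have "dd' ` {hi..<Suc z} = insert b (dd ` {hi..<z})" using hi dd' by (auto simp: atLeastLessThanSuc)
    moreover have "0 \<notin> dd ` {hi..<z}" using snd sound_pos by fastforce
    ultimately show ?thesis using minimum_or_0_insert[OF g] by simp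
  qed
  ultimately show ?thesis using 1 2 hi unfolding extends_def by auto
qed

section \<open>Evaluating one candidate\<close>

definition record_entry :: hcom where
  "record_entry = (StoreH DD (R rZ) (R rBEST) ;; rV :=\<^sub>r N 0) ;; append_loop ;; inc rZ ;; improve rG rBEST"

definition scan_previous :: hcom where
  "scan_previous = (rI :=\<^sub>r R rLO ;; rQ :=\<^sub>r R rQLO) ;; previous_loop"

text \<open>\<open>rBEST\<close> stays 0 both for an improper candidate and when the previous table
  is empty, so a single test decides whether an entry is recorded.\<close>

definition evaluate :: hcom where
  "evaluate =
     (rOK :=\<^sub>r N 1 ;; rJ :=\<^sub>r R rES ;; rBEST :=\<^sub>r N 0) ;;
     check_loop ;;
     CondH (EqualH (R rOK) (N 1)) scan_previous SkipH ;;
     CondH (LessH (N 0) (R rBEST)) record_entry SkipH"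

lemmas evaluate_simps = evaluate_def check_loop_def check_body_def scan_previous_def previous_loop_def
  previous_simps record_entry_def append_loop_def append_body_def

lemma record_entry_runs:
  assumes n: "hr h0 rN = n" and QZ: "hr h0 rQZ = hr h0 rZ * n"
  shows "runs record_entry h0 (1000 * (n + 1) + 500)
    (\<lambda>h. hr h rZ = Suc (hr h0 rZ) \<and> hr h rQZ = Suc (hr h0 rZ) * n \<and>
      hr h rG = (if hr h0 rG = 0 then hr h0 rBEST else if hr h0 rBEST < hr h0 rG then hr h0 rBEST else hr h0 rG) \<and>
      ha h DD = (ha h0 DD)(hr h0 rZ := hr h0 rBEST) \<and>
      (\<forall>a<hr h0 rZ * n. ha h CS a = ha h0 CS a) \<and> (\<forall>v<n. ha h CS (hr h0 rZ * n + v) = ha h0 COL v))"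
proof -
  define h1 where "h1 = run (StoreH DD (R rZ) (R rBEST) ;; rV :=\<^sub>r N 0) h0"
  have V: "hr h1 rV = 0" "hr h1 rN = n" using n by (simp_all add: h1_def)
  have "hr h1 rQZ = hr h0 rZ * n" "hr h1 rZ = hr h0 rZ" "hr h1 rG = hr h0 rG" "hr h1 rBEST = hr h0 rBEST"
    "ha h1 DD = (ha h0 DD)(hr h0 rZ := hr h0 rBEST)" "ha h1 CS = ha h0 CS" "ha h1 COL = ha h0 COL"
    using n QZ by (simp_all add: h1_def)
  note h1 = this
  show ?thesis unfolding record_entry_def
  proof (rule runs_straight_Seq[where B' = "1000 * (n + 1) + 200"], simp, fold h1_def,
      rule runs_Seq_frame[OF append_loop_runs[OF V], where B' = 200])
    fix h assume h: "hr h rQZ = hr h1 rQZ + n \<and> (\<forall>v<n. ha h CS (hr h1 rQZ + v) = ha h1 COL v) \<and>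
      (\<forall>a<hr h1 rQZ. ha h CS a = ha h1 CS a)" and fr: "frame append_loop h1 h"
    have c: "hr h rZ = hr h0 rZ" "hr h rG = hr h0 rG" "hr h rBEST = hr h0 rBEST"
      "ha h DD = (ha h0 DD)(hr h0 rZ := hr h0 rBEST)"
      using frameD(1)[OF fr] frameD(2)[OF fr] h1 by (simp_all add: append_loop_def append_body_def)
    show "runs (inc rZ ;; improve rG rBEST) h 200
     (\<lambda>h. hr h rZ = Suc (hr h0 rZ) \<and> hr h rQZ = Suc (hr h0 rZ) * n \<and>
      hr h rG = (if hr h0 rG = 0 then hr h0 rBEST else if hr h0 rBEST < hr h0 rG then hr h0 rBEST else hr h0 rG) \<and>
      ha h DD = (ha h0 DD)(hr h0 rZ := hr h0 rBEST) \<and>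
      (\<forall>a<hr h0 rZ * n. ha h CS a = ha h0 CS a) \<and> (\<forall>v<n. ha h CS (hr h0 rZ * n + v) = ha h0 COL v))"
      by (rule runs_straight) (use h h1 c in \<open>simp_all add: improve_def\<close>)
  qed (simp_all add: acost_address)
qed

lemma evaluate_runs:
  assumes n: "hr h0 rN = n" and L: "stored_edges (ha h0 IN) p L"
    and p: "hr h0 rES = p" "hr h0 rEE = p + 2 * length L"
    and lo: "hr h0 rLO = lo" "hr h0 rHI = lo + c" "hr h0 rQLO = lo * n"
    and QZ: "hr h0 rQZ = hr h0 rZ * n"
    and ext: "extends n E t cs0 dd0 (lo + c) (ha h0 CS) (ha h0 DD) (hr h0 rZ) (hr h0 rG) D"
    and tab: "table n E t cs0 dd0 {lo..<lo + c}"
    and bits: "\<forall>v<n. ha h0 COL v \<in> {1, 2}"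
    and F: "\<And>u v. {u, v} \<in> E (Suc t) \<longleftrightarrow> (u, v) \<in> set L \<or> (v, u) \<in> set L"
    and Ln: "set L \<subseteq> {..<n} \<times> {..<n}"
    and D: "\<And>y. D' y \<Longrightarrow> D y \<or> (\<forall>v<n. y v = ha h0 COL v)"
  shows "runs evaluate h0 (2000 * (length L + 1) + 2000 * (n + 1) * (c + 1) + 1000 * (n + 1) + 2000)
    (\<lambda>h. hr h0 rZ \<le> hr h rZ \<and> hr h rZ \<le> Suc (hr h0 rZ) \<and> hr h rQZ = hr h rZ * n \<and>
      extends n E t cs0 dd0 (lo + c) (ha h CS) (ha h DD) (hr h rZ) (hr h rG) D')"
    (is "runs _ _ _ ?Q")
proof -
  let ?x = "ha h0 COL" and ?hi = "lo + c"
  let ?ok = "\<forall>(u, v)\<in>set L. ?x u \<noteq> ?x v"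
  let ?S = "transition_costs n (ha h0 CS) (ha h0 DD) {lo..<?hi} ?x"
  have low: "\<And>a. a < ?hi * n \<Longrightarrow> ha h0 CS a = cs0 a" "\<And>i. i < ?hi \<Longrightarrow> ha h0 DD i = dd0 i"
    using ext by (auto simp: extends_def)
  have S: "?S = transition_costs n cs0 dd0 {lo..<?hi} ?x"
    by (rule transition_costs_cong) (use low entry_less in auto)
  have pos: "0 < ha h0 DD i" if "lo \<le> i" "i < ?hi" for i
    using low(2)[of i] that tab sound_pos by (fastforce simp: table_def)
  have proper: "proper n (E (Suc t)) ?x" if ?ok
    using bits F that unfolding proper_def by fastforce
  define h1 where "h1 = run (rOK :=\<^sub>r N 1 ;; rJ :=\<^sub>r R rES ;; rBEST :=\<^sub>r N 0) h0"
  have h1: "stored_edges (ha h1 IN) p L" "hr h1 rJ = p" "hr h1 rEE = p + 2 * length L" "hr h1 rOK = 1"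
    using L p by (simp_all add: h1_def)
  let ?keep = "\<lambda>h. hr h rZ = hr h0 rZ \<and> hr h rQZ = hr h0 rQZ \<and> hr h rG = hr h0 rG \<and> hr h rN = n \<and>
    ha h CS = ha h0 CS \<and> ha h DD = ha h0 DD \<and> ha h COL = ha h0 COL"
  show ?thesis unfolding evaluate_def
  proof (rule runs_straight_Seq[where B' = "2000 * (length L + 1) + 2000 * (n + 1) * (c + 1) + 1000 * (n + 1) + 1900"],
      simp, fold h1_def, rule runs_Seq_frame[OF check_loop_runs[OF h1],
        where B' = "2000 * (n + 1) * (c + 1) + 1000 * (n + 1) + 1900"])
    fix h2 assume ok: "hr h2 rOK = (if \<forall>(u, v)\<in>set L. ha h1 COL u \<noteq> ha h1 COL v then 1 else 0)"
      and fr: "frame check_loop h1 h2"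
    have k2: "?keep h2" "hr h2 rLO = lo" "hr h2 rHI = ?hi" "hr h2 rQLO = lo * n" "hr h2 rBEST = 0"
      using frameD(1)[OF fr] frameD(2)[OF fr] n lo
      by (simp_all add: h1_def check_loop_def check_body_def)
    have ok2: "hr h2 rOK = 1 \<longleftrightarrow> ?ok" using ok by (auto simp: h1_def)
    have scan: "runs (CondH (EqualH (R rOK) (N 1)) scan_previous SkipH) h2 (10 + (100 + 2000 * (n + 1) * (c + 1)))
        (\<lambda>h. minimum_or_0 (if ?ok then ?S else {}) (hr h rBEST))"
    proof (rule runs_mono[OF runs_Cond])
      assume "hbval (EqualH (R rOK) (N 1)) h2"
      then have ok: ?ok using ok2 by simp
      define h3 where "h3 = run (rI :=\<^sub>r R rLO ;; rQ :=\<^sub>r R rQLO) h2"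
      have h3: "hr h3 rN = n" "hr h3 rI = lo" "hr h3 rHI = lo + c" "hr h3 rQ = lo * n" "hr h3 rBEST = 0"
        "ha h3 DD = ha h0 DD" "ha h3 CS = ha h0 CS" "ha h3 COL = ha h0 COL"
        using k2 by (simp_all add: h3_def)
      have "runs previous_loop h3 (2000 * (n + 1) * (c + 1)) (\<lambda>h. minimum_or_0 ?S (hr h rBEST))"
        using previous_loop_runs[OF h3(1-5)] pos unfolding h3(6-8) transition_costs_def by blast
      then show "runs scan_previous h2 (100 + 2000 * (n + 1) * (c + 1))
          (\<lambda>h. minimum_or_0 (if ?ok then ?S else {}) (hr h rBEST))"
        unfolding scan_previous_def if_P[OF ok] h3_def
        by (rule runs_straight_Seq[rotated]) simp_all
    next
      assume "\<not> hbval (EqualH (R rOK) (N 1)) h2"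
      then have "\<not> ?ok" using ok2 by simp
      then show "runs SkipH h2 (100 + 2000 * (n + 1) * (c + 1))
          (\<lambda>h. minimum_or_0 (if ?ok then ?S else {}) (hr h rBEST))"
        unfolding if_not_P[OF \<open>\<not> ?ok\<close>] using k2 by (intro runs_straight) auto
    qed simp_all
    show "runs (CondH (EqualH (R rOK) (N 1)) scan_previous SkipH ;;
          CondH (LessH (N 0) (R rBEST)) record_entry SkipH) h2
        (2000 * (n + 1) * (c + 1) + 1000 * (n + 1) + 1900) ?Q"
    proof (rule runs_Seq_frame[OF scan, where B' = "10 + (1000 * (n + 1) + 500)"])
      fix h4 assume best: "minimum_or_0 (if ?ok then ?S else {}) (hr h4 rBEST)"
        and fr4: "frame (CondH (EqualH (R rOK) (N 1)) scan_previous SkipH) h2 h4"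
      have k4: "?keep h4"
        using frameD(1)[OF fr4] frameD(2)[OF fr4] k2 by (simp add: evaluate_simps)
      show "runs (CondH (LessH (N 0) (R rBEST)) record_entry SkipH) h4 (10 + (1000 * (n + 1) + 500)) ?Q"
      proof (rule runs_mono[OF runs_Cond])
        assume "hbval (LessH (N 0) (R rBEST)) h4"
        then have b: "hr h4 rBEST \<noteq> 0" by simp
        then have ok: ?ok using best by (auto split: if_splits)
        have QZ4: "hr h4 rQZ = hr h4 rZ * n" and N4: "hr h4 rN = n" using k4 QZ by auto
        have min: "minimum_or_0 (transition_costs n cs0 dd0 {lo..<?hi} ?x) (hr h4 rBEST)"
          using best unfolding if_P[OF ok] S .
        show "runs record_entry h4 (1000 * (n + 1) + 500) ?Q"
        proof (rule runs_mono[OF record_entry_runs[OF N4 QZ4] le_refl])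
          fix h :: hstate
          assume h: "hr h rZ = Suc (hr h4 rZ) \<and> hr h rQZ = Suc (hr h4 rZ) * n \<and>
            hr h rG = (if hr h4 rG = 0 then hr h4 rBEST else if hr h4 rBEST < hr h4 rG then hr h4 rBEST else hr h4 rG) \<and>
            ha h DD = (ha h4 DD)(hr h4 rZ := hr h4 rBEST) \<and>
            (\<forall>a<hr h4 rZ * n. ha h CS a = ha h4 CS a) \<and> (\<forall>v<n. ha h CS (hr h4 rZ * n + v) = ha h4 COL v)"
          have "extends n E t cs0 dd0 ?hi (ha h CS) (ha h DD) (Suc (hr h0 rZ))
            (if hr h0 rG = 0 then hr h4 rBEST else if hr h4 rBEST < hr h0 rG then hr h4 rBEST else hr h0 rG) D'"
            by (rule extends_add[OF ext tab proper[OF ok] min b]) (use h k4 D in auto)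
          then show "?Q h" using h k4 by auto
        qed
      next
        assume "\<not> hbval (LessH (N 0) (R rBEST)) h4"
        then have b: "minimum_or_0 (if ?ok then ?S else {}) 0" using best by simp
        have "extends n E t cs0 dd0 ?hi (ha h0 CS) (ha h0 DD) (hr h0 rZ) (hr h0 rG) D'"
        proof (rule extends_skip[OF ext _ D])
          fix \<psi> assume \<psi>: "admissible n E (Suc t) \<psi>" "\<And>v. v < n \<Longrightarrow> \<psi> (Suc t) v = ?x v"
          have pr: "proper n (E (Suc t)) (\<psi> (Suc t))" and adm: "admissible n E t \<psi>"
            using \<psi>(1) by (simp_all add: admissible_Suc)
          show False
          proof (cases ?ok)
            case True
            \<comment> \<open>A proper candidate with best cost 0 is possible only if the previous
              table is empty, but completeness of that table provides an entry for the first
              \<open>t\<close> snapshots of \<open>\<psi>\<close>.\<close>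
            have "\<forall>i\<in>{lo..<?hi}. ha h0 DD i \<noteq> 0" using pos by fastforce
            then have "0 \<notin> ?S" by (auto simp: transition_costs_def)
            then have "?S = {}" using b True minimum_or_0_zero by auto
            then have "{lo..<?hi} = {}" unfolding transition_costs_def by blast
            moreover have "covered n t cs0 dd0 {lo..<?hi} \<psi>" using tab adm by (simp add: table_def)
            ultimately show False by (simp add: covered_def)
          next
            case False
            then obtain u v where uv: "(u, v) \<in> set L" "?x u = ?x v" by blast
            then have "\<psi> (Suc t) u = \<psi> (Suc t) v" using \<psi>(2) Ln by auto
            then show False using pr F uv(1) unfolding proper_def by blast
          qed
        qed
        then show "runs SkipH h4 (1000 * (n + 1) + 500) ?Q"
          using k4 QZ by (intro runs_straight) auto
      qed simp_all
    qed simp_all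
  qed simp_all
qed

section \<open>Running through all root colourings\<close>

definition enumerate_body :: hcom where
  "enumerate_body = evaluate ;; (rCY :=\<^sub>r N 1 ;; rV :=\<^sub>r N 0) ;; advance_loop"

definition enumerate_loop :: hcom where
  "enumerate_loop = WhileH (EqualH (R rCY) (N 0)) enumerate_body"

lemmas enumerate_simps = enumerate_body_def evaluate_simps advance_loop_def advance_body_def

text \<open>The rank grows by 1 in each iteration, so it counts the candidates already treated. It
  therefore bounds the number of iterations and the number of new entries by \<open>W\<close> at the
  same time.\<close>

lemma enumerate_loop_runs:
  fixes c L
  assumes n: "hr h0 rN = n" and L: "stored_edges (ha h0 IN) p L"
    and p: "hr h0 rES = p" "hr h0 rEE = p + 2 * length L"
    and lo: "hr h0 rLO = lo" "hr h0 rHI = lo + c" "hr h0 rQLO = lo * n"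
    and Z: "hr h0 rZ = lo + c" "hr h0 rQZ = (lo + c) * n" and G: "hr h0 rG = 0" and CY: "hr h0 rCY = 0"
    and tab: "table n E t (ha h0 CS) (ha h0 DD) {lo..<lo + c}"
    and F: "\<And>u v. {u, v} \<in> E (Suc t) \<longleftrightarrow> (u, v) \<in> set L \<or> (v, u) \<in> set L"
    and Ln: "set L \<subseteq> {..<n} \<times> {..<n}"
    and forest: "forest n (E (Suc t)) (ha h0 ORD) (ha h0 PAR)"
    and cons: "consistent n (ha h0 PAR) (ha h0 COL)"
    and roots: "\<forall>v<n. ha h0 PAR v = v \<longrightarrow> ha h0 COL v = 1"
  defines "K \<equiv> 2000 * (length L + 1) + 2000 * (n + 1) * (c + 1) + 2000 * (n + 1) + 3000"
    and "W \<equiv> weight (ha h0 ORD) (ha h0 PAR) n"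
  shows "runs enumerate_loop h0 (K * (W + 1))
    (\<lambda>h. hr h rZ \<le> lo + c + W \<and> hr h rQZ = hr h rZ * n \<and>
      extends n E t (ha h0 CS) (ha h0 DD) (lo + c) (ha h CS) (ha h DD) (hr h rZ) (hr h rG)
        (consistent n (ha h0 PAR)))"
proof -
  let ?ord = "ha h0 ORD" and ?par = "ha h0 PAR" and ?hi = "lo + c"
  let ?rank = "\<lambda>x. rank ?ord ?par x n"
  \<comment> \<open>After the overflow the rank itself is back at 0; reading it as \<open>W\<close>
    lets the invariant say that all consistent colourings have been treated.\<close>
  let ?R = "\<lambda>h. if hr h rCY = 0 then ?rank (ha h COL) else W"
  let ?D = "\<lambda>r y. consistent n ?par y \<and> ?rank y < r"
  let ?ext = "\<lambda>h. extends n E t (ha h0 CS) (ha h0 DD) ?hi (ha h CS) (ha h DD) (hr h rZ) (hr h rG)"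
  let ?I = "\<lambda>h m. ?R h + m = W \<and> consistent n ?par (ha h COL) \<and> hr h rQZ = hr h rZ * n \<and>
    hr h rZ \<le> ?hi + ?R h \<and> ?ext h (?D (?R h))"
  have lt: "?rank x < W" if "consistent n ?par x" for x unfolding W_def
  proof (rule rank_less)
    fix j assume "j < n"
    then have "x (?ord j) \<in> {1, 2}" using that forest_less[OF forest] unfolding consistent_def by blast
    then show "x (?ord j) \<le> 2" by auto
  qed
  show ?thesis unfolding enumerate_loop_def
  proof (rule runs_While[where m = W and K = "K - 10" and K' = K and I = ?I])
    fix h m
    assume I: "?I h m" and fr: "frame enumerate_body h0 h" and b: "hbval (EqualH (R rCY) (N 0)) h"
    have const: "hr h rN = n" "ha h IN = ha h0 IN" "ha h ORD = ?ord" "ha h PAR = ?par"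
      "hr h rES = p" "hr h rEE = p + 2 * length L" "hr h rLO = lo" "hr h rHI = lo + c" "hr h rQLO = lo * n"
      using frameD(1)[OF fr] frameD(2)[OF fr] n p lo by (simp_all add: enumerate_simps)
    let ?x = "ha h COL" and ?r = "?rank (ha h COL)"
    have R: "?R h = ?r" using b by simp
    have x: "consistent n ?par ?x" and QZ: "hr h rQZ = hr h rZ * n" and m: "?r + m = W"
      and Z: "hr h rZ \<le> ?hi + ?r" and ext: "?ext h (?D ?r)"
      using I unfolding R by auto
    \<comment> \<open>By \<open>rank_inject\<close>, the current candidate is, up to agreement below
      \<open>n\<close>, the only consistent colouring of its rank.\<close>
    have D: "?D ?r y \<or> (\<forall>v<n. y v = ?x v)" if "?D (Suc ?r) y" for y
    proof (cases "?rank y = ?r")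
      case True
      have "y v = ?x v" if "v < n" for v
      proof -
        have "v \<in> ?ord ` {..<n}" using forest \<open>v < n\<close> by (simp add: forest_def)
        then obtain i where "i < n" "v = ?ord i" by blast
        then show ?thesis using rank_inject[OF forest _ x le_refl True] \<open>?D (Suc ?r) y\<close> by blast
      qed
      then show ?thesis by blast
    qed (use that in auto)
    have bits: "\<forall>v<n. ?x v \<in> {1, 2}" using x by (simp add: consistent_def)
    have L': "stored_edges (ha h IN) p L" using L const by simp
    show "runs enumerate_body h (K - 10) (\<lambda>h'. \<exists>m'<m. ?I h' m')"
      unfolding enumerate_body_def
    proof (rule runs_Seq_frame[OF evaluate_runs[OF const(1) L' const(5-9) QZ ext tab bits F Ln D],
          where B' = "50 + 1000 * (n + 1)"])
      fix h1 assume h1: "hr h rZ \<le> hr h1 rZ \<and> hr h1 rZ \<le> Suc (hr h rZ) \<and> hr h1 rQZ = hr h1 rZ * n \<and>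
        ?ext h1 (?D (Suc ?r))" and fr1: "frame evaluate h h1"
      define h2 where "h2 = run (rCY :=\<^sub>r N 1 ;; rV :=\<^sub>r N 0) h1"
      have c1: "hr h1 rN = n" "ha h1 COL = ?x" "ha h1 ORD = ?ord" "ha h1 PAR = ?par"
        using frameD(1)[OF fr1] frameD(2)[OF fr1] const by (simp_all add: evaluate_simps)
      then have h2: "hr h2 rV = 0" "hr h2 rN = n" "hr h2 rCY = 1" "ha h2 ORD = ?ord" "ha h2 PAR = ?par" "ha h2 COL = ?x"
        "hr h2 rZ = hr h1 rZ" "hr h2 rQZ = hr h1 rQZ" "hr h2 rG = hr h1 rG" "ha h2 CS = ha h1 CS" "ha h2 DD = ha h1 DD"
        by (simp_all add: h2_def)
      have adv: "runs advance_loop h2 (1000 * (n + 1)) (\<lambda>h'. hr h' rCY \<le> 1 \<and> consistent n ?par (ha h' COL) \<and>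
          ?rank (ha h' COL) + hr h' rCY * W = Suc ?r)"
        using advance_loop_runs[OF h2(1-3)] forest x unfolding h2(4-6) W_def by blast
      have "runs advance_loop h2 (1000 * (n + 1)) (\<lambda>h'. \<exists>m'<m. ?I h' m')"
      proof (rule runs_mono[OF runs_frame[OF adv] le_refl])
        fix h' assume h': "(hr h' rCY \<le> 1 \<and> consistent n ?par (ha h' COL) \<and>
          ?rank (ha h' COL) + hr h' rCY * W = Suc ?r) \<and> frame advance_loop h2 h'"
        then have fr': "frame advance_loop h2 h'" and cy: "hr h' rCY = 0 \<or> hr h' rCY = 1" by auto
        have c': "hr h' rZ = hr h1 rZ" "hr h' rQZ = hr h1 rQZ" "hr h' rG = hr h1 rG"
          "ha h' CS = ha h1 CS" "ha h' DD = ha h1 DD"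
          using frameD(1)[OF fr'] frameD(2)[OF fr'] h2 by (simp_all add: advance_loop_def advance_body_def)
        have "Suc ?r \<le> W" using lt[OF x] by simp
        then have R': "?R h' = Suc ?r" using h' cy by auto
        then show "\<exists>m'<m. ?I h' m'"
          using h' h1 c' Z m lt[OF x] by (intro exI[of _ "m - 1"]) auto
      qed
      then show "runs ((rCY :=\<^sub>r N 1 ;; rV :=\<^sub>r N 0) ;; advance_loop) h1 (50 + 1000 * (n + 1)) (\<lambda>h'. \<exists>m'<m. ?I h' m')"
        unfolding h2_def by (rule runs_straight_Seq[rotated]) simp_all
    qed (simp_all add: K_def)
  next
    have "?rank (ha h0 COL) = 0"
      by (rule rank_eq_0) (simp add: roots forest_less[OF forest])
    then show "?I h0 W" using Z G CY cons by (simp add: extends_def)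
  next
    fix h m
    assume I: "?I h m" and "frame enumerate_body h0 h" and b: "\<not> hbval (EqualH (R rCY) (N 0)) h"
    then have "?ext h (?D W)" by auto
    then have "?ext h (consistent n ?par)" using lt by (simp add: extends_def)
    then show "hr h rZ \<le> ?hi + W \<and> hr h rQZ = hr h rZ * n \<and> ?ext h (consistent n ?par)"
      using I b by auto
  qed (simp_all add: K_def)
qed

section \<open>The main loop\<close>

primrec stored :: "(nat \<Rightarrow> nat) \<Rightarrow> nat \<Rightarrow> (nat \<times> nat) list list \<Rightarrow> bool" where
  "stored f p [] \<longleftrightarrow> True"
| "stored f p (L # Ls) \<longleftrightarrow>
     f p = length L \<and> stored_edges f (p + 1) L \<and> stored f (p + 1 + 2 * length L) Ls"

lemma edge_list_iff:
  assumes "edge_list L F"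
  shows "{u, v} \<in> F \<longleftrightarrow> (u, v) \<in> set L \<or> (v, u) \<in> set L"
proof -
  have "F = (\<lambda>(u, v). {u, v}) ` set L" using assms by (simp add: edge_list_def)
  then have "{u, v} \<in> F \<longleftrightarrow> (\<exists>a b. (a, b) \<in> set L \<and> {u, v} = {a, b})" by auto
  then show ?thesis by (auto simp: doubleton_eq_iff)
qed

lemma edge_list_length: "edge_list L F \<Longrightarrow> length L = card F"
  unfolding edge_list_def by (metis distinct_card length_map)

lemma linked_adjacency:
  assumes L: "edge_list L F" and F: "\<forall>e\<in>F. e \<subseteq> {..<n} \<and> card e = 2"
    and lk: "linked n nxt tgt head adj (set L \<union> (set L)\<inverse>) p c"
  shows "adjacency n F adj tgt"
proof -
  have 1: "u < n \<and> v < n \<and> u \<noteq> v" if "{u, v} \<in> F" for u v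
    using bspec[OF F that] by (auto simp: card_insert_if split: if_splits)
  have 2: "(\<exists>b\<in>set (adj v). tgt b = w) \<longleftrightarrow> {v, w} \<in> F" if "v < n" for v w
    using lk that edge_list_iff[OF L, of v w] unfolding linked_def by auto
  show ?thesis unfolding adjacency_def using 1 2 by blast
qed

text \<open>The table drifts through memory, so its position \<open>lo\<close> is arbitrary and only
  its size \<open>c\<close> is bounded. \<open>rG\<close> is constrained only for
  \<open>0 < t\<close> because the initial table is written without setting it.\<close>

definition state_inv :: "nat \<Rightarrow> (nat \<Rightarrow> nat set set) \<Rightarrow> nat \<Rightarrow> nat \<Rightarrow> hstate \<Rightarrow> bool" where
  "state_inv n E k t h \<longleftrightarrow> (\<exists>lo c. hr h rN = n \<and> hr h rLO = lo \<and> hr h rHI = lo + c \<and> hr h rZ = lo + c \<and>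
     hr h rQLO = lo * n \<and> hr h rQHI = (lo + c) * n \<and> hr h rQZ = (lo + c) * n \<and> c \<le> 2 ^ k \<and>
     table n E t (ha h CS) (ha h DD) {lo..<lo + c} \<and>
     (0 < t \<longrightarrow> minimum_or_0 (ha h DD ` {lo..<lo + c}) (hr h rG)))"

definition snapshot :: hcom where
  "snapshot =
     (rES :=\<^sub>r Plus (R rP) (N 1) ;;
      rEE :=\<^sub>r Plus (R rES) (Plus (Ld IN (R rP)) (Ld IN (R rP))) ;;
      rP :=\<^sub>r R rES ;; rV :=\<^sub>r N 0) ;;
     reset_loop ;;
     build_loop ;;
     (rQH :=\<^sub>r N 0 ;; rQT :=\<^sub>r N 0 ;; rRT :=\<^sub>r N 0 ;; rA :=\<^sub>r N 0) ;;
     search_loop ;;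
     (rG :=\<^sub>r N 0 ;; rCY :=\<^sub>r N 0) ;;
     enumerate_loop ;;
     (rLO :=\<^sub>r R rHI ;; rHI :=\<^sub>r R rZ ;; rQLO :=\<^sub>r R rQHI ;; rQHI :=\<^sub>r R rQZ ;; rT :=\<^sub>r Minus (R rT) (N 1))"

text \<open>Here \<open>m\<close> is the number of edges of the snapshot and \<open>K\<close> stands
  for \<open>2 ^ k\<close>. The product of enumeration and comparison is at most
  \<open>16000 * (n * K\<^sup>2)\<close>; lower-order terms are absorbed using
  \<open>1 \<le> n\<close> and \<open>1 \<le> K\<close>, and the constant on the right is
  generous.\<close>

lemma snapshot_cost_bound:
  fixes m n c K :: nat
  assumes "1 \<le> n" "c \<le> K" "1 \<le> K"
  shows "200 + (1000 * (n + 1) + (1000 * (m + 1) + (100 + (1000 * (2 * n + 2 * m + 1) + (50 +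
    ((2000 * (m + 1) + 2000 * (n + 1) * (c + 1) + 2000 * (n + 1) + 3000) * (K + 1) + 100))))))
    \<le> 100000 * (m * K + n * K\<^sup>2)"
proof -
  have K: "K + 1 \<le> 2 * K" "c + 1 \<le> 2 * K" and n: "n + 1 \<le> 2 * n" using assms by auto
  have "m \<le> m * K" and nK: "n \<le> n * K" and nK2: "n * K \<le> n * K\<^sup>2"
    using assms by (simp_all add: power2_eq_square)
  have "2000 * (n + 1) * (c + 1) \<le> 2000 * (2 * n) * (2 * K)" using n K by (intro mult_le_mono) auto
  also have "\<dots> = 8000 * (n * K)" by simp
  finally have "2000 * (m + 1) + 2000 * (n + 1) * (c + 1) + 2000 * (n + 1) + 3000
      \<le> 2000 * (m + 1) + 8000 * (n * K) + 2000 * (n + 1) + 3000" by linarith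
  also have "\<dots> \<le> 2000 * m + 17000 * (n * K)"
  proof -
    have "2000 * (m + 1) + 8000 * q + 2000 * (n + 1) + 3000 \<le> 2000 * m + 17000 * q" if "n \<le> q" for q
      using that assms(1) by simp
    then show ?thesis using nK .
  qed
  finally have "2000 * (m + 1) + 2000 * (n + 1) * (c + 1) + 2000 * (n + 1) + 3000
      \<le> 2000 * m + 17000 * (n * K)" .
  then have "(2000 * (m + 1) + 2000 * (n + 1) * (c + 1) + 2000 * (n + 1) + 3000) * (K + 1)
      \<le> (2000 * m + 17000 * (n * K)) * (2 * K)" using K by (intro mult_le_mono)
  also have "\<dots> = 4000 * (m * K) + 34000 * (n * K\<^sup>2)" by (simp add: algebra_simps power2_eq_square)
  finally show ?thesis using \<open>m \<le> m * K\<close> nK nK2 assms(1) by simp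
qed

lemma snapshot_runs:
  assumes inv: "state_inv n E k t h0" and st: "stored (ha h0 IN) (hr h0 rP) (L # Ls)"
    and el: "edge_list L (E (Suc t))" and ed: "\<forall>e\<in>E (Suc t). e \<subseteq> {..<n} \<and> card e = 2"
    and comp: "card (connected_components {..<n} (E (Suc t))) \<le> k" and n1: "1 \<le> n"
  shows "runs snapshot h0 (100000 * (length L * 2 ^ k + n * (2 ^ k)\<^sup>2))
    (\<lambda>h. state_inv n E k (Suc t) h \<and> stored (ha h IN) (hr h rP) Ls \<and> hr h rT = hr h0 rT - 1)"
proof -
  let ?m = "length L" and ?IN = "ha h0 IN"
  obtain lo c where n: "hr h0 rN = n" and lo: "hr h0 rLO = lo" "hr h0 rHI = lo + c" "hr h0 rZ = lo + c"
    "hr h0 rQLO = lo * n" "hr h0 rQHI = (lo + c) * n" "hr h0 rQZ = (lo + c) * n" and c: "c \<le> 2 ^ k"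
    and tab: "table n E t (ha h0 CS) (ha h0 DD) {lo..<lo + c}"
    using inv unfolding state_inv_def by blast
  define p where "p = hr h0 rP + 1"
  have IN: "?IN (hr h0 rP) = ?m" "stored_edges ?IN p L" "stored ?IN (p + 2 * ?m) Ls"
    using st by (simp_all add: p_def)
  have F: "{u, v} \<in> E (Suc t) \<longleftrightarrow> (u, v) \<in> set L \<or> (v, u) \<in> set L" for u v
    using edge_list_iff[OF el] .
  have Ln: "set L \<subseteq> {..<n} \<times> {..<n}"
  proof
    fix e assume "e \<in> set L"
    then obtain u v where e: "e = (u, v)" "{u, v} \<in> E (Suc t)" using F by (metis surj_pair)
    then have "{u, v} \<subseteq> {..<n}" using ed by blast
    then show "e \<in> {..<n} \<times> {..<n}" using e by simp
  qed
  let ?keep = "\<lambda>h. hr h rN = n \<and> hr h rES = p \<and> hr h rEE = p + 2 * ?m \<and> hr h rT = hr h0 rT \<and>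
    hr h rLO = lo \<and> hr h rHI = lo + c \<and> hr h rQLO = lo * n \<and> hr h rQHI = (lo + c) * n \<and> ha h IN = ?IN"
  let ?tab = "\<lambda>h. hr h rZ = lo + c \<and> hr h rQZ = (lo + c) * n \<and> ha h CS = ha h0 CS \<and> ha h DD = ha h0 DD"
  let ?K = "2000 * (?m + 1) + 2000 * (n + 1) * (c + 1) + 2000 * (n + 1) + 3000"
  \<comment> \<open>\<open>B2\<close>, \<open>B4\<close> and \<open>B6\<close> bound the time of the
    rest of the program from the states \<open>h2\<close>, \<open>h4\<close> and \<open>h6\<close>
    below. They stay folded until the final estimate.\<close>
  define B6 where "B6 = ?K * (2 ^ k + 1) + 100"
  define B4 where "B4 = 1000 * (2 * n + 2 * ?m + 1) + (50 + B6)"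
  define B2 where "B2 = 1000 * (?m + 1) + (100 + B4)"
  let ?Q = "\<lambda>h. state_inv n E k (Suc t) h \<and> stored (ha h IN) (hr h rP) Ls \<and> hr h rT = hr h0 rT - 1"
  define h1 where "h1 = run (rES :=\<^sub>r Plus (R rP) (N 1) ;;
      rEE :=\<^sub>r Plus (R rES) (Plus (Ld IN (R rP)) (Ld IN (R rP))) ;;
      rP :=\<^sub>r R rES ;; rV :=\<^sub>r N 0) h0"
  have h1: "hr h1 rV = 0" "hr h1 rN = n" "hr h1 rP = p" "?keep h1" "?tab h1"
    using n lo IN(1) by (simp_all add: h1_def p_def)
  have "runs snapshot h0 (200 + (1000 * (n + 1) + B2)) ?Q" unfolding snapshot_def
  proof (rule runs_straight_Seq[where B' = "1000 * (n + 1) + B2"], simp, fold h1_def,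
      rule runs_Seq_frame[OF reset_loop_runs[OF h1(1)], where B' = B2])
    fix h2 assume h2: "\<forall>v<hr h1 rN. ha h2 HEAD v = 0 \<and> ha h2 COL v = 0" and fr2: "frame reset_loop h1 h2"
    have k2: "?keep h2" "?tab h2" "hr h2 rP = p"
      using frameD(1)[OF fr2] frameD(2)[OF fr2] h1 by (simp_all add: reset_loop_def reset_body_def)
    have b2: "stored_edges (ha h2 IN) p L" "0 < p" "hr h2 rEE = p + 2 * ?m" "\<forall>v<n. ha h2 HEAD v = 0"
      using k2 IN h2 h1(2) by (simp_all add: p_def)
    show "runs (build_loop ;; (rQH :=\<^sub>r N 0 ;; rQT :=\<^sub>r N 0 ;; rRT :=\<^sub>r N 0 ;; rA :=\<^sub>r N 0) ;;
        search_loop ;; (rG :=\<^sub>r N 0 ;; rCY :=\<^sub>r N 0) ;; enumerate_loop ;;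
        (rLO :=\<^sub>r R rHI ;; rHI :=\<^sub>r R rZ ;; rQLO :=\<^sub>r R rQHI ;; rQHI :=\<^sub>r R rQZ ;; rT :=\<^sub>r Minus (R rT) (N 1)))
        h2 B2 ?Q"
    proof (rule runs_Seq_frame[OF build_loop_runs[OF b2(1) Ln b2(2) k2(3) b2(3,4)], where B' = "100 + B4"])
      fix h3 assume h3: "hr h3 rP = p + 2 * ?m \<and> (\<exists>adj. linked n (ha h3 NXT) (ha h3 TGT) (ha h3 HEAD) adj
          (set L \<union> (set L)\<inverse>) (p + 2 * ?m) (2 * ?m))" and fr3: "frame build_loop h2 h3"
      then obtain adj where lk: "linked n (ha h3 NXT) (ha h3 TGT) (ha h3 HEAD) adj
          (set L \<union> (set L)\<inverse>) (p + 2 * ?m) (2 * ?m)" by blast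
      have k3: "?keep h3" "?tab h3" "\<forall>v<n. ha h3 COL v = 0"
        using frameD(1)[OF fr3] frameD(2)[OF fr3] k2 h2 h1(2) by (simp_all add: build_loop_def build_body_def)
      define h4 where "h4 = run (rQH :=\<^sub>r N 0 ;; rQT :=\<^sub>r N 0 ;; rRT :=\<^sub>r N 0 ;; rA :=\<^sub>r N 0) h3"
      have h4: "hr h4 rN = n" "hr h4 rA = 0" "hr h4 rQH = 0" "hr h4 rQT = 0" "hr h4 rRT = 0" "\<forall>v<n. ha h4 COL v = 0"
        and k4: "?keep h4" "?tab h4" "hr h4 rP = p + 2 * ?m"
        and arr4: "ha h4 TGT = ha h3 TGT" "ha h4 NXT = ha h3 NXT" "ha h4 HEAD = ha h3 HEAD"
        using k3 h3 by (simp_all add: h4_def)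
      have adj: "adjacency n (E (Suc t)) adj (ha h4 TGT)"
        using linked_adjacency[OF el ed lk] unfolding arr4 .
      have ch: "\<And>v. v < n \<Longrightarrow> chain (ha h4 NXT) (ha h4 HEAD v) (adj v)" and len: "(\<Sum>v<n. length (adj v)) = 2 * ?m"
        using lk unfolding arr4 linked_def by auto
      have "runs (search_loop ;; (rG :=\<^sub>r N 0 ;; rCY :=\<^sub>r N 0) ;; enumerate_loop ;;
        (rLO :=\<^sub>r R rHI ;; rHI :=\<^sub>r R rZ ;; rQLO :=\<^sub>r R rQHI ;; rQHI :=\<^sub>r R rQZ ;; rT :=\<^sub>r Minus (R rT) (N 1)))
        h4 B4 ?Q"
      proof (rule runs_Seq_frame[OF search_loop_runs[OF adj ch h4], where B' = "50 + B6"])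
        fix h5 assume h5: "forest n (E (Suc t)) (ha h5 ORD) (ha h5 PAR) \<and> consistent n (ha h5 PAR) (ha h5 COL) \<and>
          (\<forall>v<n. ha h5 PAR v = v \<longrightarrow> ha h5 COL v = 1) \<and>
          card {v. v < n \<and> ha h5 PAR v = v} \<le> card (connected_components {..<n} (E (Suc t)))"
          and fr5: "frame search_loop h4 h5"
        have k5: "?keep h5" "?tab h5" "hr h5 rP = p + 2 * ?m"
          using frameD(1)[OF fr5] frameD(2)[OF fr5] k4 by (simp_all add: search_loop_def search_body_def)
        define h6 where "h6 = run (rG :=\<^sub>r N 0 ;; rCY :=\<^sub>r N 0) h5"
        have k6: "?keep h6" "?tab h6" "hr h6 rP = p + 2 * ?m" "hr h6 rG = 0" "hr h6 rCY = 0"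
          "ha h6 ORD = ha h5 ORD" "ha h6 PAR = ha h5 PAR" "ha h6 COL = ha h5 COL"
          using k5 by (simp_all add: h6_def)
        have a6: "hr h6 rN = n" "stored_edges (ha h6 IN) p L" "hr h6 rES = p" "hr h6 rEE = p + 2 * ?m"
          "hr h6 rLO = lo" "hr h6 rHI = lo + c" "hr h6 rQLO = lo * n" "hr h6 rZ = lo + c" "hr h6 rQZ = (lo + c) * n"
          using k6 IN by simp_all
        have t6: "table n E t (ha h6 CS) (ha h6 DD) {lo..<lo + c}" using tab k6 by simp
        have f6: "forest n (E (Suc t)) (ha h6 ORD) (ha h6 PAR)" "consistent n (ha h6 PAR) (ha h6 COL)"
          "\<forall>v<n. ha h6 PAR v = v \<longrightarrow> ha h6 COL v = 1" using h5 k6 by auto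
        let ?W = "weight (ha h6 ORD) (ha h6 PAR) n"
        \<comment> \<open>The bound on the number of components enters here: there are at most
          \<open>k\<close> roots, hence at most \<open>2 ^ k\<close> candidates.\<close>
        have "?W = 2 ^ card {v. v < n \<and> ha h6 PAR v = v}" by (rule weight_eq_roots[OF f6(1)])
        also have "\<dots> \<le> 2 ^ k" using h5 k6 comp by (intro power_increasing) auto
        finally have W: "?W \<le> 2 ^ k" .
        then have "?K * (?W + 1) \<le> ?K * (2 ^ k + 1)" by (intro mult_le_mono2) simp
        note en = runs_mono[OF enumerate_loop_runs[OF a6 k6(4,5) t6 F Ln f6] this]
        have "runs (enumerate_loop ;;
          (rLO :=\<^sub>r R rHI ;; rHI :=\<^sub>r R rZ ;; rQLO :=\<^sub>r R rQHI ;; rQHI :=\<^sub>r R rQZ ;; rT :=\<^sub>r Minus (R rT) (N 1)))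
          h6 B6 ?Q"
        proof (rule runs_Seq_frame[OF en, where B' = 100])
          fix h7 assume h7: "hr h7 rZ \<le> lo + c + ?W \<and> hr h7 rQZ = hr h7 rZ * n \<and>
            extends n E t (ha h6 CS) (ha h6 DD) (lo + c) (ha h7 CS) (ha h7 DD) (hr h7 rZ) (hr h7 rG)
              (consistent n (ha h6 PAR))" and fr7: "frame enumerate_loop h6 h7"
          have k7: "?keep h7" "hr h7 rP = p + 2 * ?m"
            using frameD(1)[OF fr7] frameD(2)[OF fr7] k6 by (simp_all add: enumerate_loop_def enumerate_simps)
          have e7: "lo + c \<le> hr h7 rZ" "\<forall>i\<in>{lo + c..<hr h7 rZ}. sound n E (Suc t) (ha h7 CS) (ha h7 DD) i"
            "minimum_or_0 (ha h7 DD ` {lo + c..<hr h7 rZ}) (hr h7 rG)"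
            "\<And>\<psi>. admissible n E (Suc t) \<psi> \<Longrightarrow> consistent n (ha h6 PAR) (\<psi> (Suc t)) \<Longrightarrow>
              covered n (Suc t) (ha h7 CS) (ha h7 DD) {lo + c..<hr h7 rZ} \<psi>"
            using h7 unfolding extends_def by auto
          \<comment> \<open>Completeness for consistent colourings is completeness for all
            admissible sequences, since proper colourings are consistent with the forest.\<close>
          have tab7: "table n E (Suc t) (ha h7 CS) (ha h7 DD) {lo + c..<hr h7 rZ}"
            unfolding table_def using e7(2,4) proper_consistent[OF f6(1)] by (simp add: admissible_Suc)
          define h8 where "h8 = run (rLO :=\<^sub>r R rHI ;; rHI :=\<^sub>r R rZ ;; rQLO :=\<^sub>r R rQHI ;; rQHI :=\<^sub>r R rQZ ;;
            rT :=\<^sub>r Minus (R rT) (N 1)) h7"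
          have c7: "hr h7 rZ - (lo + c) \<le> 2 ^ k" using h7 W by linarith
          have s8: "state_inv n E k (Suc t) h8" unfolding state_inv_def
            by (rule exI[of _ "lo + c"], rule exI[of _ "hr h7 rZ - (lo + c)"])
              (use k7 h7 e7(1,3) tab7 c7 in \<open>simp add: h8_def\<close>)
          have Q8: "?Q h8" using s8 k7 IN(3) by (simp add: h8_def)
          show "runs (rLO :=\<^sub>r R rHI ;; rHI :=\<^sub>r R rZ ;; rQLO :=\<^sub>r R rQHI ;; rQHI :=\<^sub>r R rQZ ;;
            rT :=\<^sub>r Minus (R rT) (N 1)) h7 100 ?Q"
            by (rule runs_straight[where Q = ?Q]) (simp, simp, fold h8_def, rule Q8)
        qed (simp_all add: B6_def)
        then show "runs ((rG :=\<^sub>r N 0 ;; rCY :=\<^sub>r N 0) ;; enumerate_loop ;;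
          (rLO :=\<^sub>r R rHI ;; rHI :=\<^sub>r R rZ ;; rQLO :=\<^sub>r R rQHI ;; rQHI :=\<^sub>r R rQZ ;; rT :=\<^sub>r Minus (R rT) (N 1)))
          h5 (50 + B6) ?Q"
          unfolding h6_def by (rule runs_straight_Seq[rotated]) simp_all
      qed (simp_all add: B4_def len)
      then show "runs ((rQH :=\<^sub>r N 0 ;; rQT :=\<^sub>r N 0 ;; rRT :=\<^sub>r N 0 ;; rA :=\<^sub>r N 0) ;;
        search_loop ;; (rG :=\<^sub>r N 0 ;; rCY :=\<^sub>r N 0) ;; enumerate_loop ;;
        (rLO :=\<^sub>r R rHI ;; rHI :=\<^sub>r R rZ ;; rQLO :=\<^sub>r R rQHI ;; rQHI :=\<^sub>r R rQZ ;; rT :=\<^sub>r Minus (R rT) (N 1)))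
        h3 (100 + B4) ?Q"
        unfolding h4_def by (rule runs_straight_Seq[rotated]) simp_all
    qed (simp_all add: B2_def)
  qed (simp_all add: h1 acost_address)
  moreover have "200 + (1000 * (n + 1) + B2) \<le> 100000 * (?m * 2 ^ k + n * (2 ^ k)\<^sup>2)"
    unfolding B2_def B4_def B6_def by (rule snapshot_cost_bound[OF n1 c]) simp
  ultimately show ?thesis by (rule runs_mono)
qed

text \<open>The initial table belongs to the virtual snapshot 0. Its single entry takes its colours
  from the zeros already present in \<open>CS\<close>, and the stored 1 represents cost 0.\<close>

definition main_program :: hcom where
  "main_program =
     (rN :=\<^sub>r Ld IN (N 0) ;; rT :=\<^sub>r Ld IN (N 1) ;; rP :=\<^sub>r N 2 ;;
      rLO :=\<^sub>r N 0 ;; rQLO :=\<^sub>r N 0 ;; rHI :=\<^sub>r N 1 ;; rZ :=\<^sub>r N 1 ;; rQHI :=\<^sub>r R rN ;; rQZ :=\<^sub>r R rN ;;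
      StoreH DD (N 0) (N 1)) ;;
     WhileH (LessH (N 0) (R rT)) snapshot"

text \<open>Lists without repetition are as long as the edge set of their snapshot, which is
  contained in the underlying edge set. This is how every snapshot comes to be charged with
  \<open>|E|\<close>.\<close>

lemma edge_list_length_le:
  assumes G: "temporal_graph {..<n} T E" and Ls: "edge_lists Ls T E" and "t < T"
  shows "length (Ls ! t) \<le> card (underlying_edges T E)"
proof -
  have "underlying_edges T E \<subseteq> Pow {..<n}"
    using G unfolding temporal_graph_def underlying_edges_def by fastforce
  then have "finite (underlying_edges T E)" by (rule finite_subset) simp
  moreover have "E (Suc t) \<subseteq> underlying_edges T E" using \<open>t < T\<close> unfolding underlying_edges_def by fastforce
  moreover have "edge_list (Ls ! t) (E (Suc t))" using Ls \<open>t < T\<close> unfolding edge_lists_def by force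
  ultimately show ?thesis by (simp add: edge_list_length card_mono)
qed

lemma main_program_runs:
  assumes G: "temporal_graph {..<n} T E"
    and comp: "\<forall>t\<in>{1..T}. card (connected_components {..<n} (E t)) \<le> k"
    and Ls: "edge_lists Ls T E"
    and IN: "ha h0 IN 0 = n" "ha h0 IN 1 = T" "stored (ha h0 IN) 2 Ls" and CS: "\<And>a. ha h0 CS a = 0"
  shows "runs main_program h0
    (1000 + (100000 * (card (underlying_edges T E) * 2 ^ k + n * (2 ^ k)\<^sup>2) + 10) * (T + 1))
    (\<lambda>h. hr h rN = n \<and> min_colouring_cost {..<n} T E = (if hr h rG = 0 then None else Some (hr h rG - 1 - n)))"
proof -
  let ?M = "card (underlying_edges T E)"
  let ?B = "100000 * (?M * 2 ^ k + n * (2 ^ k)\<^sup>2)"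
  have n: "1 \<le> n" and T: "1 \<le> T" using G by (auto simp: temporal_graph_def Suc_le_eq)
  let ?I = "\<lambda>h m. m \<le> T \<and> hr h rT = m \<and> state_inv n E k (T - m) h \<and> stored (ha h IN) (hr h rP) (drop (T - m) Ls)"
  define h1 where "h1 = run (rN :=\<^sub>r Ld IN (N 0) ;; rT :=\<^sub>r Ld IN (N 1) ;; rP :=\<^sub>r N 2 ;;
      rLO :=\<^sub>r N 0 ;; rQLO :=\<^sub>r N 0 ;; rHI :=\<^sub>r N 1 ;; rZ :=\<^sub>r N 1 ;; rQHI :=\<^sub>r R rN ;; rQZ :=\<^sub>r R rN ;;
      StoreH DD (N 0) (N 1)) h0"
  have "table n E 0 (ha h1 CS) (ha h1 DD) {0..<0 + 1}"
    using CS by (auto simp: table_def sound_def covered_def admissible_def prefix_cost_def h1_def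
        intro!: exI[of _ "\<lambda>_ _. 0"])
  then have s1: "state_inv n E k 0 h1" unfolding state_inv_def
    by (intro exI[of _ 0] exI[of _ 1]) (use IN in \<open>simp_all add: h1_def\<close>)
  have I1: "?I h1 T" using s1 IN by (simp add: h1_def)
  have "runs (WhileH (LessH (N 0) (R rT)) snapshot) h1 ((?B + 10) * (T + 1))
    (\<lambda>h. hr h rN = n \<and> min_colouring_cost {..<n} T E = (if hr h rG = 0 then None else Some (hr h rG - 1 - n)))"
  proof (rule runs_While[where I = ?I and m = T and K = ?B and K' = "?B + 10"])
    fix h m assume I: "?I h m" and b: "hbval (LessH (N 0) (R rT)) h"
    define t where "t = T - m"
    have m: "0 < m" "t < T" "T - (m - 1) = Suc t" using I b by (auto simp: t_def)
    have len: "length Ls = T" using Ls by (simp add: edge_lists_def)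
    have drop: "drop t Ls = Ls ! t # drop (Suc t) Ls" using m len by (simp add: Cons_nth_drop_Suc)
    have st: "state_inv n E k t h" "stored (ha h IN) (hr h rP) (Ls ! t # drop (Suc t) Ls)"
      using I unfolding t_def[symmetric] drop by auto
    have el: "edge_list (Ls ! t) (E (Suc t))" using Ls m(2) unfolding edge_lists_def by force
    have ed: "\<forall>e\<in>E (Suc t). e \<subseteq> {..<n} \<and> card e = 2" using G m(2) unfolding temporal_graph_def by force
    have cp: "card (connected_components {..<n} (E (Suc t))) \<le> k" using comp m(2) by force
    have "length (Ls ! t) * 2 ^ k \<le> ?M * 2 ^ k" using edge_list_length_le[OF G Ls m(2)] by simp
    then have le: "100000 * (length (Ls ! t) * 2 ^ k + n * (2 ^ k)\<^sup>2) \<le> ?B" by simp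
    show "runs snapshot h ?B (\<lambda>h'. \<exists>m'<m. ?I h' m')"
    proof (rule runs_mono[OF snapshot_runs[OF st el ed cp n] le])
      fix h' assume "state_inv n E k (Suc t) h' \<and> stored (ha h' IN) (hr h' rP) (drop (Suc t) Ls) \<and> hr h' rT = hr h rT - 1"
      then show "\<exists>m'<m. ?I h' m'" using m I by (intro exI[of _ "m - 1"]) auto
    qed
  next
    fix h m assume I: "?I h m" and b: "\<not> hbval (LessH (N 0) (R rT)) h"
    then have "state_inv n E k T h" by auto
    then obtain lo c where "hr h rN = n" and tab: "table n E T (ha h CS) (ha h DD) {lo..<lo + c}"
      and g: "minimum_or_0 (ha h DD ` {lo..<lo + c}) (hr h rG)" using T unfolding state_inv_def by auto
    then show "hr h rN = n \<and> min_colouring_cost {..<n} T E = (if hr h rG = 0 then None else Some (hr h rG - 1 - n))"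
      using min_colouring_cost_from_table[OF G _ _ g] unfolding table_def by blast
  qed (use I1 in simp_all)
  then show ?thesis unfolding main_program_def h1_def
    by (rule runs_straight_Seq[rotated]) (simp_all add: acost_address)
qed

section \<open>Preparing the memory\<close>

abbreviation block :: "(nat \<times> nat) list \<Rightarrow> nat list" where
  "block L \<equiv> length L # concat (map (\<lambda>(u, v). [u, v]) L)"

definition contents :: "nat list \<Rightarrow> nat \<Rightarrow> nat" where
  "contents xs i = (if i < length xs then xs ! i else 0)"

definition encoding_size :: "(nat \<times> nat) list list \<Rightarrow> nat" where
  "encoding_size Ls = (\<Sum>L\<leftarrow>Ls. 1 + 2 * length L)"

lemma length_pairs: "length (concat (map (\<lambda>(u, v). [u, v]) L)) = 2 * length L"
  by (induction L) auto

lemma nth_pairs: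
  "j < length L \<Longrightarrow> concat (map (\<lambda>(u, v). [u, v]) L) ! (2 * j) = fst (L ! j) \<and>
    concat (map (\<lambda>(u, v). [u, v]) L) ! (2 * j + 1) = snd (L ! j)"
proof (induction L arbitrary: j)
  case (Cons e L)
  then show ?case by (cases j) (auto split: prod.splits)
qed simp

lemma contents_append: "contents (xs @ ys) (length xs + i) = contents ys i"
  by (simp add: contents_def nth_append)

lemma contents_prefix: "i < length xs \<Longrightarrow> contents (xs @ ys) i = xs ! i"
  by (simp add: contents_def nth_append)

text \<open>The prefix \<open>xs\<close> is arbitrary so that the induction can move each processed
  block into it.\<close>

lemma stored_contents: "stored (contents (xs @ concat (map block Ls))) (length xs) Ls"
proof (induction Ls arbitrary: xs)
  case (Cons L Ls)
  let ?P = "concat (map (\<lambda>(u, v). [u, v]) L)"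
  let ?zs = "xs @ concat (map block (L # Ls))"
  have "?zs = (xs @ block L) @ concat (map block Ls)" by simp
  moreover have "length (xs @ block L) = length xs + 1 + 2 * length L" by (simp add: length_pairs)
  ultimately have "stored (contents ?zs) (length xs + 1 + 2 * length L) Ls"
    using Cons[of "xs @ block L"] by (simp only:)
  moreover have "contents ?zs (length xs) = length L" by (simp add: contents_def)
  moreover have P: "contents ?zs (length xs + 1 + i) = ?P ! i" if "i < 2 * length L" for i
  proof -
    have "contents ((xs @ [length L]) @ ?P @ concat (map block Ls)) (length (xs @ [length L]) + i)
        = contents (?P @ concat (map block Ls)) i" by (rule contents_append)
    then show ?thesis using contents_prefix[of i ?P] that by (simp add: length_pairs)
  qed
  then have "stored_edges (contents ?zs) (length xs + 1) L"
    unfolding stored_edges_def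
  proof (intro allI impI)
    fix j assume j: "j < length L"
    have "contents ?zs (length xs + 1 + 2 * j) = ?P ! (2 * j)" using j by (intro P) simp
    moreover have "contents ?zs (length xs + 1 + (2 * j + 1)) = ?P ! (2 * j + 1)" using j by (intro P) simp
    ultimately show "contents ?zs (length xs + 1 + 2 * j) = fst (L ! j) \<and>
        contents ?zs (length xs + 1 + 2 * j + 1) = snd (L ! j)"
      using nth_pairs[OF j] by (simp only: add.assoc)
  qed
  ultimately show ?case by simp
qed simp

lemma encode_contents:
  "contents (encode n Ls) 0 = n" "contents (encode n Ls) 1 = length Ls" "stored (contents (encode n Ls)) 2 Ls"
  "length (encode n Ls) = 2 + encoding_size Ls"
proof -
  have e: "encode n Ls = [n, length Ls] @ concat (map block Ls)" by (simp add: encode_def)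
  show "contents (encode n Ls) 0 = n" "contents (encode n Ls) 1 = length Ls"
    unfolding e by (simp_all add: contents_def)
  show "stored (contents (encode n Ls)) 2 Ls"
    using stored_contents[of "[n, length Ls]" Ls] unfolding e by (simp add: numeral_2_eq_2)
  have "length (concat (map block Ls)) = encoding_size Ls"
    unfolding encoding_size_def by (induction Ls) (auto simp: length_pairs)
  then show "length (encode n Ls) = 2 + encoding_size Ls" unfolding e by simp
qed

section \<open>Finding the end of the input\<close>

definition scan_loop :: com where
  "scan_loop = While (Less (Const 0) (Reg 1))
     (Seq (Assign 0 (Add (Add (Reg 0) (Const 1)) (Add (Load (Reg 0)) (Load (Reg 0)))))
       (Assign 1 (Sub (Reg 1) (Const 1))))"

text \<open>The arrays have to start behind the input, whose total length is not given. Jumping over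
  each block by means of its edge count finds the end in time linear in \<open>T\<close>, and
  register 0 is left with the base address.\<close>

lemma scan_loop_exec:
  assumes "stored (mem s) (regs s 0) Ls" "regs s 1 = length Ls"
  shows "\<exists>d s'. exec scan_loop s d s' \<and> d \<le> 20 * length Ls + 3 \<and> mem s' = mem s \<and>
    regs s' 0 = regs s 0 + encoding_size Ls"
  using assms
proof (induction Ls arbitrary: s)
  case Nil
  then have "exec scan_loop s (bcost (Less (Const 0) (Reg 1))) s"
    unfolding scan_loop_def by (intro exec.WhileFalse) simp
  then show ?case by (intro exI[of _ 3] exI[of _ s]) (simp add: encoding_size_def numeral_3_eq_3)
next
  case (Cons L Ls)
  let ?a = "Add (Add (Reg 0) (Const 1)) (Add (Load (Reg 0)) (Load (Reg 0)))" and ?b = "Sub (Reg 1) (Const 1)"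
  define s1 where "s1 = s\<lparr>regs := (regs s)(0 := aval ?a s)\<rparr>"
  define s2 where "s2 = s1\<lparr>regs := (regs s1)(1 := aval ?b s1)\<rparr>"
  have body: "exec (Seq (Assign 0 ?a) (Assign 1 ?b)) s ((acost ?a + 1) + (acost ?b + 1)) s2"
    unfolding s2_def s1_def by (rule exec.Seq[OF exec.Assign exec.Assign])
  have s2: "mem s2 = mem s" "regs s2 0 = regs s 0 + 1 + 2 * length L" "regs s2 1 = length Ls"
    using Cons.prems by (simp_all add: s2_def s1_def)
  then obtain d s' where IH: "exec scan_loop s2 d s'" "d \<le> 20 * length Ls + 3" "mem s' = mem s"
    "regs s' 0 = regs s 0 + 1 + 2 * length L + encoding_size Ls"
    using Cons.IH[of s2] Cons.prems by auto
  have "exec scan_loop s (bcost (Less (Const 0) (Reg 1)) + ((acost ?a + 1) + (acost ?b + 1)) + d) s'"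
    unfolding scan_loop_def
    by (rule exec.WhileTrue[OF _ body IH(1)[unfolded scan_loop_def]]) (use Cons.prems in simp)
  then show ?case using IH
    by (intro exI conjI) (assumption, simp_all add: encoding_size_def)
qed

section \<open>Spreading the input with stride 16\<close>

definition copy_address :: aexp where
  "copy_address = Add (Reg 0) (double (double (double (double (Reg 1)))))"

definition copy_loop :: com where
  "copy_loop = While (Less (Reg 1) (Reg 0))
     (Seq (Store copy_address (Load (Reg 1))) (Assign 1 (Add (Reg 1) (Const 1))))"

text \<open>Sources lie below \<open>l\<close> and targets from \<open>l\<close> on, so no cell is
  overwritten before it is read. The targets are exactly the cells of \<open>IN\<close>, whose code
  is 0; all other cells from \<open>l\<close> on remain 0.\<close>

lemma copy_loop_exec:
  assumes "regs s 0 = l" "regs s 1 + m = l" "\<forall>a<l. mem s a = f a"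
    and "\<forall>a. mem s (l + a) = (if 16 dvd a \<and> a div 16 < regs s 1 then f (a div 16) else 0)"
  shows "\<exists>d s'. exec copy_loop s d s' \<and> d \<le> 100 * m + 3 \<and> regs s' 0 = l \<and>
    (\<forall>a. mem s' (l + a) = (if 16 dvd a \<and> a div 16 < l then f (a div 16) else 0))"
  using assms
proof (induction m arbitrary: s)
  case 0
  then have "exec copy_loop s (bcost (Less (Reg 1) (Reg 0))) s"
    unfolding copy_loop_def by (intro exec.WhileFalse) simp
  then show ?case using 0 by (intro exI[of _ 3] exI[of _ s]) (simp add: numeral_3_eq_3)
next
  case (Suc m)
  let ?b = "Add (Reg 1) (Const 1)" and ?i = "regs s 1"
  define s1 where "s1 = s\<lparr>mem := (mem s)(aval copy_address s := aval (Load (Reg 1)) s)\<rparr>"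
  define s2 where "s2 = s1\<lparr>regs := (regs s1)(1 := aval ?b s1)\<rparr>"
  have body: "exec (Seq (Store copy_address (Load (Reg 1))) (Assign 1 ?b)) s
      ((acost copy_address + acost (Load (Reg 1)) + 1) + (acost ?b + 1)) s2"
    unfolding s2_def s1_def by (rule exec.Seq[OF exec.Store exec.Assign])
  have addr: "aval copy_address s = l + 16 * ?i" using Suc.prems(1) by (simp add: copy_address_def double_def)
  have r: "regs s2 0 = l" "regs s2 1 = Suc ?i" "regs s2 1 + m = l"
    using Suc.prems by (simp_all add: s2_def s1_def)
  have mem2: "mem s2 = (mem s)(l + 16 * ?i := f ?i)"
    using Suc.prems by (simp add: s2_def s1_def addr)
  have low: "\<forall>a<l. mem s2 a = f a" using Suc.prems(3) by (auto simp: mem2)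
  have high: "\<forall>a. mem s2 (l + a) = (if 16 dvd a \<and> a div 16 < regs s2 1 then f (a div 16) else 0)"
    using Suc.prems(4) unfolding mem2 r(2) by (auto simp: less_Suc_eq)
  obtain d s' where IH: "exec copy_loop s2 d s'" "d \<le> 100 * m + 3" "regs s' 0 = l"
    "\<forall>a. mem s' (l + a) = (if 16 dvd a \<and> a div 16 < l then f (a div 16) else 0)"
    using Suc.IH[OF r(1,3) low high] by blast
  have "exec copy_loop s (bcost (Less (Reg 1) (Reg 0)) +
      ((acost copy_address + acost (Load (Reg 1)) + 1) + (acost ?b + 1)) + d) s'"
    unfolding copy_loop_def
    by (rule exec.WhileTrue[OF _ body IH(1)[unfolded copy_loop_def]]) (use Suc.prems in simp)
  then show ?case using IH
    by (intro exI conjI) (assumption, simp_all add: copy_address_def double_def)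
qed

definition prelude :: com where
  "prelude = Seq (Assign 1 (Load (Const 1))) (Seq (Assign 0 (Const 2)) (Seq scan_loop
     (Seq (Assign 1 (Const 0)) copy_loop)))"

lemma prelude_exec:
  assumes xs: "xs = encode n Ls"
  shows "\<exists>d s. exec prelude (initial_state xs) d s \<and> d \<le> 1000 + 20 * length Ls + 100 * encoding_size Ls \<and>
    ha (view s) IN = contents xs \<and> (\<forall>a. ha (view s) CS a = 0)"
proof -
  let ?l = "2 + encoding_size Ls"
  define s0 where "s0 = initial_state xs"
  define s1 where "s1 = s0\<lparr>regs := (regs s0)(1 := aval (Load (Const 1)) s0)\<rparr>"
  define s2 where "s2 = s1\<lparr>regs := (regs s1)(0 := aval (Const 2) s1)\<rparr>"
  have m0: "mem s0 = contents xs" by (simp add: s0_def initial_state_def contents_def fun_eq_iff)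
  have s2: "mem s2 = contents xs" "regs s2 0 = 2" "regs s2 1 = length Ls"
    using encode_contents(2)[of n Ls] by (simp_all add: s2_def s1_def m0 xs)
  then have "stored (mem s2) (regs s2 0) Ls" using encode_contents(3) by (simp add: xs)
  from scan_loop_exec[OF this s2(3)] obtain d3 s3 where
    s3: "exec scan_loop s2 d3 s3" "d3 \<le> 20 * length Ls + 3" "mem s3 = contents xs" "regs s3 0 = ?l"
    using s2 by auto
  define s4 where "s4 = s3\<lparr>regs := (regs s3)(1 := aval (Const 0) s3)\<rparr>"
  have l: "length xs = ?l" by (simp add: xs encode_contents(4))
  have s4: "regs s4 0 = ?l" "regs s4 1 + ?l = ?l" "\<forall>a<?l. mem s4 a = contents xs a"
    "\<forall>a. mem s4 (?l + a) = (if 16 dvd a \<and> a div 16 < regs s4 1 then contents xs (a div 16) else 0)"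
    using s3 l by (simp_all add: s4_def contents_def)
  from copy_loop_exec[OF s4] obtain d5 s5 where s5: "exec copy_loop s4 d5 s5" "d5 \<le> 100 * ?l + 3" "regs s5 0 = ?l"
    "\<forall>a. mem s5 (?l + a) = (if 16 dvd a \<and> a div 16 < ?l then contents xs (a div 16) else 0)" by blast
  have e1: "exec (Assign 1 (Load (Const 1))) s0 (acost (Load (Const 1)) + 1) s1"
    and e2: "exec (Assign 0 (Const 2)) s1 (acost (Const 2) + 1) s2"
    and e4: "exec (Assign 1 (Const 0)) s3 (acost (Const 0) + 1) s4"
    unfolding s1_def s2_def s4_def by (rule exec.Assign)+
  have "exec prelude s0 ((acost (Load (Const 1)) + 1) + ((acost (Const 2) + 1) + (d3 + ((acost (Const 0) + 1) + d5)))) s5"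
    unfolding prelude_def
    by (rule exec.Seq[OF e1 exec.Seq[OF e2 exec.Seq[OF s3(1) exec.Seq[OF e4 s5(1)]]]])
  moreover have "ha (view s5) IN i = contents xs i" for i
    using s5(3,4) l by (simp add: view_def contents_def)
  moreover have "ha (view s5) CS i = 0" for i
  proof -
    \<comment> \<open>The array \<open>CS\<close> has code 7, whereas the copying has touched
      multiples of 16 only.\<close>
    have "\<not> 16 dvd 16 * i + (7 :: nat)" by presburger
    then show ?thesis using s5(3) spec[OF s5(4), of "16 * i + 7"] by (simp add: view_def)
  qed
  ultimately show ?thesis using s3(2) s5(2) unfolding s0_def[symmetric]
    by (intro exI conjI) (assumption, simp_all add: fun_eq_iff)
qed

text \<open>Register 0 can be given up as base address only now, since no array is accessed any
  more.\<close>

definition postlude :: com where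
  "postlude = Seq (Assign 0 (Reg (rcode rG))) (Assign 1 (Sub (Sub (Reg (rcode rG)) (Const 1)) (Reg (rcode rN))))"

lemma postlude_exec:
  "\<exists>s'. exec postlude s 8 s' \<and> result_of s' =
    (if hr (view s) rG = 0 then None else Some (hr (view s) rG - 1 - hr (view s) rN))"
proof -
  let ?a = "Reg (rcode rG)" and ?b = "Sub (Sub (Reg (rcode rG)) (Const 1)) (Reg (rcode rN))"
  define s1 where "s1 = s\<lparr>regs := (regs s)(0 := aval ?a s)\<rparr>"
  define s2 where "s2 = s1\<lparr>regs := (regs s1)(1 := aval ?b s1)\<rparr>"
  have "exec postlude s ((acost ?a + 1) + (acost ?b + 1)) s2"
    unfolding postlude_def s2_def s1_def by (rule exec.Seq[OF exec.Assign exec.Assign])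
  moreover have "(acost ?a + 1) + (acost ?b + 1) = 8" by simp
  ultimately have "exec postlude s 8 s2" by (simp only:)
  moreover have "result_of s2 =
      (if hr (view s) rG = 0 then None else Some (hr (view s) rG - 1 - hr (view s) rN))"
    by (simp add: s2_def s1_def result_of_def view_def)
  ultimately show ?thesis by blast
qed

section \<open>Adding up the running times\<close>

lemma total_cost_bound:
  fixes T M K n s :: nat
  assumes "1 \<le> T" "1 \<le> n" "1 \<le> K" "s \<le> T + 2 * (T * M)"
  shows "(1000 + 20 * T + 100 * s) + ((1000 + (100000 * (M * K + n * K\<^sup>2) + 10) * (T + 1)) + 8)
    \<le> 1000000 * (T * M * K + n * T * K\<^sup>2)"
proof -
  let ?X = "M * K + n * K\<^sup>2"
  have "1 \<le> n * K\<^sup>2" "M \<le> M * K" using assms by simp_all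
  then have X: "1 \<le> ?X" "M \<le> ?X" by linarith+
  have "T * M \<le> T * ?X" using X(2) by (rule mult_le_mono2)
  moreover have "T \<le> T * ?X" using X(1) by simp
  moreover have "(100000 * ?X + 10) * (T + 1) \<le> (100010 * ?X) * (2 * T)"
  proof (rule mult_le_mono)
    have "100000 * x + 10 \<le> 100010 * x" if "1 \<le> x" for x :: nat using that by simp
    then show "100000 * ?X + 10 \<le> 100010 * ?X" using X(1) .
  qed (use assms(1) in simp)
  moreover have "(100010 * ?X) * (2 * T) = 200020 * (T * ?X)" by simp
  ultimately have "(1000 + 20 * T + 100 * s) + ((1000 + (100000 * ?X + 10) * (T + 1)) + 8) \<le> 1000000 * (T * ?X)"
    using assms(1,4) by linarith
  then show ?thesis by (simp add: algebra_simps)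
qed

theorem theorem3:
  "\<exists>(P :: com) (C :: nat).
     \<forall>(n :: nat) (T :: nat) (k :: nat) (E :: nat \<Rightarrow> nat set set) (Ls :: (nat \<times> nat) list list).
       temporal_graph {..<n} T E \<longrightarrow>
       (\<forall>t\<in>{1..T}. card (connected_components {..<n} (E t)) \<le> k) \<longrightarrow>
       edge_lists Ls T E \<longrightarrow>
       computes_within P (encode n Ls) (min_colouring_cost {..<n} T E)
         (C * (T * card (underlying_edges T E) * 2 ^ k + n * T * 2 ^ (2 * k)))"
proof (intro exI allI impI)
  fix n T k E Ls
  assume G: "temporal_graph {..<n} T E"
    and comp: "\<forall>t\<in>{1..T}. card (connected_components {..<n} (E t)) \<le> k"
    and Ls: "edge_lists Ls T E"
  let ?xs = "encode n Ls" and ?M = "card (underlying_edges T E)"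
  have len: "length Ls = T" using Ls by (simp add: edge_lists_def)
  obtain d1 s1 where s1: "exec prelude (initial_state ?xs) d1 s1"
    "d1 \<le> 1000 + 20 * length Ls + 100 * encoding_size Ls"
    "ha (view s1) IN = contents ?xs" "\<And>a. ha (view s1) CS a = 0"
    using prelude_exec[OF refl] by blast
  have IN: "ha (view s1) IN 0 = n" "ha (view s1) IN 1 = T" "stored (ha (view s1) IN) 2 Ls"
    unfolding s1(3) using encode_contents[of n Ls] len by simp_all
  obtain d2 s2 where s2: "exec (compile main_program) s1 d2 s2"
    "d2 \<le> 1000 + (100000 * (?M * 2 ^ k + n * (2 ^ k)\<^sup>2) + 10) * (T + 1)" "hr (view s2) rN = n"
    "min_colouring_cost {..<n} T E = (if hr (view s2) rG = 0 then None else Some (hr (view s2) rG - 1 - n))"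
    using main_program_runs[OF G comp Ls IN s1(4)] unfolding runs_def by blast
  obtain s3 where s3: "exec postlude s2 8 s3" "result_of s3 = min_colouring_cost {..<n} T E"
    using postlude_exec[of s2] unfolding s2(3,4) by blast
  have ex: "exec (Seq prelude (Seq (compile main_program) postlude)) (initial_state ?xs) (d1 + (d2 + 8)) s3"
    using s1(1) s2(1) s3(1) by (intro exec.Seq)
  \<comment> \<open>Preparing the memory is linear in the input size, which has to be expressed
    through \<open>T\<close> and \<open>|E|\<close> to fit under the claimed bound.\<close>
  have size: "encoding_size Ls \<le> T + 2 * (T * ?M)"
  proof -
    have "encoding_size Ls = (\<Sum>t<T. 1 + 2 * length (Ls ! t))"
      unfolding encoding_size_def by (simp add: sum_list_sum_nth len atLeast0LessThan)
    also have "\<dots> \<le> (\<Sum>t<T. 1 + 2 * ?M)"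
      using edge_list_length_le[OF G Ls] by (intro sum_mono) simp
    finally show ?thesis by simp
  qed
  have pos: "1 \<le> T" "1 \<le> n" using G by (auto simp: temporal_graph_def Suc_le_eq)
  have K: "1 \<le> (2 :: nat) ^ k" by simp
  have "d1 + (d2 + 8) \<le> 1000000 * (T * ?M * 2 ^ k + n * T * (2 ^ k)\<^sup>2)"
    using total_cost_bound[OF pos K size] s1(2) s2(2) unfolding len by linarith
  moreover have "((2 :: nat) ^ k)\<^sup>2 = 2 ^ (2 * k)" by (simp add: power_mult mult.commute)
  ultimately have "d1 + (d2 + 8) \<le> 1000000 * (T * ?M * 2 ^ k + n * T * 2 ^ (2 * k))" by simp
  then show "computes_within (Seq prelude (Seq (compile main_program) postlude)) ?xs (min_colouring_cost {..<n} T E)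
         (1000000 * (T * ?M * 2 ^ k + n * T * 2 ^ (2 * k)))"
    unfolding computes_within_def using ex s3(2) by blast
qed

end
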